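(* Let $H_1,H_2$ be Hilbert spaces, let $\mathcal{A}\subset B(H_1)$ and $\mathcal{B}\subset B(H_2)$ be unital operator algebras, and let $\varphi:\mathcal{A}\to\mathcal{B}$ be a unital completely bounded isomorphism. Then there is a function $\varepsilon\mapsto\rho(\varepsilon)\in(0,\infty)$ defined for $\varepsilon>0$ (so that, for the given $\mathcal{A},\mathcal{B},\varphi$, the constant $\rho(\varepsilon)$ depends only on $\varepsilon$) such that for any $\varepsilon>0$ and any finite set $\mathcal{A}_0\subset\mathcal{A}$ there exist invertible operators $X\in B(H_1)$ and $Y\in B(H_2)$ with the following properties. (1) The map $XaX^{-1}\mapsto Y\varphi(a)Y^{-1}$ (from $X\mathcal{A}X^{-1}$ onto $Y\mathcal{B}Y^{-1}$) is a complete contraction, and $$\|XaX^{-1}\|\le (1+\varepsilon)\left(1+\frac{\varepsilon}{\rho(\varepsilon)}\right)\|Y\varphi(a)Y^{-1}\|\quad\text{for every } a\in\mathcal{A}_0.$$ (2) Moreover, if $\mathcal{A}_0$ contains no non-trivial (i.e. non-zero) quasi-nilpotent element, then we have the sharper inequality $$\|XaX^{-1}\|\le \left(1+\frac{\varepsilon}{\rho}\right)\|Y\varphi(a)Y^{-1}\|\quad\text{for every } a\in\mathcal{A}_0,$$ where $\rho=\inf_{a\in\mathcal{A}_0,\,a\neq 0} r(a)$ (with $\varepsilon/\rho$ read as $0$ if $\mathcal{A}_0\subset\{0\}$).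
   Context: A unital operator algebra $\mathcal{A}\subset B(H)$ is a (not necessarily self-adjoint or norm-closed) subalgebra of $B(H)$ containing the identity operator, with the matrix norms on $M_d(\mathcal{A})$ inherited from $M_d(B(H))=B(H^{d})$. A linear map $\psi$ between operator algebras is completely bounded if $\|\psi\|_{cb}=\sup_d\sup\{\|(\psi(a_{ij}))\|:(a_{ij})\in M_d(\mathcal{A}),\|(a_{ij})\|\le1\}<\infty$, and is a complete contraction if $\|\psi\|_{cb}\le 1$. A unital completely bounded isomorphism $\varphi:\mathcal{A}\to\mathcal{B}$ is a bijective unital completely bounded algebra homomorphism whose inverse is also completely bounded. For $a\in\mathcal{A}$, $r(a)$ denotes the spectral radius of $a$ (the radius of the smallest closed disc centred at $0$ containing the spectrum of the operator $a$). An element is quasi-nilpotent if its spectrum is $\{0\}$. *)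

theory Defs
  imports "HOL-Analysis.Analysis"
begin

text \<open>Complex Hilbert spaces. As usual in Isabelle/HOL the space is a type; the real structure of
  \<^class>\<open>real_normed_vector\<close> (and with it the topology) is the restriction of the complex one. The
  inner product is antilinear in the first argument. The zero space is allowed.\<close>

class complex_inner = real_normed_vector +
  fixes scaleC :: "complex \<Rightarrow> 'a \<Rightarrow> 'a"  (infixr "*\<^sub>C" 75)
    and cinner :: "'a \<Rightarrow> 'a \<Rightarrow> complex"
  assumes scaleC_add_right: "c *\<^sub>C (x + y) = c *\<^sub>C x + c *\<^sub>C y"
    and scaleC_add_left: "(c + d) *\<^sub>C x = c *\<^sub>C x + d *\<^sub>C x"
    and scaleC_scaleC: "c *\<^sub>C (d *\<^sub>C x) = (c * d) *\<^sub>C x"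
    and scaleC_of_real: "complex_of_real r *\<^sub>C x = r *\<^sub>R x"
    and cinner_commute: "cinner x y = cnj (cinner y x)"
    and cinner_add_right: "cinner x (y + z) = cinner x y + cinner x z"
    and cinner_scaleC_right: "cinner x (c *\<^sub>C y) = c * cinner x y"
    and cinner_self: "cinner x x = complex_of_real ((norm x)\<^sup>2)"

class complex_hilbert_space = complex_inner + complete_space

instantiation complex :: complex_hilbert_space
begin

definition scaleC_complex :: "complex \<Rightarrow> complex \<Rightarrow> complex"
  where "scaleC_complex c x = c * x"

definition cinner_complex :: "complex \<Rightarrow> complex \<Rightarrow> complex"
  where "cinner_complex x y = cnj x * y"

instance
proof
  fix x :: complex
  show "cinner x x = complex_of_real ((norm x)\<^sup>2)"
    by (simp only: cinner_complex_def complex_norm_square mult.commute)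
qed (auto simp: scaleC_complex_def cinner_complex_def algebra_simps scaleR_conv_of_real)

end

lemma norm_scaleC: "norm (c *\<^sub>C x) = cmod c * norm (x :: 'a::complex_inner)"
proof -
  have "cinner (c *\<^sub>C x) (c *\<^sub>C x) = c * cnj (cinner x (c *\<^sub>C x))"
    using cinner_commute[of "c *\<^sub>C x" x] by (simp add: cinner_scaleC_right)
  also have "\<dots> = c * cnj c * complex_of_real ((norm x)\<^sup>2)"
    by (simp add: cinner_scaleC_right cinner_self)
  also have "\<dots> = complex_of_real ((cmod c * norm x)\<^sup>2)"
    by (simp only: complex_norm_square[symmetric] of_real_mult[symmetric] power_mult_distrib)
  finally have "(norm (c *\<^sub>C x))\<^sup>2 = (cmod c * norm x)\<^sup>2"
    unfolding cinner_self of_real_eq_iff .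
  then show ?thesis
    by (simp add: power2_eq_iff_nonneg)
qed

lemma bounded_linear_scaleC: "bounded_linear (\<lambda>x :: 'a::complex_inner. c *\<^sub>C x)"
proof (rule bounded_linear_intro[where K = "cmod c"])
  show "c *\<^sub>C (r *\<^sub>R x) = r *\<^sub>R (c *\<^sub>C x)" for r and x :: 'a
    by (simp add: scaleC_of_real[symmetric] scaleC_scaleC mult.commute)
qed (simp_all add: scaleC_add_right norm_scaleC mult.commute)

text \<open>\<open>B(H)\<close>: the library type of bounded operators only provides real linearity.\<close>

definition bounded_operators :: "('a::complex_hilbert_space \<Rightarrow>\<^sub>L 'a) set"
  where "bounded_operators = {T :: 'a \<Rightarrow>\<^sub>L 'a. \<forall>c x. T (c *\<^sub>C x) = c *\<^sub>C T x}"

definition scaleC_op :: "complex \<Rightarrow> ('a::complex_hilbert_space \<Rightarrow>\<^sub>L 'a) \<Rightarrow> 'a \<Rightarrow>\<^sub>L 'a"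
  where "scaleC_op c T = Blinfun (\<lambda>x. c *\<^sub>C T x)"

lemma blinfun_apply_scaleC_op: "blinfun_apply (scaleC_op c T) x = c *\<^sub>C T x"
  unfolding scaleC_op_def
  by (subst bounded_linear_Blinfun_apply)
     (auto intro: bounded_linear_compose[OF bounded_linear_scaleC blinfun.bounded_linear_right])

definition is_inverse_op ::
    "('a::complex_hilbert_space \<Rightarrow>\<^sub>L 'a) \<Rightarrow> ('a \<Rightarrow>\<^sub>L 'a) \<Rightarrow> bool"
  where "is_inverse_op T S \<longleftrightarrow>
    S \<in> bounded_operators \<and> T o\<^sub>L S = id_blinfun \<and> S o\<^sub>L T = id_blinfun"

definition invertible_op :: "('a::complex_hilbert_space \<Rightarrow>\<^sub>L 'a) \<Rightarrow> bool"
  where "invertible_op T \<longleftrightarrow> T \<in> bounded_operators \<and> (\<exists>S. is_inverse_op T S)"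

definition inverse_op :: "('a::complex_hilbert_space \<Rightarrow>\<^sub>L 'a) \<Rightarrow> 'a \<Rightarrow>\<^sub>L 'a"
  where "inverse_op T = (THE S. is_inverse_op T S)"

lemma inverse_op_eq:
  assumes "is_inverse_op T S"
  shows "inverse_op T = S"
  unfolding inverse_op_def
proof (rule the_equality)
  show "is_inverse_op T S" by (fact assms)
next
  fix R assume R: "is_inverse_op T R"
  have "R = (S o\<^sub>L T) o\<^sub>L R"
    using assms by (auto simp: is_inverse_op_def intro: blinfun_eqI)
  also have "\<dots> = S o\<^sub>L (T o\<^sub>L R)"
    by (auto intro: blinfun_eqI)
  also have "\<dots> = S"
    using R by (auto simp: is_inverse_op_def intro: blinfun_eqI)
  finally show "R = S" .
qed

definition op_spectrum :: "('a::complex_hilbert_space \<Rightarrow>\<^sub>L 'a) \<Rightarrow> complex set"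
  where "op_spectrum T = {z. \<not> invertible_op (T - scaleC_op z id_blinfun)}"

definition spectral_radius_op :: "('a::complex_hilbert_space \<Rightarrow>\<^sub>L 'a) \<Rightarrow> real"
  where "spectral_radius_op T = Inf {r. 0 \<le> r \<and> op_spectrum T \<subseteq> cball 0 r}"

definition quasinilpotent_op :: "('a::complex_hilbert_space \<Rightarrow>\<^sub>L 'a) \<Rightarrow> bool"
  where "quasinilpotent_op T \<longleftrightarrow> op_spectrum T = {0}"

definition unital_operator_algebra :: "('a::complex_hilbert_space \<Rightarrow>\<^sub>L 'a) set \<Rightarrow> bool"
  where "unital_operator_algebra A \<longleftrightarrow>
    A \<subseteq> bounded_operators \<and> id_blinfun \<in> A \<and>
    (\<forall>S\<in>A. \<forall>T\<in>A. S + T \<in> A) \<and> (\<forall>c. \<forall>T\<in>A. scaleC_op c T \<in> A) \<and>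
    (\<forall>S\<in>A. \<forall>T\<in>A. S o\<^sub>L T \<in> A)"

text \<open>A \<open>d \<times> d\<close> matrix is a function of two indices, of which only the values at indices below \<open>d\<close>
  matter; likewise a vector of \<open>H\<^sup>d\<close> is a function of one index. \<open>op_matrix_norm\<close> is the operator norm
  on \<open>H\<^sup>d\<close>, spelled out as in \<^const>\<open>onorm\<close>. The set of quotients is bounded above, and division by
  zero yields zero.\<close>

definition op_matrices :: "nat \<Rightarrow> ('a::complex_hilbert_space \<Rightarrow>\<^sub>L 'a) set \<Rightarrow>
    (nat \<Rightarrow> nat \<Rightarrow> 'a \<Rightarrow>\<^sub>L 'a) set"
  where "op_matrices d A = {a. \<forall>i<d. \<forall>j<d. a i j \<in> A}"

definition op_matrix_norm :: "nat \<Rightarrow> (nat \<Rightarrow> nat \<Rightarrow> 'a::complex_hilbert_space \<Rightarrow>\<^sub>L 'a) \<Rightarrow> real"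
  where "op_matrix_norm d a =
    (SUP x. L2_set (\<lambda>i. norm (\<Sum>j<d. a i j (x j))) {..<d} / L2_set (\<lambda>j. norm (x j)) {..<d})"

definition cb_norm :: "('a::complex_hilbert_space \<Rightarrow>\<^sub>L 'a) set \<Rightarrow>
    (('a \<Rightarrow>\<^sub>L 'a) \<Rightarrow> 'b::complex_hilbert_space \<Rightarrow>\<^sub>L 'b) \<Rightarrow> ennreal"
  where "cb_norm A \<psi> =
    (SUP d\<in>{1..}. SUP a\<in>{a \<in> op_matrices d A. op_matrix_norm d a \<le> 1}.
      ennreal (op_matrix_norm d (\<lambda>i j. \<psi> (a i j))))"

definition op_linear_map :: "('a::complex_hilbert_space \<Rightarrow>\<^sub>L 'a) set \<Rightarrow>
    ('b::complex_hilbert_space \<Rightarrow>\<^sub>L 'b) set \<Rightarrow> (('a \<Rightarrow>\<^sub>L 'a) \<Rightarrow> 'b \<Rightarrow>\<^sub>L 'b) \<Rightarrow> bool"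
  where "op_linear_map A B \<psi> \<longleftrightarrow>
    \<psi> ` A \<subseteq> B \<and> (\<forall>S\<in>A. \<forall>T\<in>A. \<psi> (S + T) = \<psi> S + \<psi> T) \<and>
    (\<forall>c. \<forall>T\<in>A. \<psi> (scaleC_op c T) = scaleC_op c (\<psi> T))"

definition completely_bounded_map :: "('a::complex_hilbert_space \<Rightarrow>\<^sub>L 'a) set \<Rightarrow>
    ('b::complex_hilbert_space \<Rightarrow>\<^sub>L 'b) set \<Rightarrow> (('a \<Rightarrow>\<^sub>L 'a) \<Rightarrow> 'b \<Rightarrow>\<^sub>L 'b) \<Rightarrow> bool"
  where "completely_bounded_map A B \<psi> \<longleftrightarrow> op_linear_map A B \<psi> \<and> cb_norm A \<psi> < \<infinity>"

definition complete_contraction :: "('a::complex_hilbert_space \<Rightarrow>\<^sub>L 'a) set \<Rightarrow>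
    ('b::complex_hilbert_space \<Rightarrow>\<^sub>L 'b) set \<Rightarrow> (('a \<Rightarrow>\<^sub>L 'a) \<Rightarrow> 'b \<Rightarrow>\<^sub>L 'b) \<Rightarrow> bool"
  where "complete_contraction A B \<psi> \<longleftrightarrow> op_linear_map A B \<psi> \<and> cb_norm A \<psi> \<le> 1"

definition unital_cb_isomorphism :: "('a::complex_hilbert_space \<Rightarrow>\<^sub>L 'a) set \<Rightarrow>
    ('b::complex_hilbert_space \<Rightarrow>\<^sub>L 'b) set \<Rightarrow> (('a \<Rightarrow>\<^sub>L 'a) \<Rightarrow> 'b \<Rightarrow>\<^sub>L 'b) \<Rightarrow> bool"
  where "unital_cb_isomorphism A B \<phi> \<longleftrightarrow>
    bij_betw \<phi> A B \<and> \<phi> id_blinfun = id_blinfun \<and>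
    (\<forall>S\<in>A. \<forall>T\<in>A. \<phi> (S o\<^sub>L T) = \<phi> S o\<^sub>L \<phi> T) \<and>
    completely_bounded_map A B \<phi> \<and> completely_bounded_map B A (the_inv_into A \<phi>)"

definition similarity :: "('a::complex_hilbert_space \<Rightarrow>\<^sub>L 'a) \<Rightarrow> ('a \<Rightarrow>\<^sub>L 'a) \<Rightarrow> 'a \<Rightarrow>\<^sub>L 'a"
  where "similarity X T = X o\<^sub>L T o\<^sub>L inverse_op X"

text \<open>The map \<open>X a X\<^sup>-\<^sup>1 \<mapsto> Y \<phi>(a) Y\<^sup>-\<^sup>1\<close>, where \<open>a\<close> is recovered from
  \<open>T = X a X\<^sup>-\<^sup>1\<close> as \<open>X\<^sup>-\<^sup>1 T X\<close>.\<close>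

definition similarity_map :: "('a::complex_hilbert_space \<Rightarrow>\<^sub>L 'a) \<Rightarrow>
    ('b::complex_hilbert_space \<Rightarrow>\<^sub>L 'b) \<Rightarrow> (('a \<Rightarrow>\<^sub>L 'a) \<Rightarrow> 'b \<Rightarrow>\<^sub>L 'b) \<Rightarrow>
    ('a \<Rightarrow>\<^sub>L 'a) \<Rightarrow> 'b \<Rightarrow>\<^sub>L 'b"
  where "similarity_map X Y \<phi> T = similarity Y (\<phi> (inverse_op X o\<^sub>L T o\<^sub>L X))"

lemma similarity_map_similarity:
  assumes "invertible_op X"
  shows "similarity_map X Y \<phi> (similarity X a) = similarity Y (\<phi> a)"
proof -
  obtain S where S: "is_inverse_op X S"
    using assms by (auto simp: invertible_op_def)
  then have "blinfun_apply S (blinfun_apply X x) = x" for x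
    by (metis blinfun_apply_blinfun_compose blinfun_apply_id_blinfun id_apply is_inverse_op_def)
  then have "S o\<^sub>L (X o\<^sub>L a o\<^sub>L S) o\<^sub>L X = a"
    by (auto intro: blinfun_eqI)
  then show ?thesis
    by (simp add: similarity_map_def similarity_def inverse_op_eq[OF S])
qed

end

theory Submission
  imports Defs "HOL-Complex_Analysis.Cauchy_Integral_Formula"
begin

text \<open>
  The proof is a zigzag between the two algebras. By Paulsen's theorem a unital completely bounded
  homomorphism of an operator algebra becomes completely contractive after a similarity of the target
  space (\<open>contractive_similarity_exists\<close>). Applied in turn to \<open>\<phi>\<close> and to its inverse, starting with
  \<open>X\<^sub>0 = 1\<close>, it yields \<open>X\<^sub>0, Y\<^sub>0, X\<^sub>1, Y\<^sub>1, \<dots>\<close> such that each of the operator algebra structures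
  \<open>\<parallel>X\<^sub>n a X\<^sub>n\<^sup>-\<^sup>1\<parallel>\<close> and \<open>\<parallel>Y\<^sub>n \<phi>(a) Y\<^sub>n\<^sup>-\<^sup>1\<parallel>\<close> on \<open>A\<close> is dominated, at all matrix levels, by the preceding one
  (\<open>alternating_similarities\<close>). For a single \<open>a\<close> the two norms form one interlaced decreasing sequence,
  hence their difference tends to zero, for finitely many \<open>a\<close> simultaneously. Since a similarity does not
  change the spectrum, all these norms are at least \<open>r(a)\<close>, so that a small additive error is a small relative
  error as soon as \<open>r(a)\<close> is bounded below by \<open>\<rho> > 0\<close>; this is the second inequality. When \<open>A\<^sub>0\<close> contains
  no non-zero quasi-nilpotent element, taking the additive error below \<open>\<epsilon> \<rho>\<close> as well gives even the
  factor \<open>1 + \<epsilon>\<close> in the first inequality. In the remaining case \<open>(X\<^sub>0, Y\<^sub>0)\<close> will do: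
  \<open>\<parallel>a\<parallel> \<le> \<parallel>X\<^sub>1\<^sup>-\<^sup>1\<parallel> \<parallel>X\<^sub>1\<parallel> \<parallel>X\<^sub>1 a X\<^sub>1\<^sup>-\<^sup>1\<parallel> \<le> \<parallel>X\<^sub>1\<^sup>-\<^sup>1\<parallel> \<parallel>X\<^sub>1\<parallel> \<parallel>Y\<^sub>0 \<phi>(a) Y\<^sub>0\<^sup>-\<^sup>1\<parallel>\<close>, and \<open>\<rho>(\<epsilon>)\<close>
  may be chosen so small that \<open>\<epsilon> / \<rho>(\<epsilon>)\<close> exceeds this constant. That \<open>r(a) > 0\<close> for the other elements
  rests on the spectrum being non-empty, which is Liouville's theorem for the resolvent.

  Paulsen's theorem for \<open>\<psi> : A \<rightarrow> B(H\<^sub>2)\<close> asks for an equivalent Hilbert space norm on \<open>H\<^sub>2\<close> for which all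
  contractive matrices over \<open>A\<close> act contractively through \<open>\<psi>\<close>. The matrices over \<open>A\<close> act contractively
  on \<open>A \<otimes> H\<^sub>2\<close> for every seminorm
  \<open>\<Sum> a\<^sub>k \<otimes> h\<^sub>k \<mapsto> \<parallel>\<Sum> a\<^sub>k V h\<^sub>k\<parallel>\<close>, where \<open>V : H\<^sub>2 \<rightarrow> H\<^sub>1\<close> is linear, and therefore for
  every square root of a positive linear functional applied to the squares of these seminorms, as functions of
  \<open>V\<close>. The Hahn-Banach theorem provides a functional for which the Hilbert seminorm so obtained dominates
  \<open>\<Sum> a\<^sub>k \<otimes> h\<^sub>k \<mapsto> \<parallel>\<Sum> \<psi>(a\<^sub>k) h\<^sub>k\<parallel>\<close> and is bounded on \<open>1 \<otimes> H\<^sub>2\<close> (\<open>dominating_form\<close>); the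
  condition for its existence is where complete boundedness enters (\<open>domination\<close>). The quotient seminorm on
  \<open>H\<^sub>2\<close> is the required norm (\<open>quadratic_norm_exists\<close>). The parallelogram law, Riesz representation and a
  positive square root turn it into the norm \<open>\<parallel>Y h\<parallel>\<close> for an invertible operator \<open>Y\<close>
  (\<open>norm_transporting_operator\<close>).
\<close>

section \<open>Quadratic norms on a Hilbert space\<close>

instance complex_hilbert_space \<subseteq> banach ..

interpretation complex_space: vector_space "scaleC :: complex \<Rightarrow> 'a::complex_inner \<Rightarrow> 'a"
  by unfold_locales
    (simp_all add: scaleC_add_right scaleC_add_left scaleC_scaleC scaleC_of_real[of 1, simplified])

text \<open>The real part of the inner product already determines norms and adjoints of complex-linear operators, and it
  is symmetric and real bilinear; all estimates below are made with it.\<close>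

definition rinner :: "'a::complex_inner \<Rightarrow> 'a \<Rightarrow> real"
  where "rinner x y = Re (cinner x y)"

lemma cinner_add_left: "cinner (x + y) z = cinner x z + cinner y (z :: 'a::complex_inner)"
  by (metis cinner_commute cinner_add_right complex_cnj_add)

lemma cinner_scaleC_left: "cinner (c *\<^sub>C x) y = cnj c * cinner x (y :: 'a::complex_inner)"
  by (metis cinner_commute cinner_scaleC_right complex_cnj_mult)

lemma rinner_self: "rinner x x = (norm x)\<^sup>2"
  by (simp add: rinner_def cinner_self)

lemma rinner_commute: "rinner x y = rinner y x"
  by (metis rinner_def cinner_commute complex_cnj(1) cnj.simps(1))

lemma norm_add_sq: "(norm (x + y))\<^sup>2 = (norm x)\<^sup>2 + 2 * rinner x y + (norm (y :: 'a::complex_inner))\<^sup>2"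
  using rinner_commute[of x y]
  unfolding rinner_self[symmetric]
  by (simp add: rinner_def cinner_add_left cinner_add_right)

lemma rinner_scaleR_right: "rinner x (r *\<^sub>R y) = r * rinner x y"
  by (simp add: rinner_def scaleC_of_real[symmetric] cinner_scaleC_right)

lemma rinner_le: "rinner x y \<le> norm x * norm y"
proof -
  have "(norm (x + y))\<^sup>2 \<le> (norm x + norm y)\<^sup>2"
    by (intro power_mono norm_triangle_ineq norm_ge_zero)
  then show ?thesis
    unfolding norm_add_sq power2_sum by simp
qed

lemma bounded_bilinear_rinner: "bounded_bilinear (rinner :: 'a::complex_inner \<Rightarrow> _)"
proof
  show "rinner (a + a') b = rinner a b + rinner a' b" for a a' b :: 'a
    by (simp add: rinner_def cinner_add_left)
  show "rinner a (b + b') = rinner a b + rinner a b'" for a b b' :: 'a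
    by (simp add: rinner_def cinner_add_right)
  show "rinner a (r *\<^sub>R b) = r *\<^sub>R rinner a b" for r and a b :: 'a
    by (simp add: rinner_scaleR_right)
  show "rinner (r *\<^sub>R a) b = r *\<^sub>R rinner a b" for r and a b :: 'a
    by (metis rinner_commute rinner_scaleR_right real_scaleR_def)
  have "\<bar>rinner a b\<bar> \<le> norm a * norm b" for a b :: 'a
    using rinner_le[of a b] rinner_le[of a "- b"] rinner_scaleR_right[of a "-1" b] by simp
  then show "\<exists>K. \<forall>a b :: 'a. norm (rinner a b) \<le> norm a * norm b * K"
    by (intro exI[of _ 1]) simp
qed

interpretation blinfun_compose: bounded_bilinear "blinfun_compose"
  by (rule bounded_bilinear_blinfun_compose)

lemma blinfun_compose_id [simp]: "T o\<^sub>L id_blinfun = T" "id_blinfun o\<^sub>L T = T"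
  by (auto intro: blinfun_eqI)

lemma blinfun_compose_assoc: "(R o\<^sub>L S) o\<^sub>L T = R o\<^sub>L (S o\<^sub>L T)"
  by (auto intro: blinfun_eqI)

interpretation rinner: bounded_bilinear rinner
  by (rule bounded_bilinear_rinner)

lemma norm_diff_sq: "(norm (x - y))\<^sup>2 = (norm x)\<^sup>2 - 2 * rinner x y + (norm (y :: 'a::complex_inner))\<^sup>2"
  using norm_add_sq[of x "- y"] by (simp add: rinner.minus_right)

lemma parallelogram:
  "(norm (x + y))\<^sup>2 + (norm (x - y))\<^sup>2 = 2 * (norm x)\<^sup>2 + 2 * (norm (y :: 'a::complex_inner))\<^sup>2"
  by (simp add: norm_add_sq norm_diff_sq)

text \<open>The functional \<open>f\<close> is represented by the minimiser of \<open>J(x) = \<parallel>x\<parallel>\<^sup>2 - 2 f(x)\<close>: minimising sequences are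
  Cauchy by the parallelogram law, and the derivative of \<open>J\<close> at the minimiser \<open>y\<close> in direction \<open>z\<close> is
  \<open>2 (\<langle>y, z\<rangle> - f(z))\<close>.\<close>

lemma riesz_representation:
  fixes f :: "'a::complex_hilbert_space \<Rightarrow> real"
  assumes f: "bounded_linear f"
  shows "\<exists>y. \<forall>x. f x = rinner y x"
proof -
  interpret f: bounded_linear f by (fact f)
  define J where "J x = (norm x)\<^sup>2 - 2 * f x" for x
  obtain c where c: "\<bar>f x\<bar> \<le> norm x * c" for x
    using f.bounded by auto
  have J_ge: "J x \<ge> - c\<^sup>2" for x
  proof -
    have "0 \<le> (norm x - c)\<^sup>2" by simp
    then show ?thesis
      using c[of x] by (simp add: J_def power2_diff)
  qed
  define m where "m = Inf (range J)"
  have bdd: "bdd_below (range J)"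
    using J_ge by (auto simp: bdd_below_def)
  have m_le: "m \<le> J x" for x
    unfolding m_def by (rule cInf_lower[OF _ bdd]) simp
  have "\<exists>x. J x < m + 1 / real (Suc n)" for n
    using cInf_lessD[of "range J" "m + 1 / real (Suc n)"] by (auto simp: m_def)
  then obtain x where x: "J (x n) < m + 1 / real (Suc n)" for n
    by metis
  have dist: "(norm (x k - x l))\<^sup>2 \<le> 2 / real (Suc k) + 2 / real (Suc l)" for k l
  proof -
    have "J ((1/2) *\<^sub>R (x k + x l)) = (norm (x k + x l))\<^sup>2 / 4 - f (x k) - f (x l)"
      unfolding J_def f.scaleR f.add norm_scaleR power_mult_distrib by (simp add: power_divide add_divide_distrib)
    then have "(norm (x k - x l))\<^sup>2 = 2 * J (x k) + 2 * J (x l) - 4 * J ((1/2) *\<^sub>R (x k + x l))"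
      using parallelogram[of "x k" "x l"] by (simp add: J_def)
    moreover have "2 * J (x k) < 2 * m + 2 / real (Suc k)" "2 * J (x l) < 2 * m + 2 / real (Suc l)"
      using x[of k] x[of l] by simp_all
    ultimately show ?thesis
      using m_le[of "(1/2) *\<^sub>R (x k + x l)"] by linarith
  qed
  have "Cauchy x"
  proof (rule metric_CauchyI)
    fix e :: real assume "0 < e"
    then obtain N where N: "4 / e\<^sup>2 < real N"
      using reals_Archimedean2 by blast
    show "\<exists>M. \<forall>k\<ge>M. \<forall>l\<ge>M. dist (x k) (x l) < e"
    proof (intro exI allI impI)
      fix k l assume "N \<le> k" "N \<le> l"
      have "4 / e\<^sup>2 > 0" using \<open>0 < e\<close> by simp
      then have "real N > 0" using N by linarith
      have "2 / real (Suc k) + 2 / real (Suc l) \<le> 2 / real N + 2 / real N"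
        using \<open>N \<le> k\<close> \<open>N \<le> l\<close> \<open>real N > 0\<close> by (intro add_mono divide_left_mono) auto
      also have "\<dots> < e\<^sup>2"
        using N \<open>0 < e\<close> \<open>real N > 0\<close> by (simp add: field_simps)
      finally have "(norm (x k - x l))\<^sup>2 < e\<^sup>2"
        using dist[of k l] by linarith
      then show "dist (x k) (x l) < e"
        using \<open>0 < e\<close> by (simp add: dist_norm power_less_imp_less_base)
    qed
  qed
  then obtain y where y: "x \<longlonglongrightarrow> y"
    using Cauchy_convergent convergent_def by blast
  have "(\<lambda>n. J (x n)) \<longlonglongrightarrow> J y"
    unfolding J_def by (intro tendsto_intros y f.tendsto)
  moreover have "(\<lambda>n. m + 1 / real (Suc n)) \<longlonglongrightarrow> m + 0"
    by (intro tendsto_intros LIMSEQ_Suc lim_const_over_n[of 1, unfolded of_real_1])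
  ultimately have "J y \<le> m + 0"
    by (rule LIMSEQ_le) (use x in \<open>auto intro: less_imp_le\<close>)
  then have min: "J y \<le> J z" for z
    using m_le[of z] by simp
  have "f z = rinner y z" for z
  proof -
    define b where "b = rinner y z - f z"
    have *: "0 \<le> 2 * t * b + t\<^sup>2 * (norm z)\<^sup>2" for t
    proof -
      have "J (y + t *\<^sub>R z) = J y + (2 * t * b + t\<^sup>2 * (norm z)\<^sup>2)"
        by (simp add: J_def b_def norm_add_sq f.add f.scaleR rinner.scaleR_right power_mult_distrib algebra_simps)
      with min[of "y + t *\<^sub>R z"] show ?thesis by linarith
    qed
    have "b = 0"
    proof (rule ccontr)
      assume "b \<noteq> 0"
      define s where "s = 1 + (norm z)\<^sup>2"
      have "s > 0" by (simp add: s_def add_pos_nonneg)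
      \<comment> \<open>The step \<open>t = - b / s\<close>, with \<open>s > \<parallel>z\<parallel>\<^sup>2 / 2\<close>, would decrease \<open>J\<close> below its minimum.\<close>
      have "2 * (- b / s) * b + (- b / s)\<^sup>2 * (norm z)\<^sup>2 < 2 * (- b / s) * b + (- b / s)\<^sup>2 * (2 * s)"
        using \<open>b \<noteq> 0\<close> \<open>s > 0\<close> by (intro add_strict_left_mono mult_strict_left_mono)
          (auto simp: s_def intro: add_pos_nonneg)
      also have "\<dots> = 0"
        using \<open>s > 0\<close> by (simp add: power2_eq_square field_simps)
      finally show False
        using *[of "- b / s"] by linarith
    qed
    then show ?thesis by (simp add: b_def)
  qed
  then show ?thesis by blast
qed

text \<open>The additive function \<open>g(r) - r g(1)\<close> vanishes at the integers, so it is periodic and bounded on the whole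
  line; a bounded additive function is zero.\<close>

lemma additive_bounded_on_interval_imp_linear:
  fixes g :: "real \<Rightarrow> real"
  assumes add: "\<And>r s. g (r + s) = g r + g s"
    and bound: "\<And>r. \<bar>r\<bar> \<le> 1 \<Longrightarrow> \<bar>g r\<bar> \<le> C"
  shows "g r = r * g 1"
proof -
  interpret g: additive g by standard (fact add)
  have nat: "g (real n * s) = real n * g s" for n s
    by (induction n) (simp_all add: g.zero distrib_right g.add)
  have bd: "\<bar>g s - s * g 1\<bar> \<le> 2 * C" for s
  proof -
    have int: "g (of_int k) = of_int k * g 1" for k :: int
    proof (cases k)
      case (nonneg n) then show ?thesis using nat[of n 1] by simp
    next
      case (neg n)
      have "g (of_int k) = - g (real (Suc n) * 1)"
        unfolding neg g.minus[symmetric] by simp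
      then show ?thesis
        unfolding nat neg by (simp add: algebra_simps)
    qed
    have fr: "0 \<le> frac s" "frac s \<le> 1" by (simp_all add: less_imp_le[OF frac_lt_1])
    have "g s = g (of_int \<lfloor>s\<rfloor>) + g (frac s)"
      by (metis add frac_def add.commute diff_add_cancel)
    then have "g s - s * g 1 = g (frac s) - frac s * g 1"
      by (simp add: int frac_def algebra_simps)
    moreover have "\<bar>g (frac s)\<bar> \<le> C" "\<bar>frac s\<bar> * \<bar>g 1\<bar> \<le> 1 * C"
      by (intro bound mult_mono; use fr in simp)+
    ultimately show ?thesis
      unfolding abs_mult[symmetric] by linarith
  qed
  have "real n * \<bar>g r - r * g 1\<bar> \<le> 2 * C" for n
  proof -
    have "real n * (g r - r * g 1) = g (real n * r) - (real n * r) * g 1"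
      unfolding nat by (simp add: algebra_simps)
    then show ?thesis
      using bd[of "real n * r"] by (metis abs_mult abs_of_nat)
  qed
  then have "\<bar>g r - r * g 1\<bar> = 0"
    by (metis abs_ge_zero ex_less_of_nat_mult linorder_not_less order_le_less)
  then show ?thesis by simp
qed

lemma bounded_operators_add: "S \<in> bounded_operators \<Longrightarrow> T \<in> bounded_operators \<Longrightarrow> S + T \<in> bounded_operators"
  by (simp add: bounded_operators_def blinfun.add_left scaleC_add_right)

lemma bounded_operators_diff: "S \<in> bounded_operators \<Longrightarrow> T \<in> bounded_operators \<Longrightarrow> S - T \<in> bounded_operators"
  by (simp add: bounded_operators_def blinfun.diff_left complex_space.scale_right_diff_distrib)

lemma bounded_operators_scaleR: "T \<in> bounded_operators \<Longrightarrow> r *\<^sub>R T \<in> bounded_operators"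
  by (simp add: bounded_operators_def blinfun.scaleR_left scaleC_of_real[symmetric] scaleC_scaleC mult.commute)

lemma bounded_operators_compose: "S \<in> bounded_operators \<Longrightarrow> T \<in> bounded_operators \<Longrightarrow> S o\<^sub>L T \<in> bounded_operators"
  by (simp add: bounded_operators_def)

lemma bounded_operators_id: "id_blinfun \<in> bounded_operators"
  by (simp add: bounded_operators_def)

lemma bounded_operators_zero: "0 \<in> bounded_operators"
  by (simp add: bounded_operators_def)

lemma bounded_operators_scaleC_op: "T \<in> bounded_operators \<Longrightarrow> scaleC_op c T \<in> bounded_operators"
  by (simp add: bounded_operators_def blinfun_apply_scaleC_op scaleC_scaleC mult.commute)

lemma closed_bounded_operators: "closed (bounded_operators :: ('a::complex_hilbert_space \<Rightarrow>\<^sub>L 'a) set)"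
  unfolding bounded_operators_def
  by (intro closed_Collect_all closed_Collect_eq bounded_linear.continuous_on[OF bounded_linear_scaleC]
      continuous_intros)

text \<open>Right and left inverses are the fixed points of the contractions \<open>R \<mapsto> 1 + Z R\<close> and \<open>L \<mapsto> 1 + L Z\<close> (the
  Neumann series in disguise), and a left and a right inverse coincide.\<close>

lemma invertible_op_id_minus:
  fixes Z :: "'a::complex_hilbert_space \<Rightarrow>\<^sub>L 'a"
  assumes Z: "Z \<in> bounded_operators" and lt: "norm Z < 1"
  shows "invertible_op (id_blinfun - Z)"
proof -
  have c: "complete (bounded_operators :: ('a \<Rightarrow>\<^sub>L 'a) set)"
    using closed_bounded_operators complete_eq_closed by blast
  have "\<exists>!R\<in>bounded_operators. id_blinfun + (Z o\<^sub>L R) = R"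
  proof (rule Banach_fix[OF c _ norm_ge_zero lt])
    show "dist (id_blinfun + (Z o\<^sub>L R)) (id_blinfun + (Z o\<^sub>L S)) \<le> norm Z * dist R S" for R S
      by (simp add: dist_norm norm_blinfun_compose flip: blinfun_compose.diff_right)
  qed (use Z in \<open>auto intro: bounded_operators_add bounded_operators_compose bounded_operators_id\<close>)
  then obtain R where R: "R \<in> bounded_operators" "id_blinfun + (Z o\<^sub>L R) = R"
    by blast
  have "\<exists>!L\<in>bounded_operators. id_blinfun + (L o\<^sub>L Z) = L"
  proof (rule Banach_fix[OF c _ norm_ge_zero lt])
    show "dist (id_blinfun + (R o\<^sub>L Z)) (id_blinfun + (S o\<^sub>L Z)) \<le> norm Z * dist R S" for R S
      by (simp add: dist_norm mult.commute[of "norm Z"] norm_blinfun_compose flip: blinfun_compose.diff_left)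
  qed (use Z in \<open>auto intro: bounded_operators_add bounded_operators_compose bounded_operators_id\<close>)
  then obtain L where L: "L \<in> bounded_operators" "id_blinfun + (L o\<^sub>L Z) = L"
    by blast
  have R_inv: "(id_blinfun - Z) o\<^sub>L R = id_blinfun"
    using R(2) by (simp add: blinfun_compose.diff_left algebra_simps)
  have L_inv: "L o\<^sub>L (id_blinfun - Z) = id_blinfun"
    using L(2) by (simp add: blinfun_compose.diff_right algebra_simps)
  have "L = L o\<^sub>L ((id_blinfun - Z) o\<^sub>L R)"
    by (simp add: R_inv)
  also have "\<dots> = R"
    by (simp add: L_inv blinfun_compose_assoc[symmetric])
  finally show ?thesis
    using Z R R_inv L_inv
    by (auto simp: invertible_op_def is_inverse_op_def intro!: bounded_operators_diff bounded_operators_id)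
qed

definition selfadjoint_op :: "('a::complex_hilbert_space \<Rightarrow>\<^sub>L 'a) \<Rightarrow> bool"
  where "selfadjoint_op T \<longleftrightarrow> (\<forall>x y. rinner (T x) y = rinner x (T y))"

text \<open>The equation for \<open>Z\<close> says \<open>(1 - Z)\<^sup>2 = 1 - T\<close>. The map \<open>Z \<mapsto> (T + Z\<^sup>2) / 2\<close> preserves the self-adjoint
  operators of norm at most \<open>t\<close>, because \<open>(t + t\<^sup>2) / 2 \<le> t\<close>, and has Lipschitz constant \<open>t\<close> there. So the
  square root of \<open>1 - T\<close> arises without a functional calculus.\<close>

lemma sqrt_fixed_point:
  fixes T :: "'a::complex_hilbert_space \<Rightarrow>\<^sub>L 'a"
  assumes T: "T \<in> bounded_operators" and sym: "selfadjoint_op T"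
    and t: "norm T \<le> t" "t < 1"
  shows "\<exists>Z :: 'a \<Rightarrow>\<^sub>L 'a. Z \<in> bounded_operators \<and> selfadjoint_op Z \<and>
    norm Z \<le> t \<and> T + (Z o\<^sub>L Z) = 2 *\<^sub>R Z"
proof -
  define S :: "('a \<Rightarrow>\<^sub>L 'a) set" where
    "S = bounded_operators \<inter> {Z. selfadjoint_op Z \<and> norm Z \<le> t}"
  have t0: "0 \<le> t"
    using t(1) norm_ge_zero[of T] by linarith
  have "closed S"
    unfolding S_def selfadjoint_op_def
    by (intro closed_Int closed_bounded_operators closed_Collect_conj closed_Collect_all closed_Collect_eq
        closed_Collect_le rinner.continuous_on continuous_intros)
  then have c: "complete S"
    using complete_eq_closed by blast
  define f :: "('a \<Rightarrow>\<^sub>L 'a) \<Rightarrow> ('a \<Rightarrow>\<^sub>L 'a)" where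
    "f Z = (1/2) *\<^sub>R (T + (Z o\<^sub>L Z))" for Z
  have "f Z \<in> S" if "Z \<in> S" for Z
  proof -
    have Z: "Z \<in> bounded_operators" "selfadjoint_op Z" "norm Z \<le> t"
      using that by (auto simp: S_def)
    have "norm (T + (Z o\<^sub>L Z)) \<le> t + t * t"
      using t t0 Z(3) norm_blinfun_compose[of Z Z] mult_mono[OF Z(3) Z(3)]
      by (intro norm_triangle_le) (auto simp: power2_eq_square)
    also have "\<dots> \<le> t + t * 1"
      using t0 t(2) by (intro add_left_mono mult_left_mono) auto
    finally have "norm (f Z) \<le> t" by (simp add: f_def)
    moreover have "f Z \<in> bounded_operators"
      using Z(1) T by (auto simp: f_def intro!: bounded_operators_scaleR bounded_operators_add bounded_operators_compose)
    moreover have "selfadjoint_op (f Z)"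
      using sym Z(2)
      by (simp add: selfadjoint_op_def f_def blinfun.scaleR_left blinfun.add_left
          rinner.scaleR_left rinner.scaleR_right rinner.add_left rinner.add_right)
    ultimately show ?thesis by (simp add: S_def)
  qed
  moreover have "dist (f Z) (f W) \<le> t * dist Z W" if "Z \<in> S" "W \<in> S" for Z W
  proof -
    \<comment> \<open>\<open>Z\<close> and \<open>W\<close> need not commute.\<close>
    have "f Z - f W = (1/2) *\<^sub>R ((Z o\<^sub>L (Z - W)) + ((Z - W) o\<^sub>L W))"
      by (simp add: f_def blinfun_compose.diff_left blinfun_compose.diff_right algebra_simps)
    then have "norm (f Z - f W) = (1/2) * norm ((Z o\<^sub>L (Z - W)) + ((Z - W) o\<^sub>L W))"
      by simp
    also have "\<dots> \<le> (1/2) * (norm Z * norm (Z - W) + norm (Z - W) * norm W)"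
      by (intro mult_left_mono norm_triangle_mono norm_blinfun_compose) auto
    also have "\<dots> \<le> (1/2) * (t * norm (Z - W) + norm (Z - W) * t)"
      using that by (intro mult_left_mono add_mono mult_right_mono) (auto simp: S_def)
    finally show ?thesis by (simp add: dist_norm)
  qed
  moreover have "0 \<in> S"
    using t0 by (simp add: S_def selfadjoint_op_def bounded_operators_zero rinner.zero_left rinner.zero_right)
  ultimately have "\<exists>!Z\<in>S. f Z = Z"
    by (intro Banach_fix[OF c _ t0 t(2)]) blast+
  then obtain Z where Z: "Z \<in> S" "f Z = Z" by blast
  have "T + (Z o\<^sub>L Z) = 2 *\<^sub>R f Z" by (simp add: f_def)
  with Z show ?thesis
    by (intro exI[of _ Z]) (auto simp: S_def)
qed

text \<open>The square \<open>\<nu>\<close> of an equivalent Hilbert space norm; the aim is an invertible operator \<open>Y\<close> with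
  \<open>\<parallel>Y x\<parallel>\<^sup>2 = \<nu>(x)\<close>.\<close>

locale quadratic_norm =
  fixes \<nu> :: "'a::complex_hilbert_space \<Rightarrow> real" and K :: real
  assumes parallelogram: "\<nu> (x + y) + \<nu> (x - y) = 2 * \<nu> x + 2 * \<nu> y"
    and homogeneous: "\<nu> (c *\<^sub>C x) = (cmod c)\<^sup>2 * \<nu> x"
    and lower: "(norm x)\<^sup>2 \<le> \<nu> x"
    and upper: "\<nu> x \<le> K * (norm x)\<^sup>2"
    and K: "1 \<le> K"
begin

definition form :: "'a \<Rightarrow> 'a \<Rightarrow> real"
  where "form x y = (\<nu> (x + y) - \<nu> (x - y)) / 4"

lemma nonneg: "0 \<le> \<nu> x"
  using lower[of x] by (meson order_trans zero_le_power2)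

lemma neg: "\<nu> (- x) = \<nu> x"
  using homogeneous[of "-1" x] by (simp add: complex_space.scale_minus_left)

lemma form_commute: "form x y = form y x"
  using neg[of "x - y"] by (simp add: form_def add.commute)

lemma form_self: "form x x = \<nu> x"
  using parallelogram[of x x] homogeneous[of 0 0] by (simp add: form_def)

lemma form_bound': "\<bar>form x y\<bar> \<le> K * ((norm x)\<^sup>2 + (norm y)\<^sup>2) / 2"
  using parallelogram[of x y] nonneg[of "x + y"] nonneg[of "x - y"] upper[of x] upper[of y]
  by (simp add: form_def abs_le_iff algebra_simps)

text \<open>The Jordan-von Neumann argument: the parallelogram law at the midpoint of \<open>u\<close> and \<open>v\<close>, shifted by \<open>z\<close> and by
  \<open>-z\<close>, gives \<open>form u z + form v z = 2 form ((u + v) / 2) z\<close>; the case \<open>v = 0\<close> removes the halves.\<close>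

lemma form_add: "form (x + y) z = form x z + form y z"
proof -
  have *: "form u z + form v z = 2 * form ((1/2) *\<^sub>R (u + v)) z" for u v
  proof -
    have e: "(1/2) *\<^sub>R (u + v) + w + (1/2) *\<^sub>R (u - v) = u + w"
        "(1/2) *\<^sub>R (u + v) + w - (1/2) *\<^sub>R (u - v) = v + w" for w
      by (simp_all add: algebra_simps scaleR_half_double flip: scaleR_add_left)
    show ?thesis
      using parallelogram[of "(1/2) *\<^sub>R (u + v) + z" "(1/2) *\<^sub>R (u - v)"]
        parallelogram[of "(1/2) *\<^sub>R (u + v) + (- z)" "(1/2) *\<^sub>R (u - v)"]
      unfolding e form_def diff_divide_distrib by simp
  qed
  have 0: "form 0 z = 0"
    by (simp add: form_def neg)
  show ?thesis
    using *[of x y] *[of "x + y" 0] by (simp add: 0)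
qed

lemma form_scaleR: "form (r *\<^sub>R x) y = r * form x y"
proof -
  have "form (r *\<^sub>R x) y = r * form (1 *\<^sub>R x) y"
  proof (rule additive_bounded_on_interval_imp_linear
      [where g = "\<lambda>r. form (r *\<^sub>R x) y" and C = "K * ((norm x)\<^sup>2 + (norm y)\<^sup>2) / 2"])
    show "form ((r + s) *\<^sub>R x) y = form (r *\<^sub>R x) y + form (s *\<^sub>R x) y" for r s
      by (simp add: scaleR_add_left form_add)
    show "\<bar>form (r *\<^sub>R x) y\<bar> \<le> K * ((norm x)\<^sup>2 + (norm y)\<^sup>2) / 2" if "\<bar>r\<bar> \<le> 1" for r
    proof -
      have "(norm (r *\<^sub>R x))\<^sup>2 \<le> (norm x)\<^sup>2"
        using that by (intro power_mono) (auto intro: mult_left_le_one_le)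
      then have "K * ((norm (r *\<^sub>R x))\<^sup>2 + (norm y)\<^sup>2) / 2 \<le> K * ((norm x)\<^sup>2 + (norm y)\<^sup>2) / 2"
        using K by (intro divide_right_mono mult_left_mono) auto
      then show ?thesis
        using form_bound'[of "r *\<^sub>R x" y] by linarith
    qed
  qed
  then show ?thesis by simp
qed

lemma form_add_right: "form x (y + z) = form x y + form x z"
  by (simp add: form_commute[of x] form_add)

lemma form_scaleR_right: "form x (r *\<^sub>R y) = r * form x y"
  by (simp add: form_commute[of x] form_scaleR)

text \<open>Multiplication by \<open>\<i>\<close> preserves \<open>\<nu>\<close>, hence it is orthogonal for the form; so its adjoint is its inverse \<open>-\<i>\<close>.
  This is what makes the representing operator complex-linear.\<close>

lemma form_scaleC_i: "form x (\<i> *\<^sub>C y) = - form (\<i> *\<^sub>C x) y"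
proof -
  have "form (\<i> *\<^sub>C u) (\<i> *\<^sub>C v) = form u v" for u v
    unfolding form_def
    by (simp add: homogeneous flip: complex_space.scale_right_distrib complex_space.scale_right_diff_distrib)
  from this[of x "\<i> *\<^sub>C y"] have "form x (\<i> *\<^sub>C y) = form (\<i> *\<^sub>C x) ((-1) *\<^sub>R y)"
    by (simp add: complex_space.scale_minus_left)
  then show ?thesis by (simp only: form_scaleR_right)
qed

lemma form_bound: "\<bar>form x y\<bar> \<le> K * norm x * norm y"
proof (cases "x = 0 \<or> y = 0")
  case True
  then show ?thesis
    using form_scaleR[of 0 x y] form_scaleR_right[of x 0 y] by auto
next
  case False
  have "\<bar>form (x /\<^sub>R norm x) (y /\<^sub>R norm y)\<bar> \<le> K"
    using form_bound'[of "x /\<^sub>R norm x" "y /\<^sub>R norm y"] False by simp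
  then show ?thesis
    using False by (simp add: form_scaleR form_scaleR_right abs_mult field_simps)
qed

lemma representing_operator:
  obtains Q :: "'a \<Rightarrow>\<^sub>L 'a" where "Q \<in> bounded_operators" "\<And>x y. rinner (Q x) y = form x y"
proof -
  have "bounded_linear (form x)" for x
    by (rule bounded_linear_intro[where K = "K * norm x"])
      (use form_bound[of x] in \<open>simp_all add: form_add_right form_scaleR_right mult_ac\<close>)
  then have "\<exists>q. \<forall>y. form x y = rinner q y" for x
    by (rule riesz_representation)
  then obtain q where q: "form x y = rinner (q x) y" for x y
    by metis
  have eqI: "u = v" if "\<And>y. rinner u y = rinner v y" for u v :: 'a
    using that[of "u - v"] rinner_self[of "u - v"] by (simp add: rinner.diff_left)
  have bl: "bounded_linear q"
  proof (rule bounded_linear_intro[where K = K])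
    show "q (x + y) = q x + q y" for x y
      by (rule eqI) (simp add: rinner.add_left form_add flip: q)
    show "q (r *\<^sub>R x) = r *\<^sub>R q x" for r x
      by (rule eqI) (simp add: rinner.scaleR_left form_scaleR flip: q)
    show "norm (q x) \<le> norm x * K" for x
    proof -
      have "(norm (q x))\<^sup>2 \<le> K * norm x * norm (q x)"
        using form_bound[of x "q x"] by (simp add: q rinner_self)
      then show ?thesis
        using K by (cases "norm (q x) = 0") (simp_all add: power2_eq_square mult_ac)
    qed
  qed
  have i: "q (\<i> *\<^sub>C x) = \<i> *\<^sub>C q x" for x
  proof (rule eqI)
    fix y
    have "rinner (\<i> *\<^sub>C q x) y = - rinner (q x) (\<i> *\<^sub>C y)"
      by (simp add: rinner_def cinner_scaleC_left cinner_scaleC_right)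
    also have "\<dots> = form (\<i> *\<^sub>C x) y"
      by (simp add: form_scaleC_i flip: q)
    finally show "rinner (q (\<i> *\<^sub>C x)) y = rinner (\<i> *\<^sub>C q x) y"
      by (simp add: q)
  qed
  interpret q: bounded_linear q by (fact bl)
  have "q (c *\<^sub>C x) = c *\<^sub>C q x" for c x
  proof -
    have *: "c *\<^sub>C z = Re c *\<^sub>R z + Im c *\<^sub>R (\<i> *\<^sub>C z)" for z :: 'a
      unfolding scaleC_of_real[symmetric] complex_space.scale_scale complex_space.scale_left_distrib[symmetric]
      by (simp add: complex_eq mult.commute)
    show ?thesis
      unfolding *[of x] *[of "q x"] by (simp add: q.add q.scaleR i)
  qed
  then show thesis
    using that[of "Blinfun q"] bl by (simp add: bounded_operators_def bounded_linear_Blinfun_apply q)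
qed

text \<open>Let \<open>Q\<close> represent the form. Then \<open>0 \<le> 1 - Q / K \<le> 1 - 1 / K < 1\<close>, so \<open>Q / K\<close> has a square root
  \<open>1 - Z\<close> with \<open>\<parallel>Z\<parallel> < 1\<close>, which is self-adjoint and invertible, and \<open>Y = \<surd>K (1 - Z)\<close>.\<close>

lemma norm_transporting_operator:
  obtains Y :: "'a \<Rightarrow>\<^sub>L 'a" where "invertible_op Y" "\<And>x. (norm (Y x))\<^sup>2 = \<nu> x"
proof -
  obtain Q :: "'a \<Rightarrow>\<^sub>L 'a" where Q: "Q \<in> bounded_operators" "\<And>x y. rinner (Q x) y = form x y"
    using representing_operator by metis
  define T where "T = id_blinfun - (1 / K) *\<^sub>R Q"
  define t where "t = 1 - 1 / K"
  have t: "0 \<le> t" "t < 1" using K by (auto simp: t_def)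
  have T: "T \<in> bounded_operators"
    by (auto simp: T_def intro!: bounded_operators_diff bounded_operators_id bounded_operators_scaleR Q(1))
  have T_form: "rinner (T x) y = rinner x y - form x y / K" for x y
    by (simp add: T_def blinfun.diff_left blinfun.scaleR_left rinner.diff_left rinner.scaleR_left Q(2))
  have sym: "rinner (T x) y = rinner x (T y)" for x y
    by (metis T_form form_commute rinner_commute)
  have T_pos: "0 \<le> rinner (T x) x" "rinner (T x) x \<le> t * (norm x)\<^sup>2" for x
  proof -
    have "(norm x)\<^sup>2 / K \<le> \<nu> x / K" "\<nu> x / K \<le> (norm x)\<^sup>2"
      using lower[of x] upper[of x] K by (simp_all add: divide_right_mono pos_divide_le_eq mult.commute)
    then show "0 \<le> rinner (T x) x" "rinner (T x) x \<le> t * (norm x)\<^sup>2"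
      by (simp_all add: T_form rinner_self form_self t_def left_diff_distrib)
  qed
  have "norm (T x) \<le> t * norm x" for x
  proof (cases "T x = 0")
    case True
    then show ?thesis using t by simp
  next
    case False
    then have nz: "norm (T x) > 0" "norm x > 0"
      by (auto simp: blinfun.zero_right)
    \<comment> \<open>For a positive operator the norm is the numerical radius: polarise at two vectors of equal length.\<close>
    define y where "y = (norm x / norm (T x)) *\<^sub>R T x"
    have ny: "norm y = norm x" using nz by (simp add: y_def)
    have "4 * rinner (T x) y = rinner (T (x + y)) (x + y) - rinner (T (x - y)) (x - y)"
      using sym[of y x] by (simp add: blinfun.add_right blinfun.diff_right rinner.add_left rinner.add_right
          rinner.diff_left rinner.diff_right rinner_commute[of y])
    also have "\<dots> \<le> t * (norm (x + y))\<^sup>2"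
      using T_pos(2)[of "x + y"] T_pos(1)[of "x - y"] by linarith
    also have "\<dots> \<le> t * (norm x + norm y)\<^sup>2"
      using t by (intro mult_left_mono power_mono norm_triangle_ineq) auto
    finally have "rinner (T x) y \<le> t * (norm x)\<^sup>2"
      by (simp add: ny power2_eq_square)
    moreover have "rinner (T x) y = norm x * norm (T x)"
      using nz by (simp add: y_def rinner.scaleR_right rinner_self power2_eq_square)
    ultimately show ?thesis
      using nz by (simp add: power2_eq_square mult_ac)
  qed
  then have "norm T \<le> t"
    using t by (intro norm_blinfun_bound) auto
  moreover have "selfadjoint_op T"
    using sym by (simp add: selfadjoint_op_def)
  ultimately obtain Z where Z: "Z \<in> bounded_operators" "selfadjoint_op Z"
    "norm Z \<le> t" "T + (Z o\<^sub>L Z) = 2 *\<^sub>R Z"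
    using sqrt_fixed_point[OF T _ _ t(2)] by blast
  define Y where "Y = sqrt K *\<^sub>R (id_blinfun - Z)"
  have "invertible_op (id_blinfun - Z)"
    using Z t by (intro invertible_op_id_minus) auto
  then obtain R where R: "is_inverse_op (id_blinfun - Z) R"
    by (auto simp: invertible_op_def)
  have "is_inverse_op Y ((1 / sqrt K) *\<^sub>R R)"
    using R K unfolding is_inverse_op_def Y_def
    by (auto simp: blinfun_compose.scaleR_left blinfun_compose.scaleR_right intro: bounded_operators_scaleR)
  moreover have "Y \<in> bounded_operators"
    unfolding Y_def by (intro bounded_operators_scaleR bounded_operators_diff bounded_operators_id Z(1))
  ultimately have inv: "invertible_op Y"
    by (auto simp: invertible_op_def)
  have "(norm (Y x))\<^sup>2 = \<nu> x" for x
  proof -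
    have "T x + Z (Z x) = 2 *\<^sub>R Z x"
      using arg_cong[OF Z(4), of "\<lambda>F. blinfun_apply F x"]
      by (simp add: blinfun.add_left blinfun.scaleR_left)
    then have "rinner (T x) x + rinner (Z (Z x)) x = 2 * rinner (Z x) x"
      by (metis rinner.add_left rinner.scaleR_left real_scaleR_def)
    then have "(norm x)\<^sup>2 - 2 * rinner x (Z x) + (norm (Z x))\<^sup>2 = \<nu> x / K"
      using Z(2)[unfolded selfadjoint_op_def, rule_format, of "Z x" x]
      unfolding T_form rinner_self form_self rinner_commute[of "Z x" x] by simp
    then have "(norm (x - Z x))\<^sup>2 = \<nu> x / K"
      by (simp add: norm_diff_sq)
    then show ?thesis
      using K by (simp add: Y_def blinfun.scaleR_left blinfun.diff_left power_mult_distrib)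
  qed
  with inv show thesis by (rule that)
qed

end

section \<open>The Hahn-Banach theorem for sublinear functionals\<close>

lemma le_Inf_add_Inf:
  fixes X Y :: "real set"
  assumes "\<And>a b. a \<in> X \<Longrightarrow> b \<in> Y \<Longrightarrow> z \<le> a + b" "X \<noteq> {}" "Y \<noteq> {}"
  shows "z \<le> Inf X + Inf Y"
proof -
  have "z - a \<le> Inf Y" if "a \<in> X" for a
    using assms(1)[OF that] assms(3) by (intro cInf_greatest) (auto simp: algebra_simps)
  then have "z - Inf Y \<le> Inf X"
    using assms(2) by (intro cInf_greatest) (auto simp: algebra_simps)
  then show ?thesis by simp
qed

definition function_space :: "('c \<Rightarrow> real) set \<Rightarrow> bool"
  where "function_space M \<longleftrightarrow> (\<lambda>_. 0) \<in> M \<and> (\<forall>f\<in>M. \<forall>g\<in>M. (\<lambda>x. f x + g x) \<in> M) \<and>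
    (\<forall>f\<in>M. \<forall>r. (\<lambda>x. r * f x) \<in> M)"

text \<open>Homogeneity is required as an inequality only: applied to \<open>t\<close> and to \<open>1 / t\<close> it gives equality.\<close>

definition sublinear_on :: "('c \<Rightarrow> real) set \<Rightarrow> (('c \<Rightarrow> real) \<Rightarrow> real) \<Rightarrow> bool"
  where "sublinear_on M p \<longleftrightarrow> (\<forall>f\<in>M. \<forall>g\<in>M. p (\<lambda>x. f x + g x) \<le> p f + p g) \<and>
    (\<forall>f\<in>M. \<forall>t>0. p (\<lambda>x. t * f x) \<le> t * p f)"

lemma function_space_add: "function_space M \<Longrightarrow> f \<in> M \<Longrightarrow> g \<in> M \<Longrightarrow> (\<lambda>x. f x + g x) \<in> M"
  by (simp add: function_space_def)

lemma function_space_scale: "function_space M \<Longrightarrow> f \<in> M \<Longrightarrow> (\<lambda>x. r * f x) \<in> M"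
  by (simp add: function_space_def)

lemma sublinear_on_add: "sublinear_on M p \<Longrightarrow> f \<in> M \<Longrightarrow> g \<in> M \<Longrightarrow> p (\<lambda>x. f x + g x) \<le> p f + p g"
  by (simp add: sublinear_on_def)

lemma sublinear_on_scale_le: "sublinear_on M p \<Longrightarrow> f \<in> M \<Longrightarrow> 0 < t \<Longrightarrow> p (\<lambda>x. t * f x) \<le> t * p f"
  by (simp add: sublinear_on_def)

lemma sublinear_on_scale:
  assumes "function_space M" "sublinear_on M p" "f \<in> M" "0 \<le> t"
  shows "p (\<lambda>x. t * f x) = t * p f"
proof (cases "t = 0")
  case False
  then have t: "t > 0" using assms by simp
  have "(\<lambda>x. t * f x) \<in> M" using assms by (auto simp: function_space_def)
  then have "p (\<lambda>x. (1 / t) * (t * f x)) \<le> (1 / t) * p (\<lambda>x. t * f x)"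
    using assms(2) t by (auto simp: sublinear_on_def simp del: times_divide_eq_left)
  then have "t * p f \<le> p (\<lambda>x. t * f x)" using t by (simp add: field_simps)
  moreover have "p (\<lambda>x. t * f x) \<le> t * p f"
    using assms t by (auto simp: sublinear_on_def)
  ultimately show ?thesis by simp
next
  case True
  have z: "(\<lambda>_. 0) \<in> M" using assms by (auto simp: function_space_def)
  then show ?thesis
    using sublinear_on_scale_le[OF assms(2), of "\<lambda>_. 0" 2]
      sublinear_on_scale_le[OF assms(2), of "\<lambda>_. 0" "1/2"] True by simp
qed

lemma sublinear_on_ge:
  assumes M: "function_space M" and p: "sublinear_on M p" and f: "f \<in> M"
  shows "- p (\<lambda>x. (-1) * f x) \<le> p f"
proof -
  have "p (\<lambda>x. f x + (-1) * f x) \<le> p f + p (\<lambda>x. (-1) * f x)"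
    by (intro sublinear_on_add[OF p f] function_space_scale[OF M f])
  moreover have "p (\<lambda>x. f x + (-1) * f x) = 0"
    using sublinear_on_scale[OF M p f, of 0] by simp
  ultimately show ?thesis by simp
qed

text \<open>Zorn's lemma gives a minimal sublinear functional \<open>m\<close> below \<open>p\<close>, and minimal sublinear functionals are
  linear: for fixed \<open>g\<close> the functional \<open>f \<mapsto> inf {m(f + t g) - t m(g) | t \<ge> 0}\<close> is sublinear and at most
  \<open>m\<close>, so it equals \<open>m\<close>, and \<open>t = 1\<close> gives \<open>m(f) + m(g) \<le> m(f + g)\<close>.\<close>

theorem Hahn_Banach_sublinear:
  assumes M: "function_space M" and p: "sublinear_on M p"
  shows "\<exists>\<Lambda>. (\<forall>f\<in>M. \<forall>g\<in>M. \<Lambda> (\<lambda>x. f x + g x) = \<Lambda> f + \<Lambda> g) \<and>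
    (\<forall>f\<in>M. \<forall>r. \<Lambda> (\<lambda>x. r * f x) = r * \<Lambda> f) \<and> (\<forall>f\<in>M. \<Lambda> f \<le> p f)"
proof -
  note M_add = function_space_add[OF M] and M_scale = function_space_scale[OF M]
  \<comment> \<open>Functionals are made to vanish outside \<open>M\<close>, so that domination on \<open>M\<close> is antisymmetric.\<close>
  define S where "S = {q. sublinear_on M q \<and> (\<forall>f\<in>M. q f \<le> p f) \<and> (\<forall>f. f \<notin> M \<longrightarrow> q f = 0)}"
  define ge where "ge q q' \<longleftrightarrow> (\<forall>f\<in>M. q' f \<le> q f)" for q q' :: "('a \<Rightarrow> real) \<Rightarrow> real"
  have restr: "(\<lambda>f. if f \<in> M then q f else 0) \<in> S"
    if "sublinear_on M q" "\<And>f. f \<in> M \<Longrightarrow> q f \<le> p f" for q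
  proof -
    have "sublinear_on M (\<lambda>f. if f \<in> M then q f else 0)"
      using sublinear_on_add[OF that(1)] sublinear_on_scale_le[OF that(1)]
      unfolding sublinear_on_def by (intro conjI ballI allI impI) (simp_all add: M_add M_scale)
    with that(2) show ?thesis by (simp add: S_def)
  qed
  have lb: "- p (\<lambda>x. (-1) * f x) \<le> q f" if "q \<in> S" "f \<in> M" for q f
  proof -
    have "sublinear_on M q" "q (\<lambda>x. (-1) * f x) \<le> p (\<lambda>x. (-1) * f x)"
      using M_scale[OF that(2), of "-1"] that(1) unfolding S_def by blast+
    then show ?thesis
      using sublinear_on_ge[OF M _ that(2), of q] by linarith
  qed
  have "\<exists>m\<in>S. \<forall>q\<in>S. ge m q \<longrightarrow> q = m"
  proof (rule predicate_Zorn)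
    have "q = q'" if "q \<in> S" "q' \<in> S" "ge q q'" "ge q' q" for q q'
    proof (rule ext)
      fix f
      show "q f = q' f"
        using that unfolding S_def ge_def by (cases "f \<in> M") (simp_all add: antisym)
    qed
    then show "partial_order_on S (relation_of ge S)"
      by (intro partial_order_on_relation_ofI) (auto simp: ge_def intro: order_trans)
  next
    fix C assume C: "C \<in> Chains (relation_of ge S)"
    then have CS: "C \<subseteq> S" and comp: "\<And>q q'. q \<in> C \<Longrightarrow> q' \<in> C \<Longrightarrow> ge q q' \<or> ge q' q"
      by (auto simp: Chains_def relation_of_def)
    show "\<exists>u\<in>S. \<forall>q\<in>C. ge q u"
    proof (cases "C = {}")
      case True
      then show ?thesis using restr[OF p] by auto
    next
      case False
      define u where "u f = Inf ((\<lambda>q. q f) ` C)" for f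
      have bdd: "bdd_below ((\<lambda>q. q f) ` C)" if "f \<in> M" for f
        using lb[OF _ that] CS by (intro bdd_belowI2[where m = "- p (\<lambda>x. (-1) * f x)"]) blast
      have u_le: "u f \<le> q f" if "q \<in> C" "f \<in> M" for q f
        unfolding u_def using bdd[OF that(2)] that(1) by (auto intro: cInf_lower)
      have "sublinear_on M u"
        unfolding sublinear_on_def
      proof (intro conjI ballI allI impI)
        fix f g assume fg: "f \<in> M" "g \<in> M"
        have "u (\<lambda>x. f x + g x) \<le> q f + q' g" if q: "q \<in> C" "q' \<in> C" for q q'
        proof -
          obtain r where r: "r \<in> C" "r f \<le> q f" "r g \<le> q' g"
            using comp[OF q] q fg by (auto simp: ge_def)
          have "r (\<lambda>x. f x + g x) \<le> r f + r g"
            using r(1) CS fg by (intro sublinear_on_add) (auto simp: S_def)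
          then show ?thesis
            using u_le[OF r(1) M_add[OF fg]] r by linarith
        qed
        then show "u (\<lambda>x. f x + g x) \<le> u f + u g"
          unfolding u_def[of f] u_def[of g] using False by (intro le_Inf_add_Inf) auto
      next
        fix f and t :: real assume f: "f \<in> M" and t: "0 < t"
        have "u (\<lambda>x. t * f x) / t \<le> q f" if "q \<in> C" for q
        proof -
          have "q (\<lambda>x. t * f x) \<le> t * q f"
            using that CS f t by (intro sublinear_on_scale_le) (auto simp: S_def)
          then have "u (\<lambda>x. t * f x) \<le> t * q f"
            using u_le[OF that M_scale[OF f], of t] by linarith
          then show ?thesis
            using t by (simp add: pos_divide_le_eq mult.commute)
        qed
        then have "u (\<lambda>x. t * f x) / t \<le> u f"
          unfolding u_def[of f] using False by (intro cInf_greatest) auto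
        then show "u (\<lambda>x. t * f x) \<le> t * u f"
          using t by (simp add: field_simps)
      qed
      moreover have "u f \<le> p f" if "f \<in> M" for f
      proof -
        obtain q where "q \<in> C" using False by blast
        then have "u f \<le> q f" "q f \<le> p f"
          using u_le[of q f] that CS unfolding S_def by blast+
        then show ?thesis by linarith
      qed
      ultimately have "(\<lambda>f. if f \<in> M then u f else 0) \<in> S"
        by (rule restr)
      moreover have "ge q (\<lambda>f. if f \<in> M then u f else 0)" if "q \<in> C" for q
        using u_le[OF that] by (simp add: ge_def)
      ultimately show ?thesis by blast
    qed
  qed
  then obtain m where mS: "m \<in> S" and min: "\<And>q. q \<in> S \<Longrightarrow> ge m q \<Longrightarrow> q = m"
    by blast
  have m: "sublinear_on M m" and mp: "\<And>f. f \<in> M \<Longrightarrow> m f \<le> p f"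
    using mS by (auto simp: S_def)
  note m_add = sublinear_on_add[OF m]
  note m_scale = sublinear_on_scale[OF M m]
  have superadd: "m f + m g \<le> m (\<lambda>x. f x + g x)" if f: "f \<in> M" and g: "g \<in> M" for f g
  proof -
    define r where "r f = Inf ((\<lambda>t. m (\<lambda>x. f x + t * g x) - t * m g) ` {0..})" for f
    have bdd: "bdd_below ((\<lambda>t. m (\<lambda>x. f x + t * g x) - t * m g) ` {0..})" if f: "f \<in> M" for f
    proof (rule bdd_belowI2)
      fix t :: real assume "t \<in> {0..}"
      then have t: "0 \<le> t" by simp
      have "m (\<lambda>x. (f x + t * g x) + (-1) * f x) \<le> m (\<lambda>x. f x + t * g x) + m (\<lambda>x. (-1) * f x)"
        using f g by (intro m_add M_add M_scale)
      moreover have "m (\<lambda>x. (f x + t * g x) + (-1) * f x) = t * m g"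
        using m_scale[OF g t] by simp
      ultimately show "- m (\<lambda>x. (-1) * f x) \<le> m (\<lambda>x. f x + t * g x) - t * m g"
        by simp
    qed
    have r_le: "r f \<le> m (\<lambda>x. f x + t * g x) - t * m g" if "f \<in> M" "0 \<le> t" for f t
      unfolding r_def using bdd[OF that(1)] that(2) by (auto intro!: cInf_lower)
    have "sublinear_on M r"
      unfolding sublinear_on_def
    proof (intro conjI ballI allI impI)
      fix f h assume fh: "f \<in> M" "h \<in> M"
      have "r (\<lambda>x. f x + h x) \<le> (m (\<lambda>x. f x + s * g x) - s * m g) + (m (\<lambda>x. h x + t * g x) - t * m g)"
        if "0 \<le> s" "0 \<le> t" for s t
      proof -
        have "m (\<lambda>x. (f x + s * g x) + (h x + t * g x)) \<le> m (\<lambda>x. f x + s * g x) + m (\<lambda>x. h x + t * g x)"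
          using fh g by (intro m_add M_add M_scale)
        moreover have "(\<lambda>x. (f x + s * g x) + (h x + t * g x)) = (\<lambda>x. (f x + h x) + (s + t) * g x)"
          by (auto simp: algebra_simps)
        ultimately show ?thesis
          using r_le[OF M_add[OF fh], of "s + t"] that by (simp add: algebra_simps)
      qed
      then show "r (\<lambda>x. f x + h x) \<le> r f + r h"
        unfolding r_def[of f] r_def[of h] by (intro le_Inf_add_Inf) auto
    next
      fix f and c :: real assume f: "f \<in> M" and c: "0 < c"
      have "r (\<lambda>x. c * f x) / c \<le> m (\<lambda>x. f x + t * g x) - t * m g" if "0 \<le> t" for t
      proof -
        have "r (\<lambda>x. c * f x) \<le> m (\<lambda>x. c * f x + (c * t) * g x) - (c * t) * m g"
          using c that by (intro r_le M_scale f) auto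
        also have "(\<lambda>x. c * f x + (c * t) * g x) = (\<lambda>x. c * (f x + t * g x))"
          by (auto simp: algebra_simps)
        also have "m \<dots> = c * m (\<lambda>x. f x + t * g x)"
          using c f g by (intro m_scale M_add M_scale) auto
        finally show ?thesis using c by (simp add: field_simps)
      qed
      then have "r (\<lambda>x. c * f x) / c \<le> r f"
        unfolding r_def[of f] by (intro cInf_greatest) auto
      then show "r (\<lambda>x. c * f x) \<le> c * r f"
        using c by (simp add: field_simps)
    qed
    moreover have r_m: "r f \<le> m f" if "f \<in> M" for f
      using r_le[OF that, of 0] by simp
    ultimately have "(\<lambda>f. if f \<in> M then r f else 0) \<in> S"
      using mp by (intro restr) (auto intro: order_trans)
    then have "(\<lambda>f. if f \<in> M then r f else 0) = m"
      using r_m by (intro min) (auto simp: ge_def)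
    from this[THEN fun_cong, of f] f have "m f = r f"
      by simp
    then show ?thesis
      using r_le[OF f, of 1] by simp
  qed
  have add: "m (\<lambda>x. f x + g x) = m f + m g" if "f \<in> M" "g \<in> M" for f g
    using superadd[OF that] m_add[OF that] by simp
  have "m (\<lambda>x. r * f x) = r * m f" if f: "f \<in> M" for f r
  proof (cases "0 \<le> r")
    case True
    then show ?thesis by (rule m_scale[OF f])
  next
    case False
    then have "m (\<lambda>x. r * f x + (- r) * f x) = m (\<lambda>x. r * f x) + (- r) * m f"
      using add[OF M_scale[OF f] M_scale[OF f], of r "- r"] m_scale[OF f, of "- r"] by simp
    moreover have "m (\<lambda>x. r * f x + (- r) * f x) = 0"
      using m_scale[OF f, of 0] by simp
    ultimately show ?thesis by simp
  qed
  with add mp show ?thesis by blast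
qed

section \<open>Replacing vectors by independent ones\<close>

text \<open>Complex-linear maps without continuity: on the finitely many vectors involved in each step, linear maps can be
  prescribed freely.\<close>

definition clinear :: "('b::complex_inner \<Rightarrow> 'a::complex_inner) \<Rightarrow> bool"
  where "clinear V \<longleftrightarrow> (\<forall>x y. V (x + y) = V x + V y) \<and> (\<forall>c x. V (c *\<^sub>C x) = c *\<^sub>C V x)"

lemma clinear_add: "clinear V \<Longrightarrow> V (x + y) = V x + V y"
  and clinear_scaleC: "clinear V \<Longrightarrow> V (c *\<^sub>C x) = c *\<^sub>C V x"
  by (simp_all add: clinear_def)

lemma clinear_zero: "clinear V \<Longrightarrow> V 0 = 0"
  using clinear_add[of V 0 0] by simp

lemma clinear_sum: "clinear V \<Longrightarrow> V (\<Sum>i\<in>I. f i) = (\<Sum>i\<in>I. V (f i))"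
  by (induction I rule: infinite_finite_induct) (simp_all add: clinear_zero clinear_add)

lemma clinear_id: "clinear (\<lambda>x. x)"
  by (simp add: clinear_def)

definition independent_family :: "nat \<Rightarrow> (nat \<Rightarrow> 'b::complex_inner) \<Rightarrow> bool"
  where "independent_family d e \<longleftrightarrow> (\<forall>\<beta>. (\<Sum>i<d. \<beta> i *\<^sub>C e i) = 0 \<longrightarrow> (\<forall>i<d. \<beta> i = 0))"

lemma independent_family_extend:
  fixes e :: "nat \<Rightarrow> 'b::complex_inner" and x :: "nat \<Rightarrow> 'a::complex_inner"
  assumes "independent_family d e"
  shows "\<exists>V. clinear V \<and> (\<forall>i<d. V (e i) = x i)"
proof -
  interpret vector_space_pair "scaleC :: complex \<Rightarrow> 'b \<Rightarrow> 'b" "scaleC :: complex \<Rightarrow> 'a \<Rightarrow> 'a" ..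
  have inj: "inj_on e {..<d}"
  proof (rule inj_onI, rule ccontr)
    fix i j assume ij: "i \<in> {..<d}" "j \<in> {..<d}" "e i = e j" "i \<noteq> j"
    have "(\<Sum>k<d. (if k = i then 1 else if k = j then -1 else 0) *\<^sub>C e k)
        = (\<Sum>k<d. (if k = i then e i else 0) - (if k = j then e j else 0))"
      using ij by (intro sum.cong) (auto simp: complex_space.scale_minus_left)
    also have "\<dots> = 0"
      using ij by (simp add: sum_subtractf)
    finally show False
      using assms[unfolded independent_family_def, rule_format,
          of "\<lambda>k. if k = i then 1 else if k = j then -1 else 0" i] ij by simp
  qed
  have "complex_space.independent (e ` {..<d})"
    unfolding complex_space.dependent_finite[OF finite_imageI[OF finite_lessThan]]
  proof (safe)
    fix u i assume i: "i < d" "u (e i) \<noteq> 0" and 0: "(\<Sum>v\<in>e ` {..<d}. u v *\<^sub>C v) = 0"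
    then have "(\<Sum>k<d. u (e k) *\<^sub>C e k) = 0"
      by (simp add: sum.reindex[OF inj])
    then show False
      using assms[unfolded independent_family_def, rule_format, of "\<lambda>k. u (e k)" i] i by simp
  qed
  then obtain V where V: "Vector_Spaces.linear scaleC scaleC V" "\<forall>y\<in>e ` {..<d}. V y = x (inv_into {..<d} e y)"
    using linear_independent_extend[of "e ` {..<d}" "\<lambda>y. x (inv_into {..<d} e y)"] by blast
  interpret V: Vector_Spaces.linear scaleC scaleC V by (fact V(1))
  show ?thesis
    using V(2) inj by (intro exI[of _ V]) (auto simp: clinear_def V.add V.scale)
qed

text \<open>If \<open>h\<close> depends on the \<open>e\<^sub>i\<close>, with coefficient vector \<open>\<alpha>\<close>, the quadratic form \<open>\<Sum> \<parallel>V e\<^sub>i\<parallel>\<^sup>2 + \<parallel>V h\<parallel>\<^sup>2\<close> has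
  matrix \<open>1 + \<alpha>\<alpha>\<^sup>*\<close>, whose square root is \<open>1 + s \<alpha>\<alpha>\<^sup>*\<close> with \<open>s\<close> as in the assumption. Applying this square root
  to the \<open>e\<^sub>i\<close> absorbs \<open>h\<close>.\<close>

lemma rank_one_update:
  fixes e :: "nat \<Rightarrow> 'b::complex_inner" and V :: "'b \<Rightarrow> 'a::complex_inner"
  assumes V: "clinear V" and h: "h = (\<Sum>i<d. \<alpha> i *\<^sub>C e i)"
    and s: "2 * s + s\<^sup>2 * (\<Sum>i<d. (cmod (\<alpha> i))\<^sup>2) = 1"
  shows "(\<Sum>i<d. (norm (V (e i + (of_real s * cnj (\<alpha> i)) *\<^sub>C h)))\<^sup>2) = (norm (V h))\<^sup>2 + (\<Sum>i<d. (norm (V (e i)))\<^sup>2)"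
proof -
  have "(norm (V (e i + (of_real s * cnj (\<alpha> i)) *\<^sub>C h)))\<^sup>2
      = (norm (V (e i)))\<^sup>2 + 2 * s * rinner (\<alpha> i *\<^sub>C V (e i)) (V h) + s\<^sup>2 * (cmod (\<alpha> i))\<^sup>2 * (norm (V h))\<^sup>2" for i
    by (simp add: clinear_add[OF V] clinear_scaleC[OF V] norm_add_sq norm_scaleC norm_mult power_mult_distrib
        rinner_def cinner_scaleC_right cinner_scaleC_left mult.assoc)
  then have "(\<Sum>i<d. (norm (V (e i + (of_real s * cnj (\<alpha> i)) *\<^sub>C h)))\<^sup>2)
      = (\<Sum>i<d. (norm (V (e i)))\<^sup>2) + 2 * s * rinner (\<Sum>i<d. \<alpha> i *\<^sub>C V (e i)) (V h)
        + s\<^sup>2 * (\<Sum>i<d. (cmod (\<alpha> i))\<^sup>2) * (norm (V h))\<^sup>2"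
    by (simp add: sum.distrib rinner.sum_left sum_distrib_left sum_distrib_right)
  also have "(\<Sum>i<d. \<alpha> i *\<^sub>C V (e i)) = V h"
    by (simp add: h clinear_sum[OF V] clinear_scaleC[OF V])
  also have "(\<Sum>i<d. (norm (V (e i)))\<^sup>2) + 2 * s * rinner (V h) (V h)
        + s\<^sup>2 * (\<Sum>i<d. (cmod (\<alpha> i))\<^sup>2) * (norm (V h))\<^sup>2
      = (\<Sum>i<d. (norm (V (e i)))\<^sup>2) + (2 * s + s\<^sup>2 * (\<Sum>i<d. (cmod (\<alpha> i))\<^sup>2)) * (norm (V h))\<^sup>2"
    by (simp add: rinner_self algebra_simps)
  finally show ?thesis by (simp add: s)
qed

text \<open>Vectors are added one at a time: an independent vector is appended, a dependent one is absorbed by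
  \<open>rank_one_update\<close>. The last conjunct is the same identity for the identity map, which has another codomain.\<close>

lemma independent_replacement:
  fixes hs :: "'b::complex_inner list"
  shows "\<exists>d e. independent_family d e \<and> (\<forall>h\<in>set hs. \<exists>\<beta>. h = (\<Sum>i<d. \<beta> i *\<^sub>C e i)) \<and>
    (\<forall>V :: 'b \<Rightarrow> 'a::complex_inner. clinear V \<longrightarrow> (\<Sum>h\<leftarrow>hs. (norm (V h))\<^sup>2) = (\<Sum>i<d. (norm (V (e i)))\<^sup>2)) \<and>
    (\<Sum>h\<leftarrow>hs. (norm h)\<^sup>2) = (\<Sum>i<d. (norm (e i))\<^sup>2)"
proof (induction hs)
  case Nil
  then show ?case by (intro exI[of _ 0]) (simp add: independent_family_def)
next
  case (Cons h hs)
  then obtain d e where ind: "independent_family d e"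
    and span: "\<And>g. g \<in> set hs \<Longrightarrow> \<exists>\<beta>. g = (\<Sum>i<d. \<beta> i *\<^sub>C e i)"
    and V: "\<And>V :: 'b \<Rightarrow> 'a. clinear V \<Longrightarrow> (\<Sum>h\<leftarrow>hs. (norm (V h))\<^sup>2) = (\<Sum>i<d. (norm (V (e i)))\<^sup>2)"
    and id: "(\<Sum>h\<leftarrow>hs. (norm h)\<^sup>2) = (\<Sum>i<d. (norm (e i))\<^sup>2)"
    by blast
  show ?case
  proof (cases "\<exists>\<alpha>. h = (\<Sum>i<d. \<alpha> i *\<^sub>C e i)")
    case True
    then obtain \<alpha> where \<alpha>: "h = (\<Sum>i<d. \<alpha> i *\<^sub>C e i)" by blast
    define a where "a = (\<Sum>i<d. (cmod (\<alpha> i))\<^sup>2)"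
    have a: "0 \<le> a" by (auto simp: a_def intro: sum_nonneg)
    have a': "(\<Sum>i<d. \<alpha> i * cnj (\<alpha> i)) = of_real a"
      by (simp add: a_def complex_norm_square del: of_real_power)
    \<comment> \<open>The positive root of \<open>a s\<^sup>2 + 2 s = 1\<close>, in a form that makes sense for \<open>a = 0\<close>.\<close>
    define s where "s = 1 / (1 + sqrt (1 + a))"
    have s: "2 * s + s\<^sup>2 * a = 1" "0 \<le> s"
    proof -
      define r where "r = sqrt (1 + a)"
      have r: "a = r\<^sup>2 - 1" "r \<ge> 0" using a by (auto simp: r_def)
      then have sr: "s * (1 + r) = 1" using r(2) by (simp add: s_def flip: r_def)
      have "2 * s + s\<^sup>2 * a = 2 * s + (s * (1 + r)) * (s * (r - 1))"
        unfolding r(1) by (simp add: power2_eq_square algebra_simps)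
      also have "\<dots> = 2 * s + s * (r - 1)"
        by (simp only: sr mult_1_left)
      also have "\<dots> = s * (1 + r)"
        by (simp add: algebra_simps)
      finally show "2 * s + s\<^sup>2 * a = 1" by (simp only: sr)
      show "0 \<le> s" using r(2) by (simp add: s_def r_def)
    qed
    define c where "c = 1 + complex_of_real (s * a)"
    have c: "c \<noteq> 0"
    proof -
      have "Re c > 0" using s(2) a by (simp add: c_def add_pos_nonneg)
      then show ?thesis by auto
    qed
    define e' where "e' i = e i + (of_real s * cnj (\<alpha> i)) *\<^sub>C h" for i
    have sum_e': "(\<Sum>i<d. \<beta> i *\<^sub>C e' i) = (\<Sum>i<d. \<beta> i *\<^sub>C e i) + (of_real s * (\<Sum>i<d. \<beta> i * cnj (\<alpha> i))) *\<^sub>C h" for \<beta>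
    proof -
      have "\<beta> i *\<^sub>C e' i = \<beta> i *\<^sub>C e i + (of_real s * (\<beta> i * cnj (\<alpha> i))) *\<^sub>C h" for i
        by (simp add: e'_def complex_space.scale_right_distrib mult_ac)
      then show ?thesis
        by (simp only: sum.distrib complex_space.scale_sum_left sum_distrib_left)
    qed
    \<comment> \<open>Hence \<open>h\<close>, and with it every \<open>e i\<close>, is a combination of the new vectors.\<close>
    have h': "(\<Sum>i<d. \<alpha> i *\<^sub>C e' i) = c *\<^sub>C h"
      unfolding sum_e' a' by (simp add: \<alpha>[symmetric] c_def complex_space.scale_left_distrib)
    have r1: "independent_family d e'"
      unfolding independent_family_def
    proof (intro allI impI)
      fix \<beta> i assume 0: "(\<Sum>i<d. \<beta> i *\<^sub>C e' i) = 0" and i: "i < d"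
      define \<gamma> where "\<gamma> = (\<Sum>i<d. \<beta> i * cnj (\<alpha> i))"
      have "(\<Sum>i<d. (\<beta> i + of_real s * \<gamma> * \<alpha> i) *\<^sub>C e i) = 0"
        using 0 unfolding sum_e' \<gamma>_def[symmetric]
        by (simp add: \<alpha> complex_space.scale_left_distrib sum.distrib complex_space.scale_sum_right)
      then have *: "\<beta> j = - (of_real s * \<gamma> * \<alpha> j)" if "j < d" for j
        using ind[unfolded independent_family_def, rule_format, OF _ that, of "\<lambda>i. \<beta> i + of_real s * \<gamma> * \<alpha> i"]
        by (simp add: eq_neg_iff_add_eq_0)
      have "\<gamma> = (\<Sum>j<d. \<beta> j * cnj (\<alpha> j))"
        by (rule \<gamma>_def)
      also have "\<dots> = (\<Sum>j<d. - (of_real s * \<gamma>) * (\<alpha> j * cnj (\<alpha> j)))"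
        by (intro sum.cong refl) (simp add: *)
      also have "\<dots> = - (of_real s * \<gamma>) * of_real a"
        by (simp only: a' flip: sum_distrib_left)
      finally have fixpt: "\<gamma> = - (of_real s * \<gamma>) * of_real a" .
      have "c * \<gamma> = \<gamma> - (- (of_real s * \<gamma>) * of_real a)"
        by (simp add: c_def algebra_simps)
      then have "c * \<gamma> = 0"
        unfolding fixpt[symmetric] by simp
      then have "\<gamma> = 0" using c by simp
      then show "\<beta> i = 0" using *[OF i] by simp
    qed
    have r2: "\<exists>\<beta>. g = (\<Sum>i<d. \<beta> i *\<^sub>C e' i)" if "g \<in> set (h # hs)" for g
    proof -
      have "\<exists>\<beta>. g = (\<Sum>i<d. \<beta> i *\<^sub>C e i)"
        using that \<alpha> span by auto
      then obtain \<beta> where \<beta>: "g = (\<Sum>i<d. \<beta> i *\<^sub>C e i)" by blast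
      define \<gamma> where "\<gamma> = of_real s * (\<Sum>i<d. \<beta> i * cnj (\<alpha> i))"
      have "(\<Sum>i<d. (\<beta> i - \<gamma> / c * \<alpha> i) *\<^sub>C e' i) = (\<Sum>i<d. \<beta> i *\<^sub>C e' i) - (\<gamma> / c) *\<^sub>C (\<Sum>i<d. \<alpha> i *\<^sub>C e' i)"
        by (simp add: complex_space.scale_left_diff_distrib sum_subtractf complex_space.scale_sum_right)
      also have "\<dots> = g"
        unfolding h' unfolding sum_e' using c by (simp add: \<beta> flip: \<gamma>_def)
      finally show ?thesis by metis
    qed
    have r3: "(\<Sum>h\<leftarrow>h # hs. (norm (V h))\<^sup>2) = (\<Sum>i<d. (norm (V (e' i)))\<^sup>2)" if "clinear V" for V :: "'b \<Rightarrow> 'a"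
      unfolding e'_def using rank_one_update[OF that \<alpha> s(1)[unfolded a_def]] V[OF that] by simp
    have r4: "(\<Sum>h\<leftarrow>h # hs. (norm h)\<^sup>2) = (\<Sum>i<d. (norm (e' i))\<^sup>2)"
      unfolding e'_def using rank_one_update[OF clinear_id \<alpha> s(1)[unfolded a_def]] id by simp
    show ?thesis
      by (intro exI[of _ "d"] exI[of _ e'] conjI ballI allI impI r1 r2 r3 r4)
  next
    case False
    define e' where "e' = e(d := h)"
    have e': "(\<Sum>i<d. f i (e' i)) = (\<Sum>i<d. f i (e i))" for f :: "nat \<Rightarrow> 'b \<Rightarrow> 'c::comm_monoid_add"
      by (intro sum.cong) (auto simp: e'_def)
    have e'd: "e' d = h" by (simp add: e'_def)
    have r1: "independent_family (Suc d) e'"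
      unfolding independent_family_def
    proof (intro allI impI)
      fix \<beta> i assume 0: "(\<Sum>i<Suc d. \<beta> i *\<^sub>C e' i) = 0" and i: "i < Suc d"
      have 1: "(\<Sum>i<d. \<beta> i *\<^sub>C e i) + \<beta> d *\<^sub>C h = 0"
        using 0 e'[of "\<lambda>i x. \<beta> i *\<^sub>C x"] by (simp add: e'd)
      have "\<beta> d = 0"
      proof (rule ccontr)
        assume nz: "\<beta> d \<noteq> 0"
        have "(\<Sum>i<d. (- \<beta> i / \<beta> d) *\<^sub>C e i) = (- 1 / \<beta> d) *\<^sub>C (\<Sum>i<d. \<beta> i *\<^sub>C e i)"
          by (simp add: complex_space.scale_sum_right)
        also have "(\<Sum>i<d. \<beta> i *\<^sub>C e i) = - \<beta> d *\<^sub>C h"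
          using 1 by (simp add: eq_neg_iff_add_eq_0 complex_space.scale_minus_left)
        also have "(- 1 / \<beta> d) *\<^sub>C (- \<beta> d *\<^sub>C h) = h"
          using nz by simp
        finally show False using False by metis
      qed
      moreover from this have "\<forall>i<d. \<beta> i = 0"
        using 1 ind unfolding independent_family_def by simp
      ultimately show "\<beta> i = 0"
        using i by (auto simp: less_Suc_eq)
    qed
    have r2: "\<exists>\<beta>. g = (\<Sum>i<Suc d. \<beta> i *\<^sub>C e' i)" if "g \<in> set (h # hs)" for g
    proof (cases "g = h")
      case True
      then show ?thesis
        by (intro exI[of _ "\<lambda>i. if i = d then 1 else 0"]) (simp add: e'd)
    next
      case False
      then have "g \<in> set hs"
        using that by simp
      then obtain \<beta> where \<beta>: "g = (\<Sum>i<d. \<beta> i *\<^sub>C e i)"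
        using span by blast
      have "(\<Sum>i<d. (\<beta>(d := 0)) i *\<^sub>C e' i) = g"
        unfolding \<beta> by (intro sum.cong) (auto simp: e'_def)
      then show ?thesis
        by (intro exI[of _ "\<beta>(d := 0)"]) simp
    qed
    have r3: "(\<Sum>h\<leftarrow>h # hs. (norm (V h))\<^sup>2) = (\<Sum>i<Suc d. (norm (V (e' i)))\<^sup>2)" if "clinear V" for V :: "'b \<Rightarrow> 'a"
      using V[OF that] e'[of "\<lambda>i x. (norm (V x))\<^sup>2"] by (simp add: e'd)
    have r4: "(\<Sum>h\<leftarrow>h # hs. (norm h)\<^sup>2) = (\<Sum>i<Suc d. (norm (e' i))\<^sup>2)"
      using id e'[of "\<lambda>i x. (norm x)\<^sup>2"] by (simp add: e'd)
    show ?thesis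
      by (intro exI[of _ "Suc d"] exI[of _ e'] conjI ballI allI impI r1 r2 r3 r4)
  qed
qed

section \<open>Formal vectors and domination\<close>

definition matrix_contraction :: "nat \<Rightarrow> (nat \<Rightarrow> nat \<Rightarrow> 'a::complex_hilbert_space \<Rightarrow>\<^sub>L 'a) \<Rightarrow> bool"
  where "matrix_contraction d a \<longleftrightarrow>
    (\<forall>x. (\<Sum>i<d. (norm (\<Sum>j<d. a i j (x j)))\<^sup>2) \<le> (\<Sum>j<d. (norm (x j))\<^sup>2))"

text \<open>The constant \<open>K\<close> bounds the squares of norms, so \<open>\<parallel>\<psi>\<parallel>\<^sub>c\<^sub>b \<le> \<surd>K\<close>.\<close>

definition cb_bounded :: "('a::complex_hilbert_space \<Rightarrow>\<^sub>L 'a) set \<Rightarrow>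
    (('a \<Rightarrow>\<^sub>L 'a) \<Rightarrow> 'b::complex_hilbert_space \<Rightarrow>\<^sub>L 'b) \<Rightarrow> real \<Rightarrow> bool"
  where "cb_bounded A \<psi> K \<longleftrightarrow> (\<forall>d. \<forall>a\<in>op_matrices d A. matrix_contraction d a \<longrightarrow>
    (\<forall>h. (\<Sum>i<d. (norm (\<Sum>j<d. \<psi> (a i j) (h j)))\<^sup>2) \<le> K * (\<Sum>j<d. (norm (h j))\<^sup>2)))"

lemma cb_boundedD:
  assumes "cb_bounded A \<psi> K" "a \<in> op_matrices d A" "matrix_contraction d a"
  shows "(\<Sum>i<d. (norm (\<Sum>j<d. \<psi> (a i j) (h j)))\<^sup>2) \<le> K * (\<Sum>j<d. (norm (h j))\<^sup>2)"
  using assms by (simp add: cb_bounded_def)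

lemma le_of_le_add_small:
  fixes x y z :: real
  assumes "\<And>\<epsilon>. 0 < \<epsilon> \<Longrightarrow> x \<le> y + \<epsilon> * z" "0 \<le> z"
  shows "x \<le> y"
proof (rule field_le_epsilon)
  fix e :: real assume e: "0 < e"
  have "e / (z + 1) * z \<le> e"
    using e assms(2) by (simp add: field_simps)
  then show "x \<le> y + e"
    using assms(1)[of "e / (z + 1)"] e assms(2) by simp
qed

text \<open>The list of pairs \<open>(a\<^sub>k, h\<^sub>k)\<close> stands for \<open>\<Sum> a\<^sub>k \<otimes> h\<^sub>k\<close>. Tensors need not be identified with each other, since
  only their images under \<open>a \<otimes> h \<mapsto> a V h\<close> and \<open>a \<otimes> h \<mapsto> \<psi>(a) h\<close> are used.\<close>

type_synonym ('a, 'b) formal_vector = "(('a \<Rightarrow>\<^sub>L 'a) \<times> 'b) list"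

definition realize :: "('b \<Rightarrow> 'a) \<Rightarrow> ('a::complex_hilbert_space, 'b) formal_vector \<Rightarrow> 'a"
  where "realize V u = (\<Sum>(a, h)\<leftarrow>u. blinfun_apply a (V h))"

definition formal_scale :: "complex \<Rightarrow> ('a::complex_hilbert_space, 'b::complex_hilbert_space) formal_vector \<Rightarrow> ('a, 'b) formal_vector"
  where "formal_scale c u = map (\<lambda>(a, h). (a, c *\<^sub>C h)) u"

definition formal_mult :: "('a \<Rightarrow>\<^sub>L 'a) \<Rightarrow> ('a::complex_hilbert_space, 'b::complex_hilbert_space) formal_vector \<Rightarrow> ('a, 'b) formal_vector"
  where "formal_mult b u = map (\<lambda>(a, h). (b o\<^sub>L a, h)) u"

lemma realize_simps [simp]:
  "realize V [] = 0" "realize V ((a, h) # u) = a (V h) + realize V u" "realize V (u @ v) = realize V u + realize V v"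
  by (simp_all add: realize_def)

lemma realize_formal_mult: "realize V (formal_mult b u) = b (realize V u)"
  by (induction u) (auto simp: formal_mult_def blinfun.zero_right blinfun.add_right)

lemma zero_padding:
  fixes n d :: nat and f :: "'a::zero \<Rightarrow> 'c::real_normed_vector \<Rightarrow>\<^sub>L 'c"
  assumes a_def: "\<And>i j. a i j = (if i < n \<and> j < d then b i j else 0)" and f: "f 0 = 0"
  shows "(\<Sum>i<n + d. (norm (\<Sum>j<n + d. f (a i j) (x j)))\<^sup>2) = (\<Sum>i<n. (norm (\<Sum>j<d. f (b i j) (x j)))\<^sup>2)"
proof -
  have "(\<Sum>j<n + d. f (a i j) (x j)) = (if i < n then (\<Sum>j<d. f (b i j) (x j)) else 0)" for i
  proof (cases "i < n")
    case True
    have "(\<Sum>j<n + d. f (a i j) (x j)) = (\<Sum>j<d. f (b i j) (x j))"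
      using True f by (intro sum.mono_neutral_cong_right) (auto simp: a_def)
    with True show ?thesis by simp
  qed (simp add: a_def f)
  then have "(\<Sum>i<n + d. (norm (\<Sum>j<n + d. f (a i j) (x j)))\<^sup>2)
      = (\<Sum>i<n + d. (norm (if i < n then (\<Sum>j<d. f (b i j) (x j)) else 0))\<^sup>2)"
    by simp
  also have "\<dots> = (\<Sum>i<n. (norm (\<Sum>j<d. f (b i j) (x j)))\<^sup>2)"
    by (intro sum.mono_neutral_cong_right) auto
  finally show ?thesis .
qed

locale cb_representation =
  fixes A :: "('a::complex_hilbert_space \<Rightarrow>\<^sub>L 'a) set"
    and \<psi> :: "('a \<Rightarrow>\<^sub>L 'a) \<Rightarrow> ('b::complex_hilbert_space \<Rightarrow>\<^sub>L 'b)" and K :: real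
  assumes A: "unital_operator_algebra A"
    and into: "a \<in> A \<Longrightarrow> \<psi> a \<in> bounded_operators"
    and add: "a \<in> A \<Longrightarrow> b \<in> A \<Longrightarrow> \<psi> (a + b) = \<psi> a + \<psi> b"
    and scale: "a \<in> A \<Longrightarrow> \<psi> (scaleC_op c a) = scaleC_op c (\<psi> a)"
    and mult: "a \<in> A \<Longrightarrow> b \<in> A \<Longrightarrow> \<psi> (a o\<^sub>L b) = \<psi> a o\<^sub>L \<psi> b"
    and unit: "\<psi> id_blinfun = id_blinfun"
    and cb: "cb_bounded A \<psi> K"
    and K: "1 \<le> K"
begin

lemma A_id: "id_blinfun \<in> A"
  and A_add: "a \<in> A \<Longrightarrow> b \<in> A \<Longrightarrow> a + b \<in> A"
  and A_scale: "a \<in> A \<Longrightarrow> scaleC_op c a \<in> A"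
  and A_mult: "a \<in> A \<Longrightarrow> b \<in> A \<Longrightarrow> a o\<^sub>L b \<in> A"
  using A by (auto simp: unital_operator_algebra_def)

lemma A_apply_scaleC: "a \<in> A \<Longrightarrow> a (c *\<^sub>C x) = c *\<^sub>C a x"
  using A by (auto simp: unital_operator_algebra_def bounded_operators_def)

lemma psi_apply_scaleC: "a \<in> A \<Longrightarrow> \<psi> a (c *\<^sub>C x) = c *\<^sub>C \<psi> a x"
  using into by (auto simp: bounded_operators_def)

lemma scaleC_op_0: "scaleC_op 0 T = 0"
  by (rule blinfun_eqI) (simp add: blinfun_apply_scaleC_op)

lemma A_zero: "0 \<in> A"
  using A_scale[OF A_id, of 0] by (simp add: scaleC_op_0)

lemma psi_zero: "\<psi> 0 = 0"
  using scale[OF A_id, of 0] by (simp add: scaleC_op_0)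

text \<open>A rectangular matrix becomes square when padded with zeros.\<close>

lemma cb_rectangular:
  fixes n d :: nat
  assumes b: "\<And>i j. i < n \<Longrightarrow> j < d \<Longrightarrow> b i j \<in> A"
    and contr: "\<And>x. (\<Sum>i<n. (norm (\<Sum>j<d. b i j (x j)))\<^sup>2) \<le> (\<Sum>j<d. (norm (x j))\<^sup>2)"
  shows "(\<Sum>i<n. (norm (\<Sum>j<d. \<psi> (b i j) (h j)))\<^sup>2) \<le> K * (\<Sum>j<d. (norm (h j))\<^sup>2)"
proof -
  define a where "a i j = (if i < n \<and> j < d then b i j else 0)" for i j
  have a: "a \<in> op_matrices (n + d) A"
    using b by (auto simp: op_matrices_def a_def A_zero)
  note trunc = zero_padding[OF a_def]
  have "matrix_contraction (n + d) a"
    unfolding matrix_contraction_def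
  proof
    fix x :: "nat \<Rightarrow> 'a"
    have "(\<Sum>j<d. (norm (x j))\<^sup>2) \<le> (\<Sum>j<n + d. (norm (x j))\<^sup>2)"
      by (intro sum_mono2) auto
    then show "(\<Sum>i<n + d. (norm (\<Sum>j<n + d. a i j (x j)))\<^sup>2) \<le> (\<Sum>j<n + d. (norm (x j))\<^sup>2)"
      using trunc[of "\<lambda>a. a" x] contr[of x] by simp
  qed
  then have "(\<Sum>i<n + d. (norm (\<Sum>j<n + d. \<psi> (a i j) (if j < d then h j else 0)))\<^sup>2)
      \<le> K * (\<Sum>j<n + d. (norm (if j < d then h j else 0))\<^sup>2)"
    by (rule cb_boundedD[OF cb a])
  also have "(\<Sum>j<n + d. (norm (if j < d then h j else 0))\<^sup>2) = (\<Sum>j<d. (norm (h j))\<^sup>2)"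
    by (intro sum.mono_neutral_cong_right) auto
  also have "(\<Sum>i<n + d. (norm (\<Sum>j<n + d. \<psi> (a i j) (if j < d then h j else 0)))\<^sup>2)
      = (\<Sum>i<n. (norm (\<Sum>j<d. \<psi> (b i j) (h j)))\<^sup>2)"
    unfolding trunc[of \<psi>, OF psi_zero] by simp
  finally show ?thesis .
qed

definition represent :: "('a, 'b) formal_vector \<Rightarrow> 'b"
  where "represent u = (\<Sum>(a, h)\<leftarrow>u. blinfun_apply (\<psi> a) h)"

definition formal_vectors :: "('a, 'b) formal_vector set"
  where "formal_vectors = {u. \<forall>(a, h)\<in>set u. a \<in> A}"

lemma represent_simps [simp]:
  "represent [] = 0" "represent ((a, h) # u) = \<psi> a h + represent u" "represent (u @ v) = represent u + represent v"
  by (simp_all add: represent_def)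

lemma formal_vectors_simps [simp]:
  "[] \<in> formal_vectors" "(a, h) # u \<in> formal_vectors \<longleftrightarrow> a \<in> A \<and> u \<in> formal_vectors" "u @ v \<in> formal_vectors \<longleftrightarrow> u \<in> formal_vectors \<and> v \<in> formal_vectors"
  by (auto simp: formal_vectors_def)

lemma formal_scale_closed: "u \<in> formal_vectors \<Longrightarrow> formal_scale c u \<in> formal_vectors"
  by (auto simp: formal_vectors_def formal_scale_def)

lemma formal_mult_closed: "b \<in> A \<Longrightarrow> u \<in> formal_vectors \<Longrightarrow> formal_mult b u \<in> formal_vectors"
  by (auto simp: formal_vectors_def formal_mult_def A_mult)

lemma realize_formal_scale: "clinear V \<Longrightarrow> u \<in> formal_vectors \<Longrightarrow> realize V (formal_scale c u) = c *\<^sub>C realize V u"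
  by (induction u) (auto simp: formal_scale_def clinear_scaleC A_apply_scaleC complex_space.scale_right_distrib)

lemma represent_formal_scale: "u \<in> formal_vectors \<Longrightarrow> represent (formal_scale c u) = c *\<^sub>C represent u"
  by (induction u) (auto simp: formal_scale_def psi_apply_scaleC complex_space.scale_right_distrib)

lemma represent_formal_mult: "b \<in> A \<Longrightarrow> u \<in> formal_vectors \<Longrightarrow> represent (formal_mult b u) = \<psi> b (represent u)"
  by (induction u) (auto simp: formal_mult_def mult blinfun.zero_right blinfun.add_right)

text \<open>If every \<open>h\<close> occurring in \<open>u\<close> is expanded as \<open>\<Sum> t(h)\<^sub>j e\<^sub>j\<close>, then \<open>u\<close> becomes \<open>\<Sum> coeff t u j \<otimes> e\<^sub>j\<close>.\<close>

definition coeff :: "('b \<Rightarrow> nat \<Rightarrow> complex) \<Rightarrow> ('a, 'b) formal_vector \<Rightarrow> nat \<Rightarrow> 'a \<Rightarrow>\<^sub>L 'a"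
  where "coeff t u j = (\<Sum>(a, h)\<leftarrow>u. scaleC_op (t h j) a)"

lemma coeff_simps [simp]:
  "coeff t [] j = 0" "coeff t ((a, h) # u) j = scaleC_op (t h j) a + coeff t u j"
  by (simp_all add: coeff_def)

lemma coeff_A: "u \<in> formal_vectors \<Longrightarrow> coeff t u j \<in> A"
  by (induction u) (auto simp: A_zero A_add A_scale)

lemma realize_coeff:
  assumes "u \<in> formal_vectors" "\<forall>(a, h)\<in>set u. h = (\<Sum>j<d. t h j *\<^sub>C e j)" "clinear V"
  shows "realize V u = (\<Sum>j<d. coeff t u j (V (e j)))"
  using assms(1,2)
proof (induction u)
  case (Cons ah u)
  obtain a h where ah: "ah = (a, h)" by force
  have h: "h = (\<Sum>j<d. t h j *\<^sub>C e j)" and a: "a \<in> A"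
    using Cons.prems by (auto simp: ah)
  have "a (V h) = a (V (\<Sum>j<d. t h j *\<^sub>C e j))"
    using h by simp
  also have "\<dots> = (\<Sum>j<d. scaleC_op (t h j) a (V (e j)))"
    by (simp add: clinear_sum[OF assms(3)] clinear_scaleC[OF assms(3)] blinfun.sum_right A_apply_scaleC[OF a]
        blinfun_apply_scaleC_op)
  finally show ?case
    using Cons by (simp add: ah blinfun.add_left sum.distrib)
qed simp

lemma represent_coeff:
  assumes "u \<in> formal_vectors" "\<forall>(a, h)\<in>set u. h = (\<Sum>j<d. t h j *\<^sub>C e j)"
  shows "represent u = (\<Sum>j<d. \<psi> (coeff t u j) (e j))"
  using assms
proof (induction u)
  case (Cons ah u)
  obtain a h where ah: "ah = (a, h)" by force
  have h: "h = (\<Sum>j<d. t h j *\<^sub>C e j)" and a: "a \<in> A"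
    using Cons.prems by (auto simp: ah)
  have "\<psi> a h = \<psi> a (\<Sum>j<d. t h j *\<^sub>C e j)"
    using h by simp
  also have "\<dots> = (\<Sum>j<d. \<psi> (scaleC_op (t h j) a) (e j))"
    by (simp add: blinfun.sum_right psi_apply_scaleC[OF a] scale[OF a] blinfun_apply_scaleC_op)
  finally show ?case
    using Cons by (simp add: ah add coeff_A A_scale blinfun.add_left sum.distrib)
qed (simp add: psi_zero)

text \<open>After \<open>independent_replacement\<close> the form on the right is \<open>\<Sum> \<parallel>V e\<^sub>j\<parallel>\<^sup>2\<close> with independent \<open>e\<^sub>j\<close>. The vectors
  \<open>V e\<^sub>j\<close> are then arbitrary, so the hypothesis says that the matrix of coefficients of the \<open>u\<close> with respect to the
  \<open>e\<^sub>j\<close> is a contraction, and complete boundedness of \<open>\<psi>\<close>, applied to this matrix and the column \<open>(e\<^sub>j)\<close>, is the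
  conclusion.\<close>

lemma domination_spanned:
  assumes us: "set us \<subseteq> formal_vectors"
    and span: "\<And>u a h. u \<in> set us \<Longrightarrow> (a, h) \<in> set u \<Longrightarrow> \<exists>c. \<exists>g\<in>set hs. h = c *\<^sub>C g"
    and dom: "\<And>V. clinear V \<Longrightarrow> (\<Sum>u\<leftarrow>us. (norm (realize V u))\<^sup>2) \<le> (\<Sum>h\<leftarrow>hs. (norm (V h))\<^sup>2)"
  shows "(\<Sum>u\<leftarrow>us. (norm (represent u))\<^sup>2) \<le> K * (\<Sum>h\<leftarrow>hs. (norm h)\<^sup>2)"
proof -
  obtain d e where ind: "independent_family d e"
    and sp: "\<forall>h\<in>set hs. \<exists>\<beta>. h = (\<Sum>i<d. \<beta> i *\<^sub>C e i)"
    and hsV: "\<forall>V :: 'b \<Rightarrow> 'a. clinear V \<longrightarrow> (\<Sum>h\<leftarrow>hs. (norm (V h))\<^sup>2) = (\<Sum>i<d. (norm (V (e i)))\<^sup>2)"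
    and hs: "(\<Sum>h\<leftarrow>hs. (norm h)\<^sup>2) = (\<Sum>i<d. (norm (e i))\<^sup>2)"
    using independent_replacement[of hs, where ?'a = 'a] by blast
  define t where "t h = (SOME \<beta>. h = (\<Sum>i<d. \<beta> i *\<^sub>C e i))" for h
  have t: "\<forall>(a, h)\<in>set u. h = (\<Sum>j<d. t h j *\<^sub>C e j)" if u: "u \<in> set us" for u
  proof clarify
    fix a h assume "(a, h) \<in> set u"
    then obtain c g where "g \<in> set hs" "h = c *\<^sub>C g"
      using span[OF u] by blast
    obtain \<beta> where "g = (\<Sum>i<d. \<beta> i *\<^sub>C e i)"
      using sp \<open>g \<in> set hs\<close> by blast
    with \<open>h = c *\<^sub>C g\<close> have "h = c *\<^sub>C (\<Sum>i<d. \<beta> i *\<^sub>C e i)"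
      by simp
    then have "h = (\<Sum>i<d. (c * \<beta> i) *\<^sub>C e i)"
      by (simp add: complex_space.scale_sum_right)
    then show "h = (\<Sum>j<d. t h j *\<^sub>C e j)"
      unfolding t_def by (rule someI[of "\<lambda>\<beta>. h = (\<Sum>i<d. \<beta> i *\<^sub>C e i)" "\<lambda>i. c * \<beta> i"])
  qed
  have us_formal: "us ! i \<in> formal_vectors" if "i < length us" for i
    using us that by auto
  have nth: "(\<Sum>u\<leftarrow>us. f u) = (\<Sum>i<length us. f (us ! i))" for f :: "('a, 'b) formal_vector \<Rightarrow> real"
    by (simp add: sum_list_sum_nth atLeast0LessThan)
  have "(\<Sum>i<length us. (norm (\<Sum>j<d. \<psi> (coeff t (us ! i) j) (e j)))\<^sup>2) \<le> K * (\<Sum>j<d. (norm (e j))\<^sup>2)"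
  proof (rule cb_rectangular)
    show "coeff t (us ! i) j \<in> A" if "i < length us" for i j
      by (rule coeff_A[OF us_formal[OF that]])
    fix x :: "nat \<Rightarrow> 'a"
    obtain V where V: "clinear V" "\<forall>i<d. V (e i) = x i"
      using independent_family_extend[OF ind] by blast
    have "(\<Sum>i<length us. (norm (\<Sum>j<d. coeff t (us ! i) j (x j)))\<^sup>2) = (\<Sum>i<length us. (norm (realize V (us ! i)))\<^sup>2)"
    proof (intro sum.cong refl)
      fix i assume "i \<in> {..<length us}"
      then have i: "i < length us" by simp
      have "realize V (us ! i) = (\<Sum>j<d. coeff t (us ! i) j (V (e j)))"
        by (rule realize_coeff[OF us_formal[OF i] t V(1)]) (use i in simp)
      then show "(norm (\<Sum>j<d. coeff t (us ! i) j (x j)))\<^sup>2 = (norm (realize V (us ! i)))\<^sup>2"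
        using V(2) by simp
    qed
    also have "\<dots> \<le> (\<Sum>i<d. (norm (V (e i)))\<^sup>2)"
      using dom[OF V(1)] hsV V(1) by (simp add: nth)
    also have "\<dots> = (\<Sum>i<d. (norm (x i))\<^sup>2)"
      using V(2) by simp
    finally show "(\<Sum>i<length us. (norm (\<Sum>j<d. coeff t (us ! i) j (x j)))\<^sup>2) \<le> (\<Sum>i<d. (norm (x i))\<^sup>2)" .
  qed
  moreover have "(\<Sum>i<length us. (norm (\<Sum>j<d. \<psi> (coeff t (us ! i) j) (e j)))\<^sup>2) = (\<Sum>u\<leftarrow>us. (norm (represent u))\<^sup>2)"
    unfolding nth
    by (intro sum.cong refl arg_cong[of _ _ "\<lambda>x. (norm x)\<^sup>2"] represent_coeff[symmetric] us_formal t nth_mem) auto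
  ultimately show ?thesis by (simp add: hs)
qed

lemma norm_clinear_sqrt_scale:
  assumes "clinear V" "0 \<le> t"
  shows "(norm (V (complex_of_real (sqrt t) *\<^sub>C h)))\<^sup>2 = t * (norm (V h))\<^sup>2"
  using assms by (simp add: clinear_scaleC norm_scaleC power_mult_distrib)

lemma sum_list_clinear_sqrt_scale:
  assumes "clinear V" "0 \<le> t"
  shows "(\<Sum>h\<leftarrow>map (\<lambda>h. complex_of_real (sqrt t) *\<^sub>C h) hs. (norm (V h))\<^sup>2) = t * (\<Sum>h\<leftarrow>hs. (norm (V h))\<^sup>2)"
  by (induction hs) (simp_all add: norm_clinear_sqrt_scale[OF assms] distrib_left)

text \<open>The span condition of \<open>domination_spanned\<close> is enforced by adding small multiples of the vectors that occur in
  the \<open>u\<close> to the right-hand side, which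
  changes it by an arbitrarily small amount.\<close>

lemma domination:
  assumes us: "set us \<subseteq> formal_vectors"
    and dom: "\<And>V. clinear V \<Longrightarrow> (\<Sum>u\<leftarrow>us. (norm (realize V u))\<^sup>2) \<le> (\<Sum>h\<leftarrow>hs. (norm (V h))\<^sup>2)"
  shows "(\<Sum>u\<leftarrow>us. (norm (represent u))\<^sup>2) \<le> K * (\<Sum>h\<leftarrow>hs. (norm h)\<^sup>2)"
proof (rule le_of_le_add_small)
  define gs where "gs = concat (map (map snd) us)"
  fix \<epsilon> :: real assume \<epsilon>: "0 < \<epsilon>"
  define hs' where "hs' = hs @ map (\<lambda>h. complex_of_real (sqrt \<epsilon>) *\<^sub>C h) gs"
  have "(\<Sum>u\<leftarrow>us. (norm (represent u))\<^sup>2) \<le> K * (\<Sum>h\<leftarrow>hs'. (norm h)\<^sup>2)"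
  proof (rule domination_spanned[OF us])
    fix u a h assume "u \<in> set us" "(a, h) \<in> set u"
    then have "h \<in> set gs" by (force simp: gs_def)
    then have "complex_of_real (sqrt \<epsilon>) *\<^sub>C h \<in> set hs'"
      by (auto simp: hs'_def)
    moreover have "h = (1 / complex_of_real (sqrt \<epsilon>)) *\<^sub>C (complex_of_real (sqrt \<epsilon>) *\<^sub>C h)"
      using \<epsilon> by simp
    ultimately show "\<exists>c. \<exists>g\<in>set hs'. h = c *\<^sub>C g"
      by blast
  next
    fix V :: "'b \<Rightarrow> 'a" assume V: "clinear V"
    have "0 \<le> (\<Sum>h\<leftarrow>gs. (norm (V h))\<^sup>2)"
      by (rule sum_list_nonneg) auto
    then show "(\<Sum>u\<leftarrow>us. (norm (realize V u))\<^sup>2) \<le> (\<Sum>h\<leftarrow>hs'. (norm (V h))\<^sup>2)"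
      using dom[OF V] \<epsilon> sum_list_clinear_sqrt_scale[OF V less_imp_le[OF \<epsilon>], of gs]
      by (simp add: hs'_def add_increasing2)
  qed
  also have "K * (\<Sum>h\<leftarrow>hs'. (norm h)\<^sup>2) = K * (\<Sum>h\<leftarrow>hs. (norm h)\<^sup>2) + \<epsilon> * (K * (\<Sum>h\<leftarrow>gs. (norm h)\<^sup>2))"
    using sum_list_clinear_sqrt_scale[OF clinear_id less_imp_le[OF \<epsilon>], of gs]
    by (simp add: hs'_def distrib_left)
  finally show "(\<Sum>u\<leftarrow>us. (norm (represent u))\<^sup>2) \<le> K * (\<Sum>h\<leftarrow>hs. (norm h)\<^sup>2)
      + \<epsilon> * (K * (\<Sum>h\<leftarrow>concat (map (map snd) us). (norm h)\<^sup>2))"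
    by (simp add: gs_def)
next
  show "0 \<le> K * (\<Sum>h\<leftarrow>concat (map (map snd) us). (norm h)\<^sup>2)"
    using K by (intro mult_nonneg_nonneg sum_list_nonneg) auto
qed

end

section \<open>A positive functional from Hahn-Banach\<close>

context cb_representation
begin

text \<open>The functions of \<open>V\<close> on which the functional will be defined; only their values at linear maps \<open>V\<close> matter.\<close>

definition dominated :: "(('b \<Rightarrow> 'a) \<Rightarrow> real) set"
  where "dominated = {F. \<exists>hs. \<forall>V. clinear V \<longrightarrow> \<bar>F V\<bar> \<le> (\<Sum>h\<leftarrow>hs. (norm (V h))\<^sup>2)}"

text \<open>The required functional \<open>\<Lambda>\<close> is to be monotone with \<open>\<Lambda>(\<parallel>V h\<parallel>\<^sup>2) \<le> K \<parallel>h\<parallel>\<^sup>2\<close> and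
  \<open>\<Lambda>(\<parallel>realize V u\<parallel>\<^sup>2) \<ge> \<parallel>represent u\<parallel>\<^sup>2\<close>. These are the upper bounds for \<open>\<Lambda>(F)\<close> that such a functional must
  satisfy, and conversely a linear functional obeying all of them has the three properties.\<close>

definition bounds :: "(('b \<Rightarrow> 'a) \<Rightarrow> real) \<Rightarrow> real set"
  where "bounds F = {K * (\<Sum>h\<leftarrow>hs. (norm h)\<^sup>2) - (\<Sum>u\<leftarrow>us. (norm (represent u))\<^sup>2) | us hs.
    set us \<subseteq> formal_vectors \<and> (\<forall>V. clinear V \<longrightarrow> F V + (\<Sum>u\<leftarrow>us. (norm (realize V u))\<^sup>2) \<le> (\<Sum>h\<leftarrow>hs. (norm (V h))\<^sup>2))}"

lemma boundsI:
  assumes "set us \<subseteq> formal_vectors"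
    "\<And>V. clinear V \<Longrightarrow> F V + (\<Sum>u\<leftarrow>us. (norm (realize V u))\<^sup>2) \<le> (\<Sum>h\<leftarrow>hs. (norm (V h))\<^sup>2)"
  shows "K * (\<Sum>h\<leftarrow>hs. (norm h)\<^sup>2) - (\<Sum>u\<leftarrow>us. (norm (represent u))\<^sup>2) \<in> bounds F"
  using assms unfolding bounds_def by blast

lemma boundsE:
  assumes "r \<in> bounds F"
  obtains us hs where "r = K * (\<Sum>h\<leftarrow>hs. (norm h)\<^sup>2) - (\<Sum>u\<leftarrow>us. (norm (represent u))\<^sup>2)" "set us \<subseteq> formal_vectors"
    "\<And>V. clinear V \<Longrightarrow> F V + (\<Sum>u\<leftarrow>us. (norm (realize V u))\<^sup>2) \<le> (\<Sum>h\<leftarrow>hs. (norm (V h))\<^sup>2)"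
  using assms unfolding bounds_def by blast

lemma dominated_space: "function_space dominated"
  unfolding function_space_def
proof (intro conjI ballI allI)
  show "(\<lambda>_. 0) \<in> dominated"
    by (auto simp: dominated_def intro!: exI[of _ "[]"])
next
  fix F G :: "('b \<Rightarrow> 'a) \<Rightarrow> real" assume "F \<in> dominated" "G \<in> dominated"
  then obtain hs gs where "\<And>V. clinear V \<Longrightarrow> \<bar>F V\<bar> \<le> (\<Sum>h\<leftarrow>hs. (norm (V h))\<^sup>2)"
    "\<And>V. clinear V \<Longrightarrow> \<bar>G V\<bar> \<le> (\<Sum>h\<leftarrow>gs. (norm (V h))\<^sup>2)"
    unfolding dominated_def by blast
  then have "\<forall>V. clinear V \<longrightarrow> \<bar>F V + G V\<bar> \<le> (\<Sum>h\<leftarrow>hs @ gs. (norm (V h))\<^sup>2)"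
    by (auto intro: order_trans[OF abs_triangle_ineq add_mono])
  then show "(\<lambda>V. F V + G V) \<in> dominated"
    unfolding dominated_def by blast
next
  fix F :: "('b \<Rightarrow> 'a) \<Rightarrow> real" and r :: real assume "F \<in> dominated"
  then obtain hs where hs: "\<And>V. clinear V \<Longrightarrow> \<bar>F V\<bar> \<le> (\<Sum>h\<leftarrow>hs. (norm (V h))\<^sup>2)"
    unfolding dominated_def by blast
  have "\<bar>r * F V\<bar> \<le> (\<Sum>h\<leftarrow>map (\<lambda>h. complex_of_real (sqrt \<bar>r\<bar>) *\<^sub>C h) hs. (norm (V h))\<^sup>2)" if "clinear V" for V
    unfolding sum_list_clinear_sqrt_scale[OF that abs_ge_zero] abs_mult
    by (intro mult_left_mono hs that) auto
  then show "(\<lambda>V. r * F V) \<in> dominated"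
    unfolding dominated_def by blast
qed

text \<open>This is where \<open>domination\<close> is used: it keeps the infimum of the bounds finite.\<close>

lemma bounds_lower:
  assumes "\<And>V. clinear V \<Longrightarrow> \<bar>F V\<bar> \<le> (\<Sum>h\<leftarrow>gs. (norm (V h))\<^sup>2)" and "r \<in> bounds F"
  shows "- K * (\<Sum>h\<leftarrow>gs. (norm h)\<^sup>2) \<le> r"
proof -
  obtain us hs where r: "r = K * (\<Sum>h\<leftarrow>hs. (norm h)\<^sup>2) - (\<Sum>u\<leftarrow>us. (norm (represent u))\<^sup>2)" and us: "set us \<subseteq> formal_vectors"
    and dom: "\<And>V. clinear V \<Longrightarrow> F V + (\<Sum>u\<leftarrow>us. (norm (realize V u))\<^sup>2) \<le> (\<Sum>h\<leftarrow>hs. (norm (V h))\<^sup>2)"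
    by (rule boundsE[OF assms(2)]) blast
  have "(\<Sum>u\<leftarrow>us. (norm (represent u))\<^sup>2) \<le> K * (\<Sum>h\<leftarrow>hs @ gs. (norm h)\<^sup>2)"
  proof (rule domination[OF us])
    fix V :: "'b \<Rightarrow> 'a" assume V: "clinear V"
    show "(\<Sum>u\<leftarrow>us. (norm (realize V u))\<^sup>2) \<le> (\<Sum>h\<leftarrow>hs @ gs. (norm (V h))\<^sup>2)"
      using dom[OF V] assms(1)[OF V] by simp
  qed
  then show ?thesis
    by (simp add: r distrib_left)
qed

lemma bounds_bdd_below: "F \<in> dominated \<Longrightarrow> bdd_below (bounds F)"
  using bounds_lower unfolding dominated_def bdd_below_def by blast

lemma bounds_nonempty: "F \<in> dominated \<Longrightarrow> bounds F \<noteq> {}"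
proof -
  assume "F \<in> dominated"
  then obtain hs where hs: "\<And>V. clinear V \<Longrightarrow> \<bar>F V\<bar> \<le> (\<Sum>h\<leftarrow>hs. (norm (V h))\<^sup>2)"
    unfolding dominated_def by blast
  have "K * (\<Sum>h\<leftarrow>hs. (norm h)\<^sup>2) - (\<Sum>u\<leftarrow>[]. (norm (represent u))\<^sup>2) \<in> bounds F"
    by (rule boundsI) (use hs in \<open>auto simp: abs_le_iff\<close>)
  then show "bounds F \<noteq> {}" by blast
qed

lemma bounds_add:
  assumes "r \<in> bounds F" "s \<in> bounds G"
  shows "r + s \<in> bounds (\<lambda>V. F V + G V)"
proof -
  obtain us hs where r: "r = K * (\<Sum>h\<leftarrow>hs. (norm h)\<^sup>2) - (\<Sum>u\<leftarrow>us. (norm (represent u))\<^sup>2)" "set us \<subseteq> formal_vectors"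
    "\<And>V. clinear V \<Longrightarrow> F V + (\<Sum>u\<leftarrow>us. (norm (realize V u))\<^sup>2) \<le> (\<Sum>h\<leftarrow>hs. (norm (V h))\<^sup>2)"
    by (rule boundsE[OF assms(1)]) blast
  obtain vs gs where s: "s = K * (\<Sum>h\<leftarrow>gs. (norm h)\<^sup>2) - (\<Sum>u\<leftarrow>vs. (norm (represent u))\<^sup>2)" "set vs \<subseteq> formal_vectors"
    "\<And>V. clinear V \<Longrightarrow> G V + (\<Sum>u\<leftarrow>vs. (norm (realize V u))\<^sup>2) \<le> (\<Sum>h\<leftarrow>gs. (norm (V h))\<^sup>2)"
    by (rule boundsE[OF assms(2)]) blast
  have "K * (\<Sum>h\<leftarrow>hs @ gs. (norm h)\<^sup>2) - (\<Sum>u\<leftarrow>us @ vs. (norm (represent u))\<^sup>2) \<in> bounds (\<lambda>V. F V + G V)"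
  proof (rule boundsI)
    show "set (us @ vs) \<subseteq> formal_vectors" using r(2) s(2) by simp
    fix V :: "'b \<Rightarrow> 'a" assume V: "clinear V"
    show "F V + G V + (\<Sum>u\<leftarrow>us @ vs. (norm (realize V u))\<^sup>2) \<le> (\<Sum>h\<leftarrow>hs @ gs. (norm (V h))\<^sup>2)"
      using r(3)[OF V] s(3)[OF V] by simp
  qed
  then show ?thesis
    by (simp add: r(1) s(1) algebra_simps)
qed

lemma bounds_scale:
  assumes "r \<in> bounds F" "0 < t"
  shows "t * r \<in> bounds (\<lambda>V. t * F V)"
proof -
  obtain us hs where r: "r = K * (\<Sum>h\<leftarrow>hs. (norm h)\<^sup>2) - (\<Sum>u\<leftarrow>us. (norm (represent u))\<^sup>2)" "set us \<subseteq> formal_vectors"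
    and dom: "\<And>V. clinear V \<Longrightarrow> F V + (\<Sum>u\<leftarrow>us. (norm (realize V u))\<^sup>2) \<le> (\<Sum>h\<leftarrow>hs. (norm (V h))\<^sup>2)"
    by (rule boundsE[OF assms(1)]) blast
  define c where "c = complex_of_real (sqrt t)"
  define us' where "us' = map (formal_scale c) us"
  define hs' where "hs' = map (\<lambda>h. c *\<^sub>C h) hs"
  have c: "(cmod c)\<^sup>2 = t" using assms(2) by (simp add: c_def)
  have hs': "(\<Sum>h\<leftarrow>hs'. (norm (V h))\<^sup>2) = t * (\<Sum>h\<leftarrow>hs. (norm (V h))\<^sup>2)" if "clinear V"
    for V :: "'b \<Rightarrow> 'c::complex_inner"
    unfolding hs'_def c_def using sum_list_clinear_sqrt_scale[OF that less_imp_le[OF assms(2)]] .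
  have realize': "(\<Sum>u\<leftarrow>us'. (norm (realize V u))\<^sup>2) = t * (\<Sum>u\<leftarrow>us. (norm (realize V u))\<^sup>2)" if V: "clinear V" for V
    using r(2) unfolding us'_def
    by (induction us) (auto simp: realize_formal_scale[OF V] norm_scaleC power_mult_distrib c distrib_left)
  have represent': "(\<Sum>u\<leftarrow>us'. (norm (represent u))\<^sup>2) = t * (\<Sum>u\<leftarrow>us. (norm (represent u))\<^sup>2)"
    using r(2) unfolding us'_def
    by (induction us) (auto simp: represent_formal_scale norm_scaleC power_mult_distrib c distrib_left)
  have "K * (\<Sum>h\<leftarrow>hs'. (norm h)\<^sup>2) - (\<Sum>u\<leftarrow>us'. (norm (represent u))\<^sup>2) \<in> bounds (\<lambda>V. t * F V)"
  proof (rule boundsI)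
    show "set us' \<subseteq> formal_vectors" using r(2) by (auto simp: us'_def formal_scale_closed)
    fix V :: "'b \<Rightarrow> 'a" assume V: "clinear V"
    have "t * (F V + (\<Sum>u\<leftarrow>us. (norm (realize V u))\<^sup>2)) \<le> t * (\<Sum>h\<leftarrow>hs. (norm (V h))\<^sup>2)"
      using dom[OF V] assms(2) by (intro mult_left_mono) auto
    then show "t * F V + (\<Sum>u\<leftarrow>us'. (norm (realize V u))\<^sup>2) \<le> (\<Sum>h\<leftarrow>hs'. (norm (V h))\<^sup>2)"
      by (simp add: realize'[OF V] hs'[OF V] distrib_left)
  qed
  then show ?thesis
    using hs'[OF clinear_id] by (simp add: r(1) represent' algebra_simps)
qed

lemma sublinear_Inf_bounds: "sublinear_on dominated (\<lambda>F. Inf (bounds F))"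
  unfolding sublinear_on_def
proof (intro conjI ballI allI impI)
  fix F G assume FG: "F \<in> dominated" "G \<in> dominated"
  have "Inf (bounds (\<lambda>V. F V + G V)) \<le> r + s" if "r \<in> bounds F" "s \<in> bounds G" for r s
    by (intro cInf_lower bounds_add that bounds_bdd_below function_space_add dominated_space FG)
  then show "Inf (bounds (\<lambda>V. F V + G V)) \<le> Inf (bounds F) + Inf (bounds G)"
    by (intro le_Inf_add_Inf bounds_nonempty FG)
next
  fix F and t :: real assume F: "F \<in> dominated" and t: "0 < t"
  have "Inf (bounds (\<lambda>V. t * F V)) / t \<le> r" if "r \<in> bounds F" for r
  proof -
    have "Inf (bounds (\<lambda>V. t * F V)) \<le> t * r"
      by (intro cInf_lower bounds_scale that t bounds_bdd_below function_space_scale dominated_space F)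
    then show ?thesis using t by (simp add: pos_divide_le_eq mult.commute)
  qed
  then have "Inf (bounds (\<lambda>V. t * F V)) / t \<le> Inf (bounds F)"
    by (intro cInf_greatest bounds_nonempty F)
  then show "Inf (bounds (\<lambda>V. t * F V)) \<le> t * Inf (bounds F)"
    using t by (simp add: pos_divide_le_eq mult.commute)
qed

lemma realize_dominated: "u \<in> formal_vectors \<Longrightarrow> (\<lambda>V. (norm (realize V u))\<^sup>2) \<in> dominated"
proof (induction u)
  case Nil
  then show ?case using dominated_space by (simp add: function_space_def)
next
  case (Cons ah u)
  obtain a h where ah: "ah = (a, h)" by force
  have "u \<in> formal_vectors" using Cons.prems by (simp add: ah)
  with Cons.IH obtain hs where hs: "\<And>V. clinear V \<Longrightarrow> \<bar>(norm (realize V u))\<^sup>2\<bar> \<le> (\<Sum>h\<leftarrow>hs. (norm (V h))\<^sup>2)"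
    unfolding dominated_def by blast
  define t where "t = 2 * (norm a)\<^sup>2"
  define gs where "gs = map (\<lambda>h. complex_of_real (sqrt t) *\<^sub>C h) [h] @ map (\<lambda>h. complex_of_real (sqrt 2) *\<^sub>C h) hs"
  have "\<bar>(norm (realize V (ah # u)))\<^sup>2\<bar> \<le> (\<Sum>h\<leftarrow>gs. (norm (V h))\<^sup>2)" if V: "clinear V" for V
  proof -
    have "(norm (realize V (ah # u)))\<^sup>2 \<le> 2 * (norm (a (V h)))\<^sup>2 + 2 * (norm (realize V u))\<^sup>2"
      using parallelogram[of "a (V h)" "realize V u"] zero_le_power2[of "norm (a (V h) - realize V u)"]
      unfolding ah realize_simps by linarith
    also have "\<dots> \<le> t * (norm (V h))\<^sup>2 + 2 * (\<Sum>h\<leftarrow>hs. (norm (V h))\<^sup>2)"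
      using power_mono[OF norm_blinfun[of a "V h"] norm_ge_zero, of 2] hs[OF V]
      by (simp add: t_def power_mult_distrib)
    also have "\<dots> = (\<Sum>h\<leftarrow>gs. (norm (V h))\<^sup>2)"
    proof -
      have "0 \<le> t" by (simp add: t_def)
      show ?thesis
        unfolding gs_def map_append sum_list_append
          sum_list_clinear_sqrt_scale[OF V \<open>0 \<le> t\<close>] sum_list_clinear_sqrt_scale[OF V zero_le_numeral]
        by simp
    qed
    finally show ?thesis by simp
  qed
  then show ?case
    unfolding dominated_def by blast
qed

text \<open>The functional \<open>\<Lambda>\<close> given by the Hahn-Banach theorem defines \<open>q(u) = \<Lambda>(\<parallel>realize V u\<parallel>\<^sup>2)\<close>. The last property,
  monotonicity of \<open>\<Lambda>\<close>, contains both the parallelogram law and complete contractivity of the left action of \<open>A\<close>.\<close>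

lemma dominating_form:
  obtains q :: "('a, 'b) formal_vector \<Rightarrow> real" where
    "\<And>u. u \<in> formal_vectors \<Longrightarrow> (norm (represent u))\<^sup>2 \<le> q u"
    "\<And>h. q [(id_blinfun, h)] \<le> K * (norm h)\<^sup>2"
    "\<And>u c. u \<in> formal_vectors \<Longrightarrow> q (formal_scale c u) = (cmod c)\<^sup>2 * q u"
    "\<And>us vs. set us \<subseteq> formal_vectors \<Longrightarrow> set vs \<subseteq> formal_vectors \<Longrightarrow>
      \<forall>V :: 'b \<Rightarrow> 'a. clinear V \<longrightarrow> (\<Sum>u\<leftarrow>us. (norm (realize V u))\<^sup>2) \<le> (\<Sum>v\<leftarrow>vs. (norm (realize V v))\<^sup>2) \<Longrightarrow>
      (\<Sum>u\<leftarrow>us. q u) \<le> (\<Sum>v\<leftarrow>vs. q v)"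
proof -
  obtain \<Lambda> where add: "\<And>F G. F \<in> dominated \<Longrightarrow> G \<in> dominated \<Longrightarrow> \<Lambda> (\<lambda>V. F V + G V) = \<Lambda> F + \<Lambda> G"
    and scale: "\<And>F r. F \<in> dominated \<Longrightarrow> \<Lambda> (\<lambda>V. r * F V) = r * \<Lambda> F"
    and le: "\<And>F. F \<in> dominated \<Longrightarrow> \<Lambda> F \<le> Inf (bounds F)"
    using Hahn_Banach_sublinear[OF dominated_space sublinear_Inf_bounds] by blast
  note closed = function_space_add[OF dominated_space] function_space_scale[OF dominated_space]
  have le_bound: "\<Lambda> F \<le> r" if "F \<in> dominated" "r \<in> bounds F" for F r
    using le[OF that(1)] cInf_lower[OF that(2) bounds_bdd_below[OF that(1)]] by linarith
  have mono: "\<Lambda> F \<le> \<Lambda> G" if F: "F \<in> dominated" and G: "G \<in> dominated"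
    and FG: "\<And>V. clinear V \<Longrightarrow> F V \<le> G V" for F G
  proof -
    have "K * (\<Sum>h\<leftarrow>([] :: 'b list). (norm h)\<^sup>2) - (\<Sum>u\<leftarrow>[]. (norm (represent u))\<^sup>2) \<in> bounds (\<lambda>V. F V + (-1) * G V)"
      by (rule boundsI) (use FG in auto)
    then have "\<Lambda> (\<lambda>V. F V + (-1) * G V) \<le> 0"
      by (intro le_bound closed F G) simp
    also have "\<Lambda> (\<lambda>V. F V + (-1) * G V) = \<Lambda> F + (-1) * \<Lambda> G"
      by (simp only: add[OF F closed(2)[OF G]] scale[OF G])
    finally show ?thesis by simp
  qed
  define q where "q u = \<Lambda> (\<lambda>V. (norm (realize V u))\<^sup>2)" for u
  have sum_dom: "(\<lambda>V. \<Sum>u\<leftarrow>us. (norm (realize V u))\<^sup>2) \<in> dominated"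
    and sum: "\<Lambda> (\<lambda>V. \<Sum>u\<leftarrow>us. (norm (realize V u))\<^sup>2) = (\<Sum>u\<leftarrow>us. q u)" if "set us \<subseteq> formal_vectors" for us
  proof -
    have zero: "(\<lambda>_. 0) \<in> dominated"
      using dominated_space by (simp add: function_space_def)
    have "(\<lambda>V. \<Sum>u\<leftarrow>us. (norm (realize V u))\<^sup>2) \<in> dominated \<and>
        \<Lambda> (\<lambda>V. \<Sum>u\<leftarrow>us. (norm (realize V u))\<^sup>2) = (\<Sum>u\<leftarrow>us. q u)"
      using that
    proof (induction us)
      case Nil
      then show ?case using zero scale[OF zero, of 0] by simp
    next
      case (Cons u us)
      then have "u \<in> formal_vectors" "set us \<subseteq> formal_vectors" by auto
      note IH = Cons.IH[OF this(2)] and u = realize_dominated[OF this(1)]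
      have "(\<lambda>V. (norm (realize V u))\<^sup>2 + (\<Sum>u\<leftarrow>us. (norm (realize V u))\<^sup>2)) \<in> dominated"
        using IH u by (intro closed(1)) auto
      moreover have "\<Lambda> (\<lambda>V. (norm (realize V u))\<^sup>2 + (\<Sum>u\<leftarrow>us. (norm (realize V u))\<^sup>2)) = q u + (\<Sum>u\<leftarrow>us. q u)"
        using IH add[OF u conjunct1[OF IH]] by (simp add: q_def)
      ultimately show ?case by simp
    qed
    then show "(\<lambda>V. \<Sum>u\<leftarrow>us. (norm (realize V u))\<^sup>2) \<in> dominated"
      "\<Lambda> (\<lambda>V. \<Sum>u\<leftarrow>us. (norm (realize V u))\<^sup>2) = (\<Sum>u\<leftarrow>us. q u)" by blast+
  qed
  show thesis
  proof (rule that)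
    fix u assume u: "u \<in> formal_vectors"
    have "K * (\<Sum>h\<leftarrow>([] :: 'b list). (norm h)\<^sup>2) - (\<Sum>u\<leftarrow>[u]. (norm (represent u))\<^sup>2) \<in> bounds (\<lambda>V. (-1) * (norm (realize V u))\<^sup>2)"
      by (rule boundsI) (use u in auto)
    then have "\<Lambda> (\<lambda>V. (-1) * (norm (realize V u))\<^sup>2) \<le> - (norm (represent u))\<^sup>2"
      by (intro le_bound closed(2) realize_dominated u) simp
    then show "(norm (represent u))\<^sup>2 \<le> q u"
      unfolding scale[OF realize_dominated[OF u]] by (simp add: q_def)
  next
    fix h :: 'b
    have "K * (\<Sum>h\<leftarrow>[h]. (norm h)\<^sup>2) - (\<Sum>u\<leftarrow>[]. (norm (represent u))\<^sup>2) \<in> bounds (\<lambda>V. (norm (realize V [(id_blinfun, h)]))\<^sup>2)"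
      by (rule boundsI) auto
    then show "q [(id_blinfun, h)] \<le> K * (norm h)\<^sup>2"
      unfolding q_def by (intro le_bound realize_dominated) (simp_all add: A_id)
  next
    fix u c assume u: "u \<in> formal_vectors"
    have 1: "(\<lambda>V. (cmod c)\<^sup>2 * (norm (realize V u))\<^sup>2) \<in> dominated"
      by (intro closed(2) realize_dominated u)
    have 2: "(\<lambda>V. (norm (realize V (formal_scale c u)))\<^sup>2) \<in> dominated"
      by (intro realize_dominated formal_scale_closed u)
    have "q (formal_scale c u) = \<Lambda> (\<lambda>V. (cmod c)\<^sup>2 * (norm (realize V u))\<^sup>2)"
      unfolding q_def
      by (intro antisym mono 1 2) (simp_all add: realize_formal_scale u norm_scaleC power_mult_distrib)
    then show "q (formal_scale c u) = (cmod c)\<^sup>2 * q u"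
      unfolding scale[OF realize_dominated[OF u]] by (simp add: q_def)
  next
    fix us vs assume "set us \<subseteq> formal_vectors" "set vs \<subseteq> formal_vectors"
      "\<forall>V :: 'b \<Rightarrow> 'a. clinear V \<longrightarrow> (\<Sum>u\<leftarrow>us. (norm (realize V u))\<^sup>2) \<le> (\<Sum>v\<leftarrow>vs. (norm (realize V v))\<^sup>2)"
    then show "(\<Sum>u\<leftarrow>us. q u) \<le> (\<Sum>v\<leftarrow>vs. q v)"
      using mono[OF sum_dom sum_dom] sum by simp
  qed
qed

end

section \<open>Similarity to a complete contraction\<close>

lemma invertible_opE:
  assumes "invertible_op X"
  obtains S where "S \<in> bounded_operators" "X \<in> bounded_operators" "inverse_op X = S"
    "X o\<^sub>L S = id_blinfun" "S o\<^sub>L X = id_blinfun" "\<And>x. X (S x) = x" "\<And>x. S (X x) = x"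
proof -
  obtain S where S: "is_inverse_op X S" and X: "X \<in> bounded_operators"
    using assms by (auto simp: invertible_op_def)
  have "X (S x) = x" "S (X x) = x" for x
    using S by (metis blinfun_apply_blinfun_compose blinfun_apply_id_blinfun id_apply is_inverse_op_def)+
  with S X show thesis
    using that[of S] inverse_op_eq[OF S] by (auto simp: is_inverse_op_def)
qed

lemma inverse_op_right: "invertible_op X \<Longrightarrow> X (inverse_op X x) = x"
  and inverse_op_left: "invertible_op X \<Longrightarrow> inverse_op X (X x) = x"
  and inverse_op_bounded: "invertible_op X \<Longrightarrow> inverse_op X \<in> bounded_operators"
  by (auto elim: invertible_opE)

context cb_representation
begin

text \<open>The norm on \<open>H\<^sub>2\<close> is the quotient of the seminorm \<open>\<surd>q\<close> under \<open>u \<mapsto> represent u\<close>. Quotients of Hilbert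
  seminorms satisfy the parallelogram law: lifting \<open>x\<close> and \<open>y\<close> gives one inequality, and replacing \<open>x, y\<close> by
  \<open>x + y, x - y\<close> gives the reverse one. Since the action of \<open>A\<close> lifts to formal vectors, contractivity
  passes to the quotient.\<close>

theorem quadratic_norm_exists:
  obtains \<nu> where "quadratic_norm \<nu> K"
    "\<And>d a h. a \<in> op_matrices d A \<Longrightarrow> matrix_contraction d a \<Longrightarrow>
      (\<Sum>i<d. \<nu> (\<Sum>j<d. \<psi> (a i j) (h j))) \<le> (\<Sum>j<d. \<nu> (h j))"
proof -
  obtain q :: "('a, 'b) formal_vector \<Rightarrow> real" where
    q_lower: "\<And>u. u \<in> formal_vectors \<Longrightarrow> (norm (represent u))\<^sup>2 \<le> q u"
    and q_upper: "\<And>h. q [(id_blinfun, h)] \<le> K * (norm h)\<^sup>2"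
    and q_scale: "\<And>u c. u \<in> formal_vectors \<Longrightarrow> q (formal_scale c u) = (cmod c)\<^sup>2 * q u"
    and q_mono: "\<And>us vs. set us \<subseteq> formal_vectors \<Longrightarrow> set vs \<subseteq> formal_vectors \<Longrightarrow>
      \<forall>V :: 'b \<Rightarrow> 'a. clinear V \<longrightarrow> (\<Sum>u\<leftarrow>us. (norm (realize V u))\<^sup>2) \<le> (\<Sum>v\<leftarrow>vs. (norm (realize V v))\<^sup>2) \<Longrightarrow>
      (\<Sum>u\<leftarrow>us. q u) \<le> (\<Sum>v\<leftarrow>vs. q v)"
    by (rule dominating_form) (rule that; assumption)
  define \<nu> where "\<nu> h = Inf {q u | u. u \<in> formal_vectors \<and> represent u = h}" for h
  have q_nonneg: "0 \<le> q u" if "u \<in> formal_vectors" for u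
    using q_lower[OF that] by (meson order_trans zero_le_power2)
  have bdd: "bdd_below {q u | u. u \<in> formal_vectors \<and> represent u = h}" for h
    using q_nonneg by (auto intro!: bdd_belowI[of _ 0])
  have unit_formal: "[(id_blinfun, h)] \<in> formal_vectors" "represent [(id_blinfun, h)] = h" for h
    by (simp_all add: A_id unit)
  have ne: "{q u | u. u \<in> formal_vectors \<and> represent u = h} \<noteq> {}" for h
    using unit_formal[of h] by blast
  have \<nu>_le: "\<nu> h \<le> q u" if "u \<in> formal_vectors" "represent u = h" for u h
    unfolding \<nu>_def using that by (intro cInf_lower bdd) auto
  have \<nu>_near: "\<exists>u\<in>formal_vectors. represent u = h \<and> q u < \<nu> h + \<delta>" if "0 < \<delta>" for h \<delta>
  proof -
    have "Inf {q u | u. u \<in> formal_vectors \<and> represent u = h} < \<nu> h + \<delta>"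
      using that by (simp add: \<nu>_def)
    from cInf_lessD[OF ne this] show ?thesis by blast
  qed
  have lower: "(norm h)\<^sup>2 \<le> \<nu> h" for h
    unfolding \<nu>_def using q_lower by (intro cInf_greatest ne) blast
  have upper: "\<nu> h \<le> K * (norm h)\<^sup>2" for h
    using \<nu>_le[OF unit_formal] q_upper[of h] by (rule order_trans)
  have scale_le: "\<nu> (c *\<^sub>C h) \<le> (cmod c)\<^sup>2 * \<nu> h" for c h
  proof (cases "c = 0")
    case True
    then show ?thesis using upper[of 0] by simp
  next
    case False
    have "\<nu> (c *\<^sub>C h) / (cmod c)\<^sup>2 \<le> \<nu> h"
      unfolding \<nu>_def[of h]
    proof (rule cInf_greatest[OF ne])
      fix r assume "r \<in> {q u | u. u \<in> formal_vectors \<and> represent u = h}"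
      then obtain u where u: "r = q u" "u \<in> formal_vectors" "represent u = h" by blast
      have "\<nu> (c *\<^sub>C h) \<le> (cmod c)\<^sup>2 * q u"
        using \<nu>_le[OF formal_scale_closed[OF u(2)] represent_formal_scale[OF u(2)], of c] u
        by (simp add: q_scale)
      then show "\<nu> (c *\<^sub>C h) / (cmod c)\<^sup>2 \<le> r"
        using False u(1) by (simp add: pos_divide_le_eq mult.commute)
    qed
    then show ?thesis
      using False by (simp add: pos_divide_le_eq mult.commute)
  qed
  have scale: "\<nu> (c *\<^sub>C h) = (cmod c)\<^sup>2 * \<nu> h" for c h
  proof (cases "c = 0")
    case True
    then show ?thesis using upper[of 0] lower[of 0] by simp
  next
    case False
    have "\<nu> h \<le> (cmod (1 / c))\<^sup>2 * \<nu> (c *\<^sub>C h)"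
      using scale_le[of "1 / c" "c *\<^sub>C h"] False by simp
    then have "(cmod c)\<^sup>2 * \<nu> h \<le> \<nu> (c *\<^sub>C h)"
      using False by (simp add: norm_divide power_divide pos_le_divide_eq mult.commute)
    with scale_le[of c h] show ?thesis by simp
  qed
  have para_le: "\<nu> (x + y) + \<nu> (x - y) \<le> 2 * \<nu> x + 2 * \<nu> y" for x y
  proof -
    have "(\<nu> (x + y) + \<nu> (x - y)) / 2 \<le> \<nu> x + \<nu> y"
      unfolding \<nu>_def[of x] \<nu>_def[of y]
    proof (rule le_Inf_add_Inf[OF _ ne ne])
      fix r s assume "r \<in> {q u | u. u \<in> formal_vectors \<and> represent u = x}" "s \<in> {q u | u. u \<in> formal_vectors \<and> represent u = y}"
      then obtain u v where u: "r = q u" "u \<in> formal_vectors" "represent u = x" and v: "s = q v" "v \<in> formal_vectors" "represent v = y"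
        by blast
      define v' where "v' = formal_scale (-1) v"
      have v': "v' \<in> formal_vectors" "represent v' = - y"
        using v by (simp_all add: v'_def formal_scale_closed represent_formal_scale complex_space.scale_minus_left)
      have realize': "realize V v' = - realize V v" if "clinear V" for V
        using realize_formal_scale[OF that v(2), of "-1"] by (simp add: v'_def complex_space.scale_minus_left)
      have "(\<Sum>w\<leftarrow>[u @ v, u @ v']. q w) \<le> (\<Sum>w\<leftarrow>[u, u, v, v]. q w)"
      proof (rule q_mono)
        show "set [u @ v, u @ v'] \<subseteq> formal_vectors" "set [u, u, v, v] \<subseteq> formal_vectors"
          using u v v' by simp_all
        show "\<forall>V :: 'b \<Rightarrow> 'a. clinear V \<longrightarrow>
            (\<Sum>u\<leftarrow>[u @ v, u @ v']. (norm (realize V u))\<^sup>2) \<le> (\<Sum>v\<leftarrow>[u, u, v, v]. (norm (realize V v))\<^sup>2)"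
        proof (intro allI impI)
          fix V :: "'b \<Rightarrow> 'a" assume "clinear V"
          then show "(\<Sum>u\<leftarrow>[u @ v, u @ v']. (norm (realize V u))\<^sup>2) \<le> (\<Sum>v\<leftarrow>[u, u, v, v]. (norm (realize V v))\<^sup>2)"
            using parallelogram[of "realize V u" "realize V v"] by (simp add: realize')
        qed
      qed
      moreover have "\<nu> (x + y) \<le> q (u @ v)" "\<nu> (x - y) \<le> q (u @ v')"
        using u v v' by (auto intro!: \<nu>_le)
      ultimately show "(\<nu> (x + y) + \<nu> (x - y)) / 2 \<le> r + s"
        by (simp add: u(1) v(1))
    qed
    then show ?thesis by simp
  qed
  have para: "\<nu> (x + y) + \<nu> (x - y) = 2 * \<nu> x + 2 * \<nu> y" for x y
  proof -
    have "x + y + (x - y) = 2 *\<^sub>C x" "x + y - (x - y) = 2 *\<^sub>C y"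
      using complex_space.scale_left_distrib[of 1 1 x] complex_space.scale_left_distrib[of 1 1 y] by simp_all
    then have "4 * \<nu> x + 4 * \<nu> y \<le> 2 * \<nu> (x + y) + 2 * \<nu> (x - y)"
      using para_le[of "x + y" "x - y"] by (simp add: scale)
    then show ?thesis using para_le[of x y] by simp
  qed
  have "quadratic_norm \<nu> K"
    by unfold_locales (fact para scale lower upper K)+
  moreover have "(\<Sum>i<d. \<nu> (\<Sum>j<d. \<psi> (a i j) (h j))) \<le> (\<Sum>j<d. \<nu> (h j))"
    if a: "a \<in> op_matrices d A" and contr: "matrix_contraction d a" for d a h
  proof (rule le_of_le_add_small)
    fix \<delta> :: real assume "0 < \<delta>"
    then have "\<forall>j. \<exists>u. u \<in> formal_vectors \<and> represent u = h j \<and> q u < \<nu> (h j) + \<delta>"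
      using \<nu>_near by blast
    then obtain u where u: "\<And>j. u j \<in> formal_vectors" "\<And>j. represent (u j) = h j" "\<And>j. q (u j) < \<nu> (h j) + \<delta>"
      by metis
    have aA: "a i j \<in> A" if "i < d" "j < d" for i j
      using a that by (auto simp: op_matrices_def)
    \<comment> \<open>A lift of the \<open>i\<close>-th entry of \<open>(\<psi>(a\<^sub>i\<^sub>j)) h\<close>: the matrix \<open>a\<close> applied to the lifts of the \<open>h\<^sub>j\<close>.\<close>
    define w where "w i = concat (map (\<lambda>j. formal_mult (a i j) (u j)) [0..<d])" for i
    have w_partial: "concat (map (\<lambda>j. formal_mult (a i j) (u j)) [0..<n]) \<in> formal_vectors \<and>
        represent (concat (map (\<lambda>j. formal_mult (a i j) (u j)) [0..<n])) = (\<Sum>j<n. \<psi> (a i j) (h j)) \<and>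
        (\<forall>V. realize V (concat (map (\<lambda>j. formal_mult (a i j) (u j)) [0..<n])) = (\<Sum>j<n. a i j (realize V (u j))))"
      if "i < d" "n \<le> d" for i n
      using that(2)
      by (induction n) (simp_all add: formal_mult_closed aA[OF that(1)] u represent_formal_mult realize_formal_mult)
    have w: "w i \<in> formal_vectors" "represent (w i) = (\<Sum>j<d. \<psi> (a i j) (h j))"
      "\<And>V. realize V (w i) = (\<Sum>j<d. a i j (realize V (u j)))" if "i < d" for i
      using w_partial[OF that order_refl] unfolding w_def by blast+
    have upt: "(\<Sum>u\<leftarrow>map f [0..<d]. g u) = (\<Sum>i<d. g (f i))" for f :: "nat \<Rightarrow> ('a, 'b) formal_vector" and g :: "_ \<Rightarrow> real"
      by (simp add: interv_sum_list_conv_sum_set_nat comp_def atLeast0LessThan)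
    have "(\<Sum>i<d. \<nu> (\<Sum>j<d. \<psi> (a i j) (h j))) \<le> (\<Sum>i<d. q (w i))"
      by (intro sum_mono \<nu>_le) (simp_all add: w)
    also have "\<dots> = (\<Sum>u\<leftarrow>map w [0..<d]. q u)"
      by (rule upt[symmetric])
    also have "\<dots> \<le> (\<Sum>u\<leftarrow>map u [0..<d]. q u)"
    proof (rule q_mono)
      show "set (map w [0..<d]) \<subseteq> formal_vectors" "set (map u [0..<d]) \<subseteq> formal_vectors"
        using w(1) u(1) by auto
      have "(\<Sum>i<d. (norm (realize V (w i)))\<^sup>2) \<le> (\<Sum>j<d. (norm (realize V (u j)))\<^sup>2)" for V :: "'b \<Rightarrow> 'a"
        using contr[unfolded matrix_contraction_def, rule_format, of "\<lambda>j. realize V (u j)"] by (simp add: w(3))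
      then show "\<forall>V :: 'b \<Rightarrow> 'a. clinear V \<longrightarrow>
          (\<Sum>u\<leftarrow>map w [0..<d]. (norm (realize V u))\<^sup>2) \<le> (\<Sum>v\<leftarrow>map u [0..<d]. (norm (realize V v))\<^sup>2)"
        unfolding upt by blast
    qed
    also have "\<dots> = (\<Sum>j<d. q (u j))"
      by (rule upt)
    also have "\<dots> \<le> (\<Sum>j<d. \<nu> (h j) + \<delta>)"
      using u(3) by (intro sum_mono less_imp_le)
    finally show "(\<Sum>i<d. \<nu> (\<Sum>j<d. \<psi> (a i j) (h j))) \<le> (\<Sum>j<d. \<nu> (h j)) + \<delta> * real d"
      by (simp add: sum.distrib mult.commute)
  qed simp
  ultimately show thesis by (rule that)
qed

theorem similar_to_completely_contractive:
  obtains Y :: "'b \<Rightarrow>\<^sub>L 'b" where "invertible_op Y" "cb_bounded A (\<lambda>a. similarity Y (\<psi> a)) 1"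
proof -
  obtain \<nu> where qn: "quadratic_norm \<nu> K" and contr: "\<And>d a h. a \<in> op_matrices d A \<Longrightarrow> matrix_contraction d a \<Longrightarrow>
      (\<Sum>i<d. \<nu> (\<Sum>j<d. \<psi> (a i j) (h j))) \<le> (\<Sum>j<d. \<nu> (h j))"
    by (rule quadratic_norm_exists) (rule that; assumption)
  obtain Y :: "'b \<Rightarrow>\<^sub>L 'b" where Y: "invertible_op Y" "\<And>x. (norm (Y x))\<^sup>2 = \<nu> x"
    by (rule quadratic_norm.norm_transporting_operator[OF qn]) (rule that; assumption)
  have "cb_bounded A (\<lambda>a. similarity Y (\<psi> a)) 1"
    unfolding cb_bounded_def
  proof (intro allI ballI impI)
    fix d a and h :: "nat \<Rightarrow> 'b"
    assume a: "a \<in> op_matrices d A" "matrix_contraction d a"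
    have "(\<Sum>i<d. (norm (\<Sum>j<d. similarity Y (\<psi> (a i j)) (h j)))\<^sup>2)
        = (\<Sum>i<d. \<nu> (\<Sum>j<d. \<psi> (a i j) (inverse_op Y (h j))))"
      by (simp add: similarity_def Y(2)[symmetric] blinfun.sum_right)
    also have "\<dots> \<le> (\<Sum>j<d. \<nu> (inverse_op Y (h j)))"
      by (rule contr[OF a])
    also have "\<dots> = (\<Sum>j<d. (norm (h j))\<^sup>2)"
      by (simp add: Y(2)[symmetric] inverse_op_right[OF Y(1)])
    finally show "(\<Sum>i<d. (norm (\<Sum>j<d. similarity Y (\<psi> (a i j)) (h j)))\<^sup>2) \<le> 1 * (\<Sum>j<d. (norm (h j))\<^sup>2)"
      by simp
  qed
  with Y(1) show thesis by (rule that)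
qed

end

section \<open>The spectrum of an operator\<close>

lemma bounded_linear_cinner_right: "bounded_linear (cinner (y :: 'a::complex_inner))"
proof (rule bounded_linear_intro[where K = "2 * norm y"])
  show "cinner y (u + v) = cinner y u + cinner y v" for u v
    by (rule cinner_add_right)
  show "cinner y (r *\<^sub>R u) = r *\<^sub>R cinner y u" for r u
    by (metis cinner_scaleC_right scaleC_of_real scaleR_conv_of_real)
  show "norm (cinner y v) \<le> norm v * (2 * norm y)" for v
  proof -
    have le: "\<bar>Re (cinner y w)\<bar> \<le> norm y * norm w" for w
      using rinner_le[of y w] rinner_le[of y "- w"] unfolding rinner.minus_right
      by (simp add: rinner_def abs_le_iff)
    have "Im (cinner y v) = Re (cinner y ((- \<i>) *\<^sub>C v))"
      by (simp add: cinner_scaleC_right del: complex_space.scale_minus_left)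
    then have "\<bar>Im (cinner y v)\<bar> \<le> norm y * norm v"
      using le[of "(- \<i>) *\<^sub>C v"] by (simp add: norm_scaleC)
    then show ?thesis
      using le[of v] cmod_le[of "cinner y v"] by (simp add: mult.commute)
  qed
qed

text \<open>If the resolvent \<open>R(z)\<close> existed everywhere, \<open>z \<mapsto> \<langle>y, R(z) x\<rangle>\<close> would be entire and vanish at infinity, so it
  would be zero; but for \<open>y = R(0) x\<close> its value at \<open>0\<close> is
  \<open>\<parallel>R(0) x\<parallel>\<^sup>2\<close>.\<close>

lemma op_spectrum_nonempty:
  fixes T :: "'a::complex_hilbert_space \<Rightarrow>\<^sub>L 'a"
  assumes T: "T \<in> bounded_operators" and x: "(x :: 'a) \<noteq> 0"
  shows "op_spectrum T \<noteq> {}"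
proof
  assume empty: "op_spectrum T = {}"
  define S where "S z = T - scaleC_op z id_blinfun" for z
  define R where "R z = inverse_op (S z)" for z
  have inv: "invertible_op (S z)" for z
    using empty by (auto simp: op_spectrum_def S_def)
  have S_apply: "S z v = T v - z *\<^sub>C v" for z v
    by (simp add: S_def blinfun.diff_left blinfun_apply_scaleC_op)
  have SR: "S z (R z v) = v" and RS: "R z (S z v) = v" for z v
    by (simp_all add: R_def inverse_op_right inverse_op_left inv)
  have R_scaleC: "R z (c *\<^sub>C v) = c *\<^sub>C R z v" for z c v
    using inverse_op_bounded[OF inv, of z] by (simp add: R_def bounded_operators_def)
  have resolvent: "R z v = R w v + (z - w) *\<^sub>C R w (R z v)" for z w v
  proof -
    have "S w (R z v) = S z (R z v) + (z - w) *\<^sub>C R z v"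
      by (simp add: S_apply complex_space.scale_left_diff_distrib)
    then have "R w (S w (R z v)) = R w (v + (z - w) *\<^sub>C R z v)"
      by (simp add: SR)
    then show ?thesis
      by (simp add: RS blinfun.add_right R_scaleC)
  qed
  have R_cont: "((\<lambda>z. R z v) \<longlongrightarrow> R w v) (at w)" for w v
  proof -
    define B where "B = norm (R w)"
    \<comment> \<open>Near \<open>w\<close> the resolvent identity bounds \<open>R z v\<close> by \<open>2 \<parallel>R w v\<parallel>\<close>.\<close>
    have est: "norm (R z v - R w v) \<le> cmod (z - w) * (B * (2 * norm (R w v)))"
      if z: "cmod (z - w) * B \<le> 1 / 2" for z
    proof -
      have diff: "norm (R z v - R w v) \<le> cmod (z - w) * (B * norm (R z v))"
      proof -
        have "R z v - R w v = (z - w) *\<^sub>C R w (R z v)"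
          using resolvent[of z v w] by (metis add_diff_cancel_left')
        then have "norm (R z v - R w v) = cmod (z - w) * norm (R w (R z v))"
          by (simp add: norm_scaleC)
        then show ?thesis
          using norm_blinfun[of "R w" "R z v"] by (simp add: B_def mult_left_mono)
      qed
      have "norm (R z v) \<le> norm (R w v) + norm (R z v - R w v)"
        using norm_triangle_ineq[of "R w v" "R z v - R w v"] by simp
      also have "norm (R z v - R w v) \<le> 1 / 2 * norm (R z v)"
        using diff mult_right_mono[OF z norm_ge_zero[of "R z v"]] by (simp add: mult.assoc)
      finally have "norm (R z v) \<le> 2 * norm (R w v)" by simp
      then have "cmod (z - w) * (B * norm (R z v)) \<le> cmod (z - w) * (B * (2 * norm (R w v)))"
        by (intro mult_left_mono) (auto simp: B_def)
      with diff show ?thesis by linarith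
    qed
    have "((\<lambda>z. cmod (z - w) * B) \<longlongrightarrow> cmod (w - w) * B) (at w)"
      by (intro tendsto_intros)
    then have "\<forall>\<^sub>F z in at w. cmod (z - w) * B < 1 / 2"
      by (rule order_tendstoD) simp
    then have ev: "\<forall>\<^sub>F z in at w. norm (R z v - R w v) \<le> cmod (z - w) * (B * (2 * norm (R w v)))"
      by (rule eventually_mono) (rule est, simp)
    have "((\<lambda>z. cmod (z - w) * (B * (2 * norm (R w v)))) \<longlongrightarrow> cmod (w - w) * (B * (2 * norm (R w v)))) (at w)"
      by (intro tendsto_intros)
    then have "((\<lambda>z. R z v - R w v) \<longlongrightarrow> 0) (at w)"
      using Lim_null_comparison[OF ev] by simp
    then show ?thesis by (simp add: LIM_zero_iff)
  qed
  define y where "y = R 0 x"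
  interpret cy: bounded_linear "cinner y" by (rule bounded_linear_cinner_right)
  define f where "f z = cinner y (R z x)" for z
  have deriv: "(f has_field_derivative cinner y (R w (R w x))) (at w)" for w
    unfolding has_field_derivative_iff
  proof (rule Lim_transform_eventually)
    show "((\<lambda>z. cinner y (R w (R z x))) \<longlongrightarrow> cinner y (R w (R w x))) (at w)"
      by (intro cy.tendsto blinfun.tendsto tendsto_const R_cont)
    have "cinner y (R w (R z x)) = (f z - f w) / (z - w)" if "z \<noteq> w" for z
    proof -
      have "f z = f w + (z - w) * cinner y (R w (R z x))"
        unfolding f_def using resolvent[of z x w] by (metis cinner_add_right cinner_scaleC_right)
      then show ?thesis using that by simp
    qed
    then show "\<forall>\<^sub>F z in at w. cinner y (R w (R z x)) = (f z - f w) / (z - w)"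
      by (auto simp: eventually_at_filter)
  qed
  have "f holomorphic_on UNIV"
    using deriv by (auto simp: holomorphic_on_def field_differentiable_def)
  moreover have "(f \<longlongrightarrow> 0) at_infinity"
  proof -
    have bound: "norm (R z x) \<le> norm x / (cmod z - norm T)" if z: "cmod z > norm T" for z
    proof -
      have "z *\<^sub>C R z x = T (R z x) - x"
        using SR[of z x] by (simp add: S_apply algebra_simps)
      then have "cmod z * norm (R z x) = norm (T (R z x) - x)"
        by (metis norm_scaleC)
      also have "\<dots> \<le> norm T * norm (R z x) + norm x"
        by (intro order_trans[OF norm_triangle_ineq4] add_right_mono norm_blinfun)
      finally show ?thesis
        using z by (simp add: pos_le_divide_eq algebra_simps)
    qed
    have "((\<lambda>z. R z x) \<longlongrightarrow> 0) at_infinity"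
    proof (rule Lim_null_comparison)
      show "\<forall>\<^sub>F z in at_infinity. norm (R z x) \<le> norm x / (cmod z - norm T)"
        using bound unfolding eventually_at_infinity
        by (intro exI[of _ "norm T + 1"]) auto
      have "filterlim (\<lambda>z. - norm T + cmod z) at_top (at_infinity :: complex filter)"
        by (intro filterlim_tendsto_add_at_top[OF tendsto_const] filterlim_norm_at_top)
      then show "((\<lambda>z. norm x / (cmod z - norm T)) \<longlongrightarrow> 0) (at_infinity :: complex filter)"
        by (intro tendsto_divide_0[OF tendsto_const] filterlim_at_top_imp_at_infinity) simp
    qed
    from cy.tendsto[OF this] show ?thesis
      by (simp add: f_def[abs_def] cy.zero)
  qed
  ultimately have "f 0 = 0"
    by (rule Liouville_weak_0)
  then have "y = 0"
    by (simp add: f_def y_def[symmetric] cinner_self)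
  then have "x = 0"
    using SR[of 0 x] by (simp add: y_def blinfun.zero_right)
  with x show False ..
qed

text \<open>If \<open>\<bar>z\<bar>\<close> exceeds the norm of \<open>X T X\<^sup>-\<^sup>1\<close>, the Neumann series inverts \<open>X T X\<^sup>-\<^sup>1 - z\<close>, and conjugating back inverts \<open>T - z\<close>.\<close>

lemma op_spectrum_bound:
  assumes T: "T \<in> bounded_operators" and X: "invertible_op X" and z: "z \<in> op_spectrum T"
  shows "cmod z \<le> norm (similarity X T)"
proof (rule ccontr)
  assume "\<not> cmod z \<le> norm (similarity X T)"
  then have lt: "norm (similarity X T) < cmod z" by simp
  then have nz: "z \<noteq> 0" using norm_ge_zero[of "similarity X T"] by auto
  obtain X' where X': "X' \<in> bounded_operators" "X \<in> bounded_operators" "inverse_op X = X'"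
    "\<And>x. X (X' x) = x" "\<And>x. X' (X x) = x"
    using X by (rule invertible_opE) blast
  define Z where "Z = scaleC_op (1 / z) (similarity X T)"
  have "similarity X T \<in> bounded_operators"
    unfolding similarity_def X'(3) by (intro bounded_operators_compose X' T)
  then have Zb: "Z \<in> bounded_operators"
    unfolding Z_def by (rule bounded_operators_scaleC_op)
  have "norm Z \<le> norm (similarity X T) / cmod z"
    by (rule norm_blinfun_bound)
      (auto simp: Z_def blinfun_apply_scaleC_op norm_scaleC norm_divide divide_right_mono norm_blinfun)
  then have "norm Z < 1"
    using lt nz by (auto intro: order_le_less_trans simp: divide_less_eq_1)
  then have "invertible_op (id_blinfun - Z)"
    by (rule invertible_op_id_minus[OF Zb])
  then obtain R where R: "R \<in> bounded_operators"
    "\<And>x. (id_blinfun - Z) (R x) = x" "\<And>x. R ((id_blinfun - Z) x) = x"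
    by (rule invertible_opE) blast
  have lin: "F (c *\<^sub>C x) = c *\<^sub>C F x" if "F \<in> bounded_operators" for F :: "'a \<Rightarrow>\<^sub>L 'a" and c x
    using that by (simp add: bounded_operators_def)
  have fact: "T x - z *\<^sub>C x = (- z) *\<^sub>C X' ((id_blinfun - Z) (X x))" for x
    using nz by (simp add: Z_def similarity_def X' blinfun.diff_left blinfun.diff_right blinfun_apply_scaleC_op
        lin[OF X'(1)] complex_space.scale_right_diff_distrib complex_space.scale_minus_left)
  define G where "G = scaleC_op (- 1 / z) (X' o\<^sub>L R o\<^sub>L X)"
  have "is_inverse_op (T - scaleC_op z id_blinfun) G"
    unfolding is_inverse_op_def
  proof (intro conjI blinfun_eqI)
    show "G \<in> bounded_operators"
      unfolding G_def by (intro bounded_operators_scaleC_op bounded_operators_compose X' R)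
    fix x
    have Gx: "G x = (- 1 / z) *\<^sub>C X' (R (X x))" for x
      by (simp add: G_def blinfun_apply_scaleC_op)
    have id_Z: "id_blinfun - Z \<in> bounded_operators"
      by (intro bounded_operators_diff bounded_operators_id Zb)
    have ap: "(T - scaleC_op z id_blinfun) x = (- z) *\<^sub>C X' ((id_blinfun - Z) (X x))" for x
      unfolding fact[symmetric] by (simp add: blinfun.diff_left blinfun_apply_scaleC_op)
    show "((T - scaleC_op z id_blinfun) o\<^sub>L G) x = id_blinfun x"
      using nz unfolding blinfun_apply_blinfun_compose ap Gx
      by (simp only: lin[OF X'(2)] lin[OF id_Z] lin[OF X'(1)] X'(4,5) R complex_space.scale_scale) simp
    show "(G o\<^sub>L (T - scaleC_op z id_blinfun)) x = id_blinfun x"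
      using nz unfolding blinfun_apply_blinfun_compose ap Gx
      by (simp only: lin[OF X'(2)] lin[OF R(1)] lin[OF X'(1)] X'(4,5) R complex_space.scale_scale) simp
  qed
  then have "invertible_op (T - scaleC_op z id_blinfun)"
    unfolding invertible_op_def
    by (blast intro: bounded_operators_diff T bounded_operators_scaleC_op bounded_operators_id)
  with z show False by (simp add: op_spectrum_def)
qed

lemma invertible_op_id: "invertible_op id_blinfun"
  by (auto simp: invertible_op_def is_inverse_op_def bounded_operators_id)

lemma spectral_radius_op_le:
  assumes "T \<in> bounded_operators" "invertible_op X"
  shows "spectral_radius_op T \<le> norm (similarity X T)"
  unfolding spectral_radius_op_def
  using op_spectrum_bound[OF assms]
  by (intro cInf_lower) (auto intro: bdd_belowI[of _ 0])

lemma spectral_radius_op_pos: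
  assumes T: "T \<in> bounded_operators" and "\<not> quasinilpotent_op T" "T \<noteq> 0"
  shows "0 < spectral_radius_op T"
proof -
  obtain x where "T x \<noteq> 0"
    using \<open>T \<noteq> 0\<close> by (metis blinfun_eqI zero_blinfun.rep_eq)
  then have "op_spectrum T \<noteq> {}"
    by (rule op_spectrum_nonempty[OF T])
  then obtain z where z: "z \<in> op_spectrum T" "z \<noteq> 0"
    using assms(2) by (auto simp: quasinilpotent_op_def)
  have "cmod z \<le> spectral_radius_op T"
    unfolding spectral_radius_op_def
  proof (rule cInf_greatest)
    show "{r. 0 \<le> r \<and> op_spectrum T \<subseteq> cball 0 r} \<noteq> {}"
      using op_spectrum_bound[OF T invertible_op_id]
      by (auto intro!: exI[of _ "norm (similarity id_blinfun T)"])
    show "cmod z \<le> r" if "r \<in> {r. 0 \<le> r \<and> op_spectrum T \<subseteq> cball 0 r}" for r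
      using that z(1) by auto
  qed
  then show ?thesis
    using z(2) by (meson less_le_trans zero_less_norm_iff)
qed

section \<open>Completely bounded homomorphisms and similarities\<close>

lemma op_matrix_quotients_bdd_above:
  fixes a :: "nat \<Rightarrow> nat \<Rightarrow> 'a::complex_hilbert_space \<Rightarrow>\<^sub>L 'a"
  shows "bdd_above (range (\<lambda>x. L2_set (\<lambda>i. norm (\<Sum>j<d. a i j (x j))) {..<d} / L2_set (\<lambda>j. norm (x j)) {..<d}))"
proof (rule bdd_aboveI2)
  fix x :: "nat \<Rightarrow> 'a"
  define C where "C = (\<Sum>i<d. \<Sum>j<d. norm (a i j))"
  have "L2_set (\<lambda>i. norm (\<Sum>j<d. a i j (x j))) {..<d} \<le> (\<Sum>i<d. norm (\<Sum>j<d. a i j (x j)))"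
    by (rule L2_set_le_sum) simp
  also have "\<dots> \<le> (\<Sum>i<d. \<Sum>j<d. norm (a i j) * L2_set (\<lambda>j. norm (x j)) {..<d})"
  proof (intro sum_mono order_trans[OF norm_sum])
    fix i j assume "j \<in> {..<d}"
    then show "norm (a i j (x j)) \<le> norm (a i j) * L2_set (\<lambda>j. norm (x j)) {..<d}"
      by (intro order_trans[OF norm_blinfun mult_left_mono] member_le_L2_set) auto
  qed
  also have "\<dots> = C * L2_set (\<lambda>j. norm (x j)) {..<d}"
    by (simp add: C_def sum_distrib_right)
  finally have "L2_set (\<lambda>i. norm (\<Sum>j<d. a i j (x j))) {..<d} \<le> C * L2_set (\<lambda>j. norm (x j)) {..<d}" .
  note le = this
  have "0 \<le> C" by (auto simp: C_def intro!: sum_nonneg)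
  then show "L2_set (\<lambda>i. norm (\<Sum>j<d. a i j (x j))) {..<d} / L2_set (\<lambda>j. norm (x j)) {..<d} \<le> C"
  proof (cases "L2_set (\<lambda>j. norm (x j)) {..<d} = 0")
    case False
    then have "0 < L2_set (\<lambda>j. norm (x j)) {..<d}"
      using L2_set_nonneg[of "\<lambda>j. norm (x j)" "{..<d}"] by linarith
    then show ?thesis
      using le by (simp add: pos_divide_le_eq)
  qed simp
qed

lemma op_matrix_norm_le_iff:
  fixes a :: "nat \<Rightarrow> nat \<Rightarrow> 'a::complex_hilbert_space \<Rightarrow>\<^sub>L 'a"
  assumes c: "0 \<le> c"
  shows "op_matrix_norm d a \<le> c \<longleftrightarrow>
    (\<forall>x. (\<Sum>i<d. (norm (\<Sum>j<d. a i j (x j)))\<^sup>2) \<le> c\<^sup>2 * (\<Sum>j<d. (norm (x j))\<^sup>2))"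
proof -
  let ?N = "\<lambda>x :: nat \<Rightarrow> 'a. L2_set (\<lambda>i. norm (\<Sum>j<d. a i j (x j))) {..<d}" and ?D = "\<lambda>x :: nat \<Rightarrow> 'a. L2_set (\<lambda>j. norm (x j)) {..<d}"
  have "op_matrix_norm d a \<le> c \<longleftrightarrow> (\<forall>x. ?N x / ?D x \<le> c)"
    unfolding op_matrix_norm_def by (subst cSUP_le_iff[OF _ op_matrix_quotients_bdd_above]) auto
  also have "\<dots> \<longleftrightarrow> (\<forall>x. ?N x \<le> c * ?D x)"
  proof (intro all_cong1)
    fix x
    show "?N x / ?D x \<le> c \<longleftrightarrow> ?N x \<le> c * ?D x"
    proof (cases "?D x = 0")
      case True
      then have "x j = 0" if "j < d" for j
        using that by (simp add: L2_set_eq_0_iff)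
      then have "?N x = 0"
        by (simp add: blinfun.zero_right L2_set_eq_0_iff)
      with c show ?thesis by simp
    next
      case False
      then have "?D x > 0" using L2_set_nonneg[of "\<lambda>j. norm (x j)" "{..<d}"] by linarith
      then show ?thesis by (simp add: pos_divide_le_eq)
    qed
  qed
  also have "\<dots> \<longleftrightarrow> (\<forall>x. (\<Sum>i<d. (norm (\<Sum>j<d. a i j (x j)))\<^sup>2) \<le> c\<^sup>2 * (\<Sum>j<d. (norm (x j))\<^sup>2))"
  proof (intro all_cong1)
    fix x
    have "c * ?D x = sqrt (c\<^sup>2 * (\<Sum>j<d. (norm (x j))\<^sup>2))"
      using c by (simp add: L2_set_def real_sqrt_mult)
    then show "?N x \<le> c * ?D x \<longleftrightarrow> (\<Sum>i<d. (norm (\<Sum>j<d. a i j (x j)))\<^sup>2) \<le> c\<^sup>2 * (\<Sum>j<d. (norm (x j))\<^sup>2)"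
      by (simp add: L2_set_def)
  qed
  finally show ?thesis .
qed

lemma matrix_contraction_iff: "matrix_contraction d a \<longleftrightarrow> op_matrix_norm d a \<le> 1"
  by (simp add: op_matrix_norm_le_iff matrix_contraction_def)

lemma cb_bounded_of_cb_norm:
  assumes "cb_norm A \<psi> < \<infinity>"
  shows "cb_bounded A \<psi> ((enn2real (cb_norm A \<psi>))\<^sup>2)"
  unfolding cb_bounded_def
proof (intro allI ballI impI)
  fix d a and h :: "nat \<Rightarrow> 'b"
  assume a: "a \<in> op_matrices d A" "matrix_contraction d a"
  define C where "C = enn2real (cb_norm A \<psi>)"
  have C: "ennreal C = cb_norm A \<psi>" "0 \<le> C"
    using assms by (simp_all add: C_def)
  show "(\<Sum>i<d. (norm (\<Sum>j<d. \<psi> (a i j) (h j)))\<^sup>2) \<le> C\<^sup>2 * (\<Sum>j<d. (norm (h j))\<^sup>2)"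
  proof (cases "d = 0")
    case False
    have "ennreal (op_matrix_norm d (\<lambda>i j. \<psi> (a i j))) \<le> cb_norm A \<psi>"
      unfolding cb_norm_def using False a
      by (intro SUP_upper2[of d] SUP_upper2[of a]) (auto simp: matrix_contraction_iff)
    then have "op_matrix_norm d (\<lambda>i j. \<psi> (a i j)) \<le> C"
      using C by (metis ennreal_le_iff)
    then show ?thesis
      unfolding op_matrix_norm_le_iff[OF C(2)] by blast
  qed simp
qed

lemma cb_norm_le_1:
  assumes "cb_bounded A \<psi> 1"
  shows "cb_norm A \<psi> \<le> 1"
  unfolding cb_norm_def
proof (intro SUP_least)
  fix d a assume "a \<in> {a \<in> op_matrices d A. op_matrix_norm d a \<le> 1}"
  then have "a \<in> op_matrices d A" "matrix_contraction d a"
    by (auto simp: matrix_contraction_iff)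
  from cb_boundedD[OF assms this]
  have "op_matrix_norm d (\<lambda>i j. \<psi> (a i j)) \<le> 1"
    by (simp add: op_matrix_norm_le_iff)
  then show "ennreal (op_matrix_norm d (\<lambda>i j. \<psi> (a i j))) \<le> 1"
    by (simp add: ennreal_le_1)
qed

lemma cb_bounded_scaled:
  assumes cb: "cb_bounded A \<psi> K" and A: "\<And>c T. T \<in> A \<Longrightarrow> scaleC_op c T \<in> A"
    and \<psi>: "\<And>c T. T \<in> A \<Longrightarrow> \<psi> (scaleC_op c T) = scaleC_op c (\<psi> T)"
    and a: "a \<in> op_matrices d A" and c: "0 < c"
    and contr: "\<And>x. (\<Sum>i<d. (norm (\<Sum>j<d. a i j (x j)))\<^sup>2) \<le> c\<^sup>2 * (\<Sum>j<d. (norm (x j))\<^sup>2)"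
  shows "(\<Sum>i<d. (norm (\<Sum>j<d. \<psi> (a i j) (h j)))\<^sup>2) \<le> K * c\<^sup>2 * (\<Sum>j<d. (norm (h j))\<^sup>2)"
proof -
  define b where "b i j = scaleC_op (of_real (1 / c)) (a i j)" for i j
  have scaled: "(\<Sum>i<d. (norm (\<Sum>j<d. scaleC_op (of_real (1 / c)) (T i j) (x j)))\<^sup>2)
      = (\<Sum>i<d. (norm (\<Sum>j<d. T i j (x j)))\<^sup>2) / c\<^sup>2" for T :: "nat \<Rightarrow> nat \<Rightarrow> 'c::complex_hilbert_space \<Rightarrow>\<^sub>L 'c" and x
    using c by (simp add: blinfun_apply_scaleC_op norm_scaleC norm_divide power_mult_distrib power_divide
        sum_divide_distrib flip: complex_space.scale_sum_right)
  have "b \<in> op_matrices d A"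
    using a A by (auto simp: op_matrices_def b_def)
  moreover have "matrix_contraction d b"
    unfolding matrix_contraction_def b_def scaled using contr c by (simp add: pos_divide_le_eq mult.commute)
  ultimately have "(\<Sum>i<d. (norm (\<Sum>j<d. \<psi> (b i j) (h j)))\<^sup>2) \<le> K * (\<Sum>j<d. (norm (h j))\<^sup>2)"
    by (rule cb_boundedD[OF cb])
  also have "(\<Sum>i<d. (norm (\<Sum>j<d. \<psi> (b i j) (h j)))\<^sup>2)
      = (\<Sum>i<d. (norm (\<Sum>j<d. scaleC_op (of_real (1 / c)) (\<psi> (a i j)) (h j)))\<^sup>2)"
    using a by (intro sum.cong refl) (simp add: b_def \<psi> op_matrices_def)
  finally show ?thesis
    unfolding scaled using c by (simp add: pos_divide_le_eq mult_ac)
qed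

text \<open>The case of \<open>1 \<times> 1\<close> matrices, rescaled by numbers slightly larger than \<open>\<parallel>T\<parallel>\<close> to allow for \<open>T = 0\<close>.\<close>

lemma cb_bounded_1_norm_le:
  assumes cb: "cb_bounded A \<psi> 1" and A: "\<And>c T. T \<in> A \<Longrightarrow> scaleC_op c T \<in> A"
    and \<psi>: "\<And>c T. T \<in> A \<Longrightarrow> \<psi> (scaleC_op c T) = scaleC_op c (\<psi> T)"
    and T: "T \<in> A"
  shows "norm (\<psi> T) \<le> norm T"
proof (rule field_le_epsilon)
  fix e :: real assume "0 < e"
  define c where "c = norm T + e"
  have c: "0 < c" using \<open>0 < e\<close> by (simp add: c_def add_nonneg_pos)
  have "norm (\<psi> T h) \<le> c * norm h" for h
  proof -
    have "(\<Sum>i<(1::nat). (norm (\<Sum>j<(1::nat). \<psi> T h))\<^sup>2) \<le> 1 * c\<^sup>2 * (\<Sum>j<(1::nat). (norm h)\<^sup>2)"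
    proof (rule cb_bounded_scaled[OF cb A \<psi> _ c, where a = "\<lambda>_ _. T" and d = 1 and h = "\<lambda>_. h"])
      show "(\<lambda>_ _. T) \<in> op_matrices 1 A" using T by (simp add: op_matrices_def)
      fix x :: "nat \<Rightarrow> 'a"
      have "norm (T (x 0)) \<le> c * norm (x 0)"
        using norm_blinfun[of T "x 0"] \<open>0 < e\<close> by (simp add: c_def distrib_right add_increasing2)
      then show "(\<Sum>i<(1::nat). (norm (\<Sum>j<1. T (x j)))\<^sup>2) \<le> c\<^sup>2 * (\<Sum>j<1. (norm (x j))\<^sup>2)"
        by (simp add: power_mono flip: power_mult_distrib)
    qed auto
    then have "(norm (\<psi> T h))\<^sup>2 \<le> (c * norm h)\<^sup>2"
      by (simp add: power_mult_distrib)
    then show ?thesis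
      by (rule power2_le_imp_le) (use c in simp)
  qed
  then have "norm (\<psi> T) \<le> c"
    by (rule norm_blinfun_bound[OF less_imp_le[OF c]])
  then show "norm (\<psi> T) \<le> norm T + e"
    by (simp only: c_def)
qed

lemma similarity_cancel:
  assumes "invertible_op X"
  shows "inverse_op X o\<^sub>L similarity X a o\<^sub>L X = a"
  by (rule blinfun_eqI) (simp add: similarity_def inverse_op_left[OF assms])

lemma similarity_add: "similarity X (a + b) = similarity X a + similarity X b"
  by (simp add: similarity_def blinfun_compose.add_left blinfun_compose.add_right)

lemma similarity_scaleC_op:
  assumes "invertible_op X"
  shows "similarity X (scaleC_op c a) = scaleC_op c (similarity X a)"
proof -
  have "X \<in> bounded_operators" using assms by (simp add: invertible_op_def)
  then show ?thesis
    by (intro blinfun_eqI) (simp add: similarity_def blinfun_apply_scaleC_op bounded_operators_def)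
qed

lemma similarity_compose:
  assumes "invertible_op X"
  shows "similarity X (a o\<^sub>L b) = similarity X a o\<^sub>L similarity X b"
  by (rule blinfun_eqI) (simp add: similarity_def inverse_op_left[OF assms])

lemma similarity_id: "invertible_op X \<Longrightarrow> similarity X id_blinfun = id_blinfun"
  by (rule blinfun_eqI) (simp add: similarity_def inverse_op_right)

lemma similarity_bounded_operators:
  "invertible_op X \<Longrightarrow> a \<in> bounded_operators \<Longrightarrow> similarity X a \<in> bounded_operators"
  unfolding similarity_def
  by (intro bounded_operators_compose inverse_op_bounded) (auto simp: invertible_op_def)

lemma unital_operator_algebra_similarity:
  assumes X: "invertible_op X" and A: "unital_operator_algebra A"
  shows "unital_operator_algebra (similarity X ` A)"
  unfolding unital_operator_algebra_def
proof (intro conjI ballI allI)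
  show "similarity X ` A \<subseteq> bounded_operators"
    using A similarity_bounded_operators[OF X] by (auto simp: unital_operator_algebra_def)
  show "id_blinfun \<in> similarity X ` A"
    using A similarity_id[OF X] by (metis imageI unital_operator_algebra_def)
next
  fix S T assume "S \<in> similarity X ` A" "T \<in> similarity X ` A"
  then show "S + T \<in> similarity X ` A"
    using A by (auto simp: unital_operator_algebra_def simp flip: similarity_add)
next
  fix c T assume "T \<in> similarity X ` A"
  then show "scaleC_op c T \<in> similarity X ` A"
    using A by (auto simp: unital_operator_algebra_def simp flip: similarity_scaleC_op[OF X])
next
  fix S T assume "S \<in> similarity X ` A" "T \<in> similarity X ` A"
  then show "S o\<^sub>L T \<in> similarity X ` A"
    using A by (auto simp: unital_operator_algebra_def simp flip: similarity_compose[OF X])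
qed

locale cb_homomorphism =
  fixes A :: "('a::complex_hilbert_space \<Rightarrow>\<^sub>L 'a) set"
    and \<phi> :: "('a \<Rightarrow>\<^sub>L 'a) \<Rightarrow> ('b::complex_hilbert_space \<Rightarrow>\<^sub>L 'b)"
  assumes A: "unital_operator_algebra A"
    and into: "a \<in> A \<Longrightarrow> \<phi> a \<in> bounded_operators"
    and add: "a \<in> A \<Longrightarrow> b \<in> A \<Longrightarrow> \<phi> (a + b) = \<phi> a + \<phi> b"
    and scale: "a \<in> A \<Longrightarrow> \<phi> (scaleC_op c a) = scaleC_op c (\<phi> a)"
    and mult: "a \<in> A \<Longrightarrow> b \<in> A \<Longrightarrow> \<phi> (a o\<^sub>L b) = \<phi> a o\<^sub>L \<phi> b"
    and unit: "\<phi> id_blinfun = id_blinfun"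
    and cb_finite: "cb_norm A \<phi> < \<infinity>"
begin

lemma A_scale: "a \<in> A \<Longrightarrow> scaleC_op c a \<in> A"
  using A by (auto simp: unital_operator_algebra_def)

text \<open>Conjugation by \<open>X\<close> multiplies matrix norms at most by \<open>\<parallel>X\<^sup>-\<^sup>1\<parallel> \<parallel>X\<parallel>\<close>, at all levels.\<close>

lemma cb_bounded_similarity:
  assumes X: "invertible_op X"
  shows "\<exists>K\<ge>1. cb_bounded (similarity X ` A) (\<lambda>T. \<phi> (inverse_op X o\<^sub>L T o\<^sub>L X)) K"
proof -
  define K0 where "K0 = (enn2real (cb_norm A \<phi>))\<^sup>2"
  define c where "c = 1 + norm (inverse_op X) * norm X"
  have c: "0 < c" by (simp add: c_def add_pos_nonneg)
  have "cb_bounded (similarity X ` A) (\<lambda>T. \<phi> (inverse_op X o\<^sub>L T o\<^sub>L X)) (1 + K0 * c\<^sup>2)"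
    unfolding cb_bounded_def
  proof (intro allI ballI impI)
    fix d S and h :: "nat \<Rightarrow> 'b"
    assume S: "S \<in> op_matrices d (similarity X ` A)" "matrix_contraction d S"
    define a where "a i j = inverse_op X o\<^sub>L S i j o\<^sub>L X" for i j
    have "(\<Sum>i<d. (norm (\<Sum>j<d. \<phi> (a i j) (h j)))\<^sup>2) \<le> K0 * c\<^sup>2 * (\<Sum>j<d. (norm (h j))\<^sup>2)"
    proof (rule cb_bounded_scaled[OF cb_bounded_of_cb_norm[OF cb_finite, folded K0_def] A_scale scale _ c])
      show "a \<in> op_matrices d A"
        using S(1) by (auto simp: op_matrices_def a_def similarity_cancel[OF X])
          (metis imageE similarity_cancel[OF X])
      fix x :: "nat \<Rightarrow> 'a"
      have "(\<Sum>i<d. (norm (\<Sum>j<d. a i j (x j)))\<^sup>2) = (\<Sum>i<d. (norm (inverse_op X (\<Sum>j<d. S i j (X (x j)))))\<^sup>2)"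
        by (simp add: a_def blinfun.sum_right)
      also have "\<dots> \<le> (\<Sum>i<d. (norm (inverse_op X) * norm (\<Sum>j<d. S i j (X (x j))))\<^sup>2)"
        by (intro sum_mono power_mono norm_blinfun) auto
      also have "\<dots> = (norm (inverse_op X))\<^sup>2 * (\<Sum>i<d. (norm (\<Sum>j<d. S i j (X (x j))))\<^sup>2)"
        by (simp add: power_mult_distrib sum_distrib_left)
      also have "\<dots> \<le> (norm (inverse_op X))\<^sup>2 * (\<Sum>j<d. (norm (X (x j)))\<^sup>2)"
        using S(2)[unfolded matrix_contraction_def, rule_format, of "\<lambda>j. X (x j)"] by (intro mult_left_mono) auto
      also have "\<dots> \<le> (norm (inverse_op X))\<^sup>2 * (\<Sum>j<d. (norm X * norm (x j))\<^sup>2)"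
        by (intro mult_left_mono sum_mono power_mono norm_blinfun) auto
      also have "\<dots> = (norm (inverse_op X) * norm X)\<^sup>2 * (\<Sum>j<d. (norm (x j))\<^sup>2)"
        by (simp add: power_mult_distrib sum_distrib_left mult.assoc)
      also have "\<dots> \<le> c\<^sup>2 * (\<Sum>j<d. (norm (x j))\<^sup>2)"
        by (intro mult_right_mono power_mono) (auto simp: c_def intro: sum_nonneg)
      finally show "(\<Sum>i<d. (norm (\<Sum>j<d. a i j (x j)))\<^sup>2) \<le> c\<^sup>2 * (\<Sum>j<d. (norm (x j))\<^sup>2)" .
    qed
    also have "\<dots> \<le> (1 + K0 * c\<^sup>2) * (\<Sum>j<d. (norm (h j))\<^sup>2)"
      by (intro mult_right_mono sum_nonneg) auto
    finally show "(\<Sum>i<d. (norm (\<Sum>j<d. \<phi> (inverse_op X o\<^sub>L S i j o\<^sub>L X) (h j)))\<^sup>2)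
        \<le> (1 + K0 * c\<^sup>2) * (\<Sum>j<d. (norm (h j))\<^sup>2)"
      by (simp add: a_def)
  qed
  moreover have "1 \<le> 1 + K0 * c\<^sup>2" by (simp add: K0_def)
  ultimately show ?thesis by blast
qed

text \<open>Paulsen's theorem, applied to \<open>X a X\<^sup>-\<^sup>1 \<mapsto> \<phi>(a)\<close> on the operator algebra \<open>X A X\<^sup>-\<^sup>1\<close>.\<close>

lemma contractive_similarity_exists:
  assumes X: "invertible_op X"
  shows "\<exists>Y. invertible_op Y \<and> cb_bounded (similarity X ` A) (similarity_map X Y \<phi>) 1"
proof -
  define \<psi> where "\<psi> T = \<phi> (inverse_op X o\<^sub>L T o\<^sub>L X)" for T
  have \<psi>: "\<psi> (similarity X a) = \<phi> a" for a
    by (simp add: \<psi>_def similarity_cancel[OF X])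
  obtain K where K: "1 \<le> K" "cb_bounded (similarity X ` A) \<psi> K"
    using cb_bounded_similarity[OF X] unfolding \<psi>_def by blast
  interpret cb_representation "similarity X ` A" \<psi> K
  proof
    show "unital_operator_algebra (similarity X ` A)"
      by (rule unital_operator_algebra_similarity[OF X A])
    show "\<psi> id_blinfun = id_blinfun"
      using \<psi>[of id_blinfun] by (simp add: similarity_id[OF X] unit)
    show "cb_bounded (similarity X ` A) \<psi> K" "1 \<le> K" by (fact K)+
    fix S assume S: "S \<in> similarity X ` A"
    then obtain a where a: "S = similarity X a" "a \<in> A" by blast
    show "\<psi> S \<in> bounded_operators"
      using a by (simp add: \<psi> into)
    show "\<psi> (scaleC_op c S) = scaleC_op c (\<psi> S)" for c
      unfolding a(1) similarity_scaleC_op[OF X, symmetric] \<psi> by (rule scale[OF a(2)])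
    fix T assume T: "T \<in> similarity X ` A"
    then obtain b where b: "T = similarity X b" "b \<in> A" by blast
    show "\<psi> (S + T) = \<psi> S + \<psi> T"
      unfolding a(1) b(1) similarity_add[symmetric] \<psi> by (rule add[OF a(2) b(2)])
    show "\<psi> (S o\<^sub>L T) = \<psi> S o\<^sub>L \<psi> T"
      unfolding a(1) b(1) similarity_compose[OF X, symmetric] \<psi> by (rule mult[OF a(2) b(2)])
  qed
  obtain Y :: "'b \<Rightarrow>\<^sub>L 'b" where Y: "invertible_op Y" "cb_bounded (similarity X ` A) (\<lambda>T. similarity Y (\<psi> T)) 1"
    by (rule similar_to_completely_contractive)
  have "similarity_map X Y \<phi> = (\<lambda>T. similarity Y (\<psi> T))"
    by (simp add: fun_eq_iff similarity_map_def \<psi>_def)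
  with Y show ?thesis by auto
qed

lemma similarity_map_scaleC_op:
  assumes "invertible_op X" "invertible_op Y" "T \<in> similarity X ` A"
  shows "similarity_map X Y \<phi> (scaleC_op c T) = scaleC_op c (similarity_map X Y \<phi> T)"
proof -
  obtain a where a: "T = similarity X a" "a \<in> A"
    using assms(3) by blast
  show ?thesis
    unfolding a(1) similarity_scaleC_op[OF assms(1), symmetric] similarity_map_similarity[OF assms(1)]
      scale[OF a(2)] similarity_scaleC_op[OF assms(2)] ..
qed

lemma norm_le_of_contractive:
  assumes X: "invertible_op X" and Y: "invertible_op Y"
    and cb: "cb_bounded (similarity X ` A) (similarity_map X Y \<phi>) 1" and a: "a \<in> A"
  shows "norm (similarity Y (\<phi> a)) \<le> norm (similarity X a)"
proof -
  have "norm (similarity_map X Y \<phi> (similarity X a)) \<le> norm (similarity X a)"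
  proof (rule cb_bounded_1_norm_le[OF cb])
    show "scaleC_op c T \<in> similarity X ` A" if "T \<in> similarity X ` A" for c T
      using that by (auto simp: A_scale simp flip: similarity_scaleC_op[OF X])
  qed (use a similarity_map_scaleC_op[OF X Y] in auto)
  then show ?thesis
    by (simp add: similarity_map_similarity[OF X])
qed

lemma complete_contraction_of_contractive:
  assumes X: "invertible_op X" and Y: "invertible_op Y"
    and cb: "cb_bounded (similarity X ` A) (similarity_map X Y \<phi>) 1" and im: "\<phi> ` A = B"
  shows "similarity_map X Y \<phi> ` similarity X ` A = similarity Y ` B"
    and "complete_contraction (similarity X ` A) (similarity Y ` B) (similarity_map X Y \<phi>)"
proof -
  show eq: "similarity_map X Y \<phi> ` similarity X ` A = similarity Y ` B"
    by (simp only: im[symmetric] image_image similarity_map_similarity[OF X])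
  have "similarity_map X Y \<phi> (S + T) = similarity_map X Y \<phi> S + similarity_map X Y \<phi> T"
    if ST: "S \<in> similarity X ` A" "T \<in> similarity X ` A" for S T
  proof -
    obtain a b where a: "S = similarity X a" "a \<in> A" and b: "T = similarity X b" "b \<in> A"
      using ST by blast
    show ?thesis
      unfolding a(1) b(1) similarity_add[of X, symmetric] similarity_map_similarity[OF X]
        add[OF a(2) b(2)] similarity_add[of Y] ..
  qed
  then show "complete_contraction (similarity X ` A) (similarity Y ` B) (similarity_map X Y \<phi>)"
    unfolding complete_contraction_def op_linear_map_def
    by (intro conjI ballI allI equalityD1[OF eq] cb_norm_le_1[OF cb] similarity_map_scaleC_op[OF X Y])
qed

end

section \<open>Alternating similarities\<close>

lemma unital_cb_isomorphism_homomorphism: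
  assumes A: "unital_operator_algebra A" and B: "unital_operator_algebra B"
    and iso: "unital_cb_isomorphism A B \<phi>"
  shows "cb_homomorphism A \<phi>"
proof
  show "unital_operator_algebra A" by (fact A)
  show "\<phi> a \<in> bounded_operators" if "a \<in> A" for a
    using iso B that by (auto simp: unital_cb_isomorphism_def bij_betw_def unital_operator_algebra_def)
qed (use iso in \<open>auto simp: unital_cb_isomorphism_def completely_bounded_map_def op_linear_map_def\<close>)

lemma unital_cb_isomorphism_inverse:
  assumes A: "unital_operator_algebra A" and B: "unital_operator_algebra B"
    and iso: "unital_cb_isomorphism A B \<phi>"
  shows "cb_homomorphism B (the_inv_into A \<phi>)"
proof -
  have bij: "bij_betw \<phi> A B" and inj: "inj_on \<phi> A" and im: "\<phi> ` A = B"
    using iso by (auto simp: unital_cb_isomorphism_def bij_betw_def)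
  have inv: "the_inv_into A \<phi> (\<phi> a) = a" if "a \<in> A" for a
    using the_inv_into_f_f[OF inj that] .
  have cb: "completely_bounded_map B A (the_inv_into A \<phi>)"
    using iso by (simp add: unital_cb_isomorphism_def)
  show ?thesis
  proof
    show "unital_operator_algebra B" by (fact B)
    show "the_inv_into A \<phi> id_blinfun = id_blinfun"
      using inv[of id_blinfun] A iso by (simp add: unital_cb_isomorphism_def unital_operator_algebra_def)
    show "the_inv_into A \<phi> S \<in> bounded_operators" if "S \<in> B" for S
      using that inv A im by (auto simp: unital_operator_algebra_def)
    show "the_inv_into A \<phi> (S o\<^sub>L T) = the_inv_into A \<phi> S o\<^sub>L the_inv_into A \<phi> T"
      if ST: "S \<in> B" "T \<in> B" for S T
    proof -
      obtain a b where a: "S = \<phi> a" "a \<in> A" and b: "T = \<phi> b" "b \<in> A"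
        using ST im by blast
      have "\<phi> a o\<^sub>L \<phi> b = \<phi> (a o\<^sub>L b)" "a o\<^sub>L b \<in> A"
        using iso A a b by (auto simp: unital_cb_isomorphism_def unital_operator_algebra_def)
      then show ?thesis
        by (simp add: a b inv)
    qed
  qed (use cb in \<open>auto simp: completely_bounded_map_def op_linear_map_def\<close>)
qed

lemma norm_le_similarity:
  assumes X: "invertible_op X"
  shows "norm a \<le> norm (inverse_op X) * norm X * norm (similarity X a)"
proof -
  have "norm a = norm (inverse_op X o\<^sub>L similarity X a o\<^sub>L X)"
    by (simp add: similarity_cancel[OF X])
  also have "\<dots> \<le> (norm (inverse_op X) * norm (similarity X a)) * norm X"
    by (intro order_trans[OF norm_blinfun_compose] mult_right_mono norm_blinfun_compose norm_ge_zero)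
  finally show ?thesis by (simp add: mult_ac)
qed

definition contractive_pair :: "('a::complex_hilbert_space \<Rightarrow>\<^sub>L 'a) set \<Rightarrow>
    ('b::complex_hilbert_space \<Rightarrow>\<^sub>L 'b) set \<Rightarrow> (('a \<Rightarrow>\<^sub>L 'a) \<Rightarrow> 'b \<Rightarrow>\<^sub>L 'b) \<Rightarrow>
    ('a \<Rightarrow>\<^sub>L 'a) \<Rightarrow> ('b \<Rightarrow>\<^sub>L 'b) \<Rightarrow> bool"
  where "contractive_pair A B \<phi> X Y \<longleftrightarrow> invertible_op X \<and> invertible_op Y \<and>
    similarity_map X Y \<phi> ` similarity X ` A = similarity Y ` B \<and>
    complete_contraction (similarity X ` A) (similarity Y ` B) (similarity_map X Y \<phi>)"

text \<open>\<open>Y\<^sub>n\<close> is obtained from \<open>X\<^sub>n\<close> by making \<open>X\<^sub>n a X\<^sub>n\<^sup>-\<^sup>1 \<mapsto> \<phi>(a)\<close> completely contractive, and \<open>X\<^sub>n\<^sub>+\<^sub>1\<close> from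
  \<open>Y\<^sub>n\<close> by doing the same for the inverse of \<open>\<phi>\<close>.\<close>

theorem alternating_similarities:
  assumes A: "unital_operator_algebra A" and B: "unital_operator_algebra B"
    and iso: "unital_cb_isomorphism A B \<phi>"
  shows "\<exists>X Y. X 0 = id_blinfun \<and> (\<forall>n::nat. contractive_pair A B \<phi> (X n) (Y n)) \<and>
    (\<forall>n. \<forall>a\<in>A. norm (similarity (Y n) (\<phi> a)) \<le> norm (similarity (X n) a)) \<and>
    (\<forall>n. \<forall>a\<in>A. norm (similarity (X (Suc n)) a) \<le> norm (similarity (Y n) (\<phi> a)))"
proof -
  interpret F: cb_homomorphism A \<phi>
    by (rule unital_cb_isomorphism_homomorphism[OF A B iso])
  interpret G: cb_homomorphism B "the_inv_into A \<phi>"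
    by (rule unital_cb_isomorphism_inverse[OF A B iso])
  have inj: "inj_on \<phi> A" and im: "\<phi> ` A = B"
    using iso by (auto simp: unital_cb_isomorphism_def bij_betw_def)
  obtain f where f: "\<And>X. invertible_op X \<Longrightarrow> invertible_op (f X)"
    "\<And>X. invertible_op X \<Longrightarrow> cb_bounded (similarity X ` A) (similarity_map X (f X) \<phi>) 1"
    using F.contractive_similarity_exists by metis
  obtain g where g: "\<And>Y. invertible_op Y \<Longrightarrow> invertible_op (g Y)"
    "\<And>Y. invertible_op Y \<Longrightarrow> cb_bounded (similarity Y ` B) (similarity_map Y (g Y) (the_inv_into A \<phi>)) 1"
    using G.contractive_similarity_exists by metis
  define X where "X n = ((\<lambda>X. g (f X)) ^^ n) id_blinfun" for n
  have X0: "X 0 = id_blinfun" and X_Suc: "X (Suc n) = g (f (X n))" for n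
    by (simp_all add: X_def)
  have X: "invertible_op (X n)" for n
    by (induction n) (simp_all add: X0 X_Suc invertible_op_id f g)
  have Y: "invertible_op (f (X n))" for n
    by (intro f X)
  have "norm (similarity (f (X n)) (\<phi> a)) \<le> norm (similarity (X n) a)" if "a \<in> A" for n a
    by (rule F.norm_le_of_contractive[OF X Y f(2)[OF X] that])
  moreover have "norm (similarity (X (Suc n)) a) \<le> norm (similarity (f (X n)) (\<phi> a))" if a: "a \<in> A" for n a
  proof -
    have "\<phi> a \<in> B" using a im by blast
    from G.norm_le_of_contractive[OF Y g(1)[OF Y] g(2)[OF Y] this]
    show ?thesis by (simp add: X_Suc the_inv_into_f_f[OF inj a])
  qed
  moreover have "contractive_pair A B \<phi> (X n) (f (X n))" for n
    unfolding contractive_pair_def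
    by (intro conjI X Y F.complete_contraction_of_contractive[OF X Y f(2)[OF X] im])
  ultimately show ?thesis
    by (intro exI[of _ X] exI[of _ "\<lambda>n. f (X n)"] conjI allI ballI X0) simp_all
qed

text \<open>Here \<open>\<alpha>\<close> decreases to a limit and \<open>\<beta> n\<close> lies between \<open>\<alpha> (n + 1)\<close> and \<open>\<alpha> n\<close>.\<close>

lemma eventually_close:
  fixes \<alpha> \<beta> :: "nat \<Rightarrow> real"
  assumes "\<And>n. \<beta> n \<le> \<alpha> n" "\<And>n. \<alpha> (Suc n) \<le> \<beta> n" "\<And>n. 0 \<le> \<alpha> n" "0 < \<delta>"
  shows "\<forall>\<^sub>F n in sequentially. \<alpha> n \<le> \<beta> n + \<delta>"
proof -
  have dec: "decseq \<alpha>"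
    using assms(1,2) by (intro decseq_SucI) (meson order_trans)
  then obtain L where "\<alpha> \<longlonglongrightarrow> L"
    using decseq_convergent[of \<alpha> 0] assms(3) by blast
  then have "(\<lambda>n. \<alpha> n - \<alpha> (Suc n)) \<longlonglongrightarrow> L - L"
    by (intro tendsto_diff LIMSEQ_Suc)
  then have "\<forall>\<^sub>F n in sequentially. \<alpha> n - \<alpha> (Suc n) < \<delta>"
    using assms(4) by (intro order_tendstoD(2)) auto
  then show ?thesis
    by eventually_elim (use assms(2) in \<open>smt (verit)\<close>)
qed

theorem theorem2p2:
  fixes A :: "('a::complex_hilbert_space \<Rightarrow>\<^sub>L 'a) set"
    and B :: "('b::complex_hilbert_space \<Rightarrow>\<^sub>L 'b) set"
    and \<phi> :: "('a \<Rightarrow>\<^sub>L 'a) \<Rightarrow> ('b \<Rightarrow>\<^sub>L 'b)"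
  assumes "unital_operator_algebra A"
    and "unital_operator_algebra B"
    and "unital_cb_isomorphism A B \<phi>"
  shows "\<exists>\<rho> :: real \<Rightarrow> real. (\<forall>\<epsilon>>0. 0 < \<rho> \<epsilon>) \<and>
    (\<forall>\<epsilon>>0. \<forall>A0. finite A0 \<and> A0 \<subseteq> A \<longrightarrow>
      (\<exists>X Y. invertible_op X \<and> invertible_op Y \<and>
        similarity_map X Y \<phi> ` similarity X ` A = similarity Y ` B \<and>
        complete_contraction (similarity X ` A) (similarity Y ` B) (similarity_map X Y \<phi>) \<and>
        (\<forall>a\<in>A0. norm (similarity X a)
          \<le> (1 + \<epsilon>) * (1 + \<epsilon> / \<rho> \<epsilon>) * norm (similarity Y (\<phi> a))) \<and>
        ((\<forall>a\<in>A0. quasinilpotent_op a \<longrightarrow> a = 0) \<longrightarrow>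
          (\<forall>a\<in>A0. norm (similarity X a)
            \<le> (1 + (if A0 \<subseteq> {0} then 0 else \<epsilon> / (INF a\<in>A0 - {0}. spectral_radius_op a)))
                * norm (similarity Y (\<phi> a))))))"
proof -
  obtain X Y where X0: "X 0 = id_blinfun" and pair: "\<And>n::nat. contractive_pair A B \<phi> (X n) (Y n)"
    and down: "\<And>n a. a \<in> A \<Longrightarrow> norm (similarity (Y n) (\<phi> a)) \<le> norm (similarity (X n) a)"
    and up: "\<And>n a. a \<in> A \<Longrightarrow> norm (similarity (X (Suc n)) a) \<le> norm (similarity (Y n) (\<phi> a))"
    using alternating_similarities[OF assms] by blast
  have X: "invertible_op (X n)" for n
    using pair[of n] by (simp add: contractive_pair_def)
  define C where "C = 1 + norm (inverse_op (X 1)) * norm (X 1)"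
  have C: "1 \<le> C" by (simp add: C_def)
  \<comment> \<open>With this choice \<open>1 + \<epsilon> / \<rho> \<epsilon> = 1 + C\<close> does not depend on \<open>\<epsilon>\<close>.\<close>
  define \<rho> where "\<rho> \<epsilon> = \<epsilon> / C" for \<epsilon> :: real
  have ratio: "1 + \<epsilon> / \<rho> \<epsilon> = 1 + C" if "0 < \<epsilon>" for \<epsilon>
    using that C by (simp add: \<rho>_def)
  have coarse: "norm (similarity (X 0) a) \<le> (1 + \<epsilon>) * (1 + \<epsilon> / \<rho> \<epsilon>) * norm (similarity (Y 0) (\<phi> a))"
    if "0 < \<epsilon>" "a \<in> A" for \<epsilon> a
  proof -
    have "similarity (X 0) a = a"
      by (intro blinfun_eqI) (simp add: X0 similarity_def inverse_op_left[OF invertible_op_id, simplified])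
    then have "norm (similarity (X 0) a) \<le> norm (inverse_op (X 1)) * norm (X 1) * norm (similarity (X 1) a)"
      using norm_le_similarity[OF X[of 1], of a] by simp
    also have "\<dots> \<le> (1 + \<epsilon>) * (1 + C) * norm (similarity (Y 0) (\<phi> a))"
    proof (rule mult_mono)
      have "norm (inverse_op (X 1)) * norm (X 1) \<le> 1 * (1 + C)"
        by (simp add: C_def)
      also have "\<dots> \<le> (1 + \<epsilon>) * (1 + C)"
        using that C by (intro mult_right_mono) auto
      finally show "norm (inverse_op (X 1)) * norm (X 1) \<le> (1 + \<epsilon>) * (1 + C)" .
    qed (use up[OF that(2), of 0] that C in auto)
    finally show ?thesis by (simp only: ratio[OF that(1)])
  qed
  have sim_0: "similarity (X n) 0 = 0" for n
    by (simp add: similarity_def blinfun_compose.zero_left blinfun_compose.zero_right)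
  have "\<exists>X Y. contractive_pair A B \<phi> X Y \<and>
        (\<forall>a\<in>A0. norm (similarity X a)
          \<le> (1 + \<epsilon>) * (1 + \<epsilon> / \<rho> \<epsilon>) * norm (similarity Y (\<phi> a))) \<and>
        ((\<forall>a\<in>A0. quasinilpotent_op a \<longrightarrow> a = 0) \<longrightarrow>
          (\<forall>a\<in>A0. norm (similarity X a)
            \<le> (1 + (if A0 \<subseteq> {0} then 0 else \<epsilon> / (INF a\<in>A0 - {0}. spectral_radius_op a)))
                * norm (similarity Y (\<phi> a))))"
    if \<epsilon>: "0 < \<epsilon>" and A0: "finite A0" "A0 \<subseteq> A" for \<epsilon> A0
  proof (cases "(\<forall>a\<in>A0. quasinilpotent_op a \<longrightarrow> a = 0) \<and> \<not> A0 \<subseteq> {0}")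
    case False
    have "\<forall>a\<in>A0. norm (similarity (X 0) a) \<le> (1 + \<epsilon>) * (1 + \<epsilon> / \<rho> \<epsilon>) * norm (similarity (Y 0) (\<phi> a))"
      using coarse[OF \<epsilon>] A0(2) by blast
    moreover have "(\<forall>a\<in>A0. quasinilpotent_op a \<longrightarrow> a = 0) \<longrightarrow>
          (\<forall>a\<in>A0. norm (similarity (X 0) a)
            \<le> (1 + (if A0 \<subseteq> {0} then 0 else \<epsilon> / (INF a\<in>A0 - {0}. spectral_radius_op a)))
                * norm (similarity (Y 0) (\<phi> a)))"
    proof (intro impI ballI)
      fix a assume "\<forall>a\<in>A0. quasinilpotent_op a \<longrightarrow> a = 0" "a \<in> A0"
      then have "A0 \<subseteq> {0}" "a = 0" using False by blast+
      then show "norm (similarity (X 0) a)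
            \<le> (1 + (if A0 \<subseteq> {0} then 0 else \<epsilon> / (INF a\<in>A0 - {0}. spectral_radius_op a)))
                * norm (similarity (Y 0) (\<phi> a))"
        by (simp add: sim_0)
    qed
    ultimately show ?thesis
      using pair[of 0] by blast
  next
    case True
    have A_ops: "a \<in> bounded_operators" if "a \<in> A0" for a
      using that A0(2) assms(1) by (auto simp: unital_operator_algebra_def)
    define m where "m = (INF a\<in>A0 - {0}. spectral_radius_op a)"
    have fin: "finite (spectral_radius_op ` (A0 - {0}))" and ne: "spectral_radius_op ` (A0 - {0}) \<noteq> {}"
      using A0 True by auto
    have m_Min: "m = Min (spectral_radius_op ` (A0 - {0}))"
      unfolding m_def using fin ne by (rule cInf_eq_Min)
    have m_pos: "0 < m"
      unfolding m_Min Min_gr_iff[OF fin ne] using True A_ops by (auto intro!: spectral_radius_op_pos)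
    have m_le: "m \<le> spectral_radius_op a" if "a \<in> A0" "a \<noteq> 0" for a
      unfolding m_Min using that fin by (intro Min_le) auto
    \<comment> \<open>The additive error \<open>\<delta> \<le> \<epsilon> m\<close> yields the factor \<open>1 + \<epsilon>\<close>, and \<open>\<delta> \<le> \<epsilon>\<close> yields the factor \<open>1 + \<epsilon> / m\<close>.\<close>
    define \<delta> where "\<delta> = min \<epsilon> (\<epsilon> * m)"
    have \<delta>: "0 < \<delta>" "\<delta> \<le> \<epsilon>" "\<delta> \<le> \<epsilon> * m"
      using \<epsilon> m_pos by (auto simp: \<delta>_def)
    have "\<forall>\<^sub>F n in sequentially. norm (similarity (X n) a) \<le> norm (similarity (Y n) (\<phi> a)) + \<delta>" if "a \<in> A" for a
      using that by (intro eventually_close down up \<delta>(1)) auto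
    then have "\<forall>\<^sub>F n in sequentially. \<forall>a\<in>A0. norm (similarity (X n) a) \<le> norm (similarity (Y n) (\<phi> a)) + \<delta>"
      using A0 by (intro eventually_ball_finite) auto
    then have "\<exists>n. \<forall>a\<in>A0. norm (similarity (X n) a) \<le> norm (similarity (Y n) (\<phi> a)) + \<delta>"
      by (rule eventually_happens'[OF sequentially_bot])
    then obtain n where n: "\<And>a. a \<in> A0 \<Longrightarrow> norm (similarity (X n) a) \<le> norm (similarity (Y n) (\<phi> a)) + \<delta>"
      by blast
    \<comment> \<open>Each of the norms dominates the next one, and so the spectral radius.\<close>
    have ge_m: "m \<le> norm (similarity (Y n) (\<phi> a))" if a: "a \<in> A0" "a \<noteq> 0" for a
    proof -
      have "a \<in> A" using a(1) A0(2) by blast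
      then show ?thesis
        using m_le[OF a] spectral_radius_op_le[OF A_ops[OF a(1)] X[of "Suc n"]] up[of a n] by linarith
    qed
    have fine: "norm (similarity (X n) a) \<le> (1 + \<epsilon>) * norm (similarity (Y n) (\<phi> a))"
      "norm (similarity (X n) a) \<le> (1 + \<epsilon> / m) * norm (similarity (Y n) (\<phi> a))" if a: "a \<in> A0" for a
    proof -
      define \<beta> where "\<beta> = norm (similarity (Y n) (\<phi> a))"
      have "norm (similarity (X n) a) \<le> (1 + \<epsilon>) * \<beta> \<and> norm (similarity (X n) a) \<le> (1 + \<epsilon> / m) * \<beta>"
      proof (cases "a = 0")
        case True
        have "0 \<le> \<beta>" by (simp add: \<beta>_def)
        then show ?thesis
          using \<epsilon> m_pos by (simp add: True sim_0)
      next
        case False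
        have \<beta>: "m \<le> \<beta>" using ge_m[OF a False] by (simp add: \<beta>_def)
        have "\<delta> \<le> \<epsilon> * \<beta>"
          using \<delta>(3) mult_left_mono[OF \<beta>, of \<epsilon>] \<epsilon> by linarith
        moreover have "\<delta> \<le> \<epsilon> / m * \<beta>"
          using \<delta>(2) mult_left_mono[OF \<beta>, of "\<epsilon> / m"] \<epsilon> m_pos by simp
        ultimately show ?thesis
          using n[OF a] unfolding \<beta>_def[symmetric] distrib_right by linarith
      qed
      then show "norm (similarity (X n) a) \<le> (1 + \<epsilon>) * norm (similarity (Y n) (\<phi> a))"
        "norm (similarity (X n) a) \<le> (1 + \<epsilon> / m) * norm (similarity (Y n) (\<phi> a))"
        by (simp_all add: \<beta>_def)
    qed
    have "norm (similarity (X n) a) \<le> (1 + \<epsilon>) * (1 + \<epsilon> / \<rho> \<epsilon>) * norm (similarity (Y n) (\<phi> a))"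
      if "a \<in> A0" for a
    proof -
      have "(1 + \<epsilon>) * 1 \<le> (1 + \<epsilon>) * (1 + \<epsilon> / \<rho> \<epsilon>)"
        unfolding ratio[OF \<epsilon>] using C \<epsilon> by (intro mult_left_mono) auto
      then have "(1 + \<epsilon>) * norm (similarity (Y n) (\<phi> a)) \<le> (1 + \<epsilon>) * (1 + \<epsilon> / \<rho> \<epsilon>) * norm (similarity (Y n) (\<phi> a))"
        by (intro mult_right_mono) auto
      with fine(1)[OF that] show ?thesis by linarith
    qed
    moreover have "norm (similarity (X n) a)
            \<le> (1 + (if A0 \<subseteq> {0} then 0 else \<epsilon> / (INF a\<in>A0 - {0}. spectral_radius_op a)))
                * norm (similarity (Y n) (\<phi> a))" if "a \<in> A0" for a
      using fine(2)[OF that] True unfolding m_def by simp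
    ultimately show ?thesis
      by (intro exI[of _ "X n"] exI[of _ "Y n"] conjI pair ballI impI)
  qed
  moreover have "\<forall>\<epsilon>>0. 0 < \<rho> \<epsilon>"
    using C by (simp add: \<rho>_def)
  ultimately show ?thesis
    unfolding contractive_pair_def conj_assoc by (intro exI[of _ \<rho>] conjI allI impI) simp_all
qed

end
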